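(* The class of finitary gammoids is closed under taking minors; equivalently, the class of topological gammoids is closed under taking minors.
   Context: Matroids may be infinite (Bruhn et al. axioms (I1)–(I3),(IM)); a matroid is finitary if a set is independent whenever all its finite subsets are. A dimaze $(D,B_0)$ is a digraph $D$ (no loops or parallel edges) with vertex set $V$ and a set $B_0\subseteq V$ of sinks (exits). A linkage is a set of vertex-disjoint finite directed paths ending in $B_0$; $A$ is linkable if some linkage has initial vertex set exactly $A$; $M_L(D,B_0)$ is the pair of $V$ and the linkable sets. A strict gammoid is a matroid isomorphic to some $M_L(D,B_0)$; a gammoid is a restriction of a strict gammoid. $C^O$: vertices $x_i$ ($i\ge1$), $y_i$ ($i\ge2$), edges $(x_i,x_{i+1})$ and $(x_i,y_i)$, exits $\{y_i\}$; $F^\infty$: vertices $v,v_i$ ($i\in\mathbb N$), edges $(v,v_i)$, exits $\{v_i\}$. A subdivision of a dimaze $(D,B_0)$ is obtained by adding a vertex $b_0$ with edges $(b,b_0)$, $b\in B_0$, subdividing edges to get $D''$, then taking $D''-b_0$ with exits the in-neighbourhood of $b_0$. An outgoing comb (resp. linking fan) is a subdimaze (subdigraph with exits a subset of $B_0$) isomorphic to a subdivision of $C^O$ (resp. $F^\infty$); its spine is the subdivided ray $x_1x_2\dots$ (resp. its centre is the image of $v$). $X\subseteq V$ is topologically linkable if there are pairwise disjoint $P_x$ ($x\in X$) starting at $x$, each being the spine of an outgoing comb, a finite path ending at the centre of a linking fan, or a finite path ending in $B_0$. A strict topological gammoid is a matroid of the form $(V,\{\text{topologically linkable sets}\})$;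 a topological gammoid is a restriction of one. *)

theory Defs
  imports "HOL-Library.Disjoint_Sets" "Graph_Theory.Graph_Theory"
begin

section \<open>Infinite matroids\<close>

type_synonym 'a set_system = "'a set \<times> 'a set set"

abbreviation ground :: "'a set_system \<Rightarrow> 'a set" where "ground \<equiv> fst"

abbreviation indep :: "'a set_system \<Rightarrow> 'a set set" where "indep \<equiv> snd"

definition bases :: "'a set_system \<Rightarrow> 'a set set" where
  "bases M = {B \<in> indep M. \<forall>A \<in> indep M. B \<subseteq> A \<longrightarrow> A = B}"

text \<open>The last four conjuncts are the axioms (I1), (I2), (I3) and (IM) of Bruhn et al.\<close>

definition matroid :: "'a set_system \<Rightarrow> bool" where
  "matroid M \<longleftrightarrow>
     indep M \<subseteq> Pow (ground M) \<and>
     {} \<in> indep M \<and>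
     (\<forall>I \<in> indep M. \<forall>J. J \<subseteq> I \<longrightarrow> J \<in> indep M) \<and>
     (\<forall>I \<in> indep M - bases M. \<forall>B \<in> bases M. \<exists>x \<in> B - I. insert x I \<in> indep M) \<and>
     (\<forall>I \<in> indep M. \<forall>X. I \<subseteq> X \<and> X \<subseteq> ground M \<longrightarrow>
        (\<exists>J \<in> indep M. I \<subseteq> J \<and> J \<subseteq> X \<and>
           (\<forall>K \<in> indep M. J \<subseteq> K \<and> K \<subseteq> X \<longrightarrow> K = J)))"

definition finitary :: "'a set_system \<Rightarrow> bool" where
  "finitary M \<longleftrightarrow>
     (\<forall>A \<subseteq> ground M. (\<forall>F \<subseteq> A. finite F \<longrightarrow> F \<in> indep M) \<longrightarrow> A \<in> indep M)"

definition isomorphic :: "'a set_system \<Rightarrow> 'b set_system \<Rightarrow> bool" where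
  "isomorphic M N \<longleftrightarrow>
     (\<exists>f. bij_betw f (ground M) (ground N) \<and> indep N = (`) f ` indep M)"

definition dual :: "'a set_system \<Rightarrow> 'a set_system" where
  "dual M = (ground M, {A. \<exists>B \<in> bases M. A \<subseteq> ground M - B})"

definition restrict_to :: "'a set_system \<Rightarrow> 'a set \<Rightarrow> 'a set_system" where
  "restrict_to M X = (X, indep M \<inter> Pow X)"

definition contract :: "'a set_system \<Rightarrow> 'a set \<Rightarrow> 'a set_system" where
  "contract M X = dual (restrict_to (dual M) (ground M - X))"

definition minor_of :: "'a set_system \<Rightarrow> 'a set_system \<Rightarrow> bool" where
  "minor_of N M \<longleftrightarrow>
     (\<exists>X Y. X \<subseteq> ground M \<and> Y \<subseteq> ground M \<and> X \<inter> Y = {} \<and>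
        N = restrict_to (contract M X) (ground M - X - Y))"


section \<open>Dimazes and linkages\<close>

text \<open>Arcs of a \<open>pair_pre_digraph\<close> are pairs of vertices, which excludes parallel edges.\<close>

definition dimaze :: "'v pair_pre_digraph \<Rightarrow> 'v set \<Rightarrow> bool" where
  "dimaze D B0 \<longleftrightarrow>
     pair_loopfree_digraph D \<and> B0 \<subseteq> pverts D \<and> (\<forall>b \<in> B0. \<forall>v. (b, v) \<notin> parcs D)"

definition linkage :: "'v pair_pre_digraph \<Rightarrow> 'v set \<Rightarrow> 'v list set \<Rightarrow> bool" where
  "linkage D B0 \<Q> \<longleftrightarrow>
     (\<forall>p \<in> \<Q>. vpath p (with_proj D) \<and> last p \<in> B0) \<and>
     (\<forall>p \<in> \<Q>. \<forall>q \<in> \<Q>. p \<noteq> q \<longrightarrow> set p \<inter> set q = {})"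

definition linkable :: "'v pair_pre_digraph \<Rightarrow> 'v set \<Rightarrow> 'v set \<Rightarrow> bool" where
  "linkable D B0 A \<longleftrightarrow> (\<exists>\<Q>. linkage D B0 \<Q> \<and> hd ` \<Q> = A)"

definition M_L :: "'v pair_pre_digraph \<Rightarrow> 'v set \<Rightarrow> 'v set_system" where
  "M_L D B0 = (pverts D, {A. linkable D B0 A})"


section \<open>Subdivisions, outgoing combs and linking fans\<close>

text \<open>
  \<open>H\<close> is a copy of a (possibly infinite) subdivision of \<open>G\<close>: the vertex \<open>u\<close> of \<open>G\<close> becomes
  the branch vertex \<open>\<phi> u\<close>, and the edge \<open>e\<close> is replaced by the path \<open>\<pi> e\<close>.
\<close>

definition inner_verts :: "'w list \<Rightarrow> 'w set" where
  "inner_verts p = set (butlast (tl p))"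

definition subdivides ::
  "'c pair_pre_digraph \<Rightarrow> ('c \<Rightarrow> 'w) \<Rightarrow> ('c \<times> 'c \<Rightarrow> 'w list) \<Rightarrow> 'w pair_pre_digraph \<Rightarrow> bool" where
  "subdivides G \<phi> \<pi> H \<longleftrightarrow>
     inj_on \<phi> (pverts G) \<and>
     (\<forall>e \<in> parcs G. vpath (\<pi> e) (with_proj H) \<and>
        hd (\<pi> e) = \<phi> (fst e) \<and> last (\<pi> e) = \<phi> (snd e) \<and>
        inner_verts (\<pi> e) \<inter> \<phi> ` pverts G = {}) \<and>
     (\<forall>e \<in> parcs G. \<forall>f \<in> parcs G. e \<noteq> f \<longrightarrow> inner_verts (\<pi> e) \<inter> inner_verts (\<pi> f) = {}) \<and>
     pverts H = \<phi> ` pverts G \<union> (\<Union>e \<in> parcs G. set (\<pi> e)) \<and>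
     parcs H = (\<Union>e \<in> parcs G. set (vwalk_arcs (\<pi> e)))"

text \<open>The additional vertex \<open>b\<^sub>0\<close> is \<open>None\<close>.\<close>

definition add_sink :: "'v pair_pre_digraph \<Rightarrow> 'v set \<Rightarrow> 'v option pair_pre_digraph" where
  "add_sink D B0 =
     \<lparr> pverts = insert None (Some ` pverts D),
       parcs = {(Some u, Some v) | u v. (u, v) \<in> parcs D} \<union> {(Some b, None) | b. b \<in> B0} \<rparr>"

definition del_sink :: "'v option pair_pre_digraph \<Rightarrow> 'v pair_pre_digraph" where
  "del_sink H =
     \<lparr> pverts = {v. Some v \<in> pverts H}, parcs = {(u, v). (Some u, Some v) \<in> parcs H} \<rparr>"

definition subdivides_dimaze ::
  "'c pair_pre_digraph \<Rightarrow> 'c set \<Rightarrow> ('c option \<Rightarrow> 'v option)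
     \<Rightarrow> ('c option \<times> 'c option \<Rightarrow> 'v option list)
     \<Rightarrow> 'v pair_pre_digraph \<Rightarrow> 'v set \<Rightarrow> bool" where
  "subdivides_dimaze C C0 \<phi> \<pi> D B0 \<longleftrightarrow>
     (\<exists>H. subdivides (add_sink C C0) \<phi> \<pi> H \<and> \<phi> None = None \<and>
          D = del_sink H \<and> B0 = {b. (Some b, None) \<in> parcs H})"

definition subdimaze ::
  "'v pair_pre_digraph \<Rightarrow> 'v set \<Rightarrow> 'v pair_pre_digraph \<Rightarrow> 'v set \<Rightarrow> bool" where
  "subdimaze D' B' D B0 \<longleftrightarrow> subgraph (with_proj D') (with_proj D) \<and> B' \<subseteq> B0"

datatype comb_vertex = CX nat | CY nat

definition CO :: "comb_vertex pair_pre_digraph" where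
  "CO = \<lparr> pverts = {CX i | i. i \<ge> 1} \<union> {CY i | i. i \<ge> 2},
          parcs = {(CX i, CX (i + 1)) | i. i \<ge> 1} \<union> {(CX i, CY i) | i. i \<ge> 2} \<rparr>"

definition CO_exits :: "comb_vertex set" where
  "CO_exits = {CY i | i. i \<ge> 2}"

datatype fan_vertex = Centre | Leaf nat

definition Finf :: "fan_vertex pair_pre_digraph" where
  "Finf = \<lparr> pverts = insert Centre (range Leaf), parcs = {(Centre, Leaf i) | i. True} \<rparr>"

definition Finf_exits :: "fan_vertex set" where
  "Finf_exits = range Leaf"

text \<open>\<open>S\<close> is the vertex set of the spine, starting at \<open>x\<close>, of an outgoing comb.\<close>

definition outgoing_comb_spine ::
  "'v pair_pre_digraph \<Rightarrow> 'v set \<Rightarrow> 'v \<Rightarrow> 'v set \<Rightarrow> bool" where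
  "outgoing_comb_spine D B0 x S \<longleftrightarrow>
     (\<exists>D' B' \<phi> \<pi>. subdimaze D' B' D B0 \<and> subdivides_dimaze CO CO_exits \<phi> \<pi> D' B' \<and>
        \<phi> (Some (CX 1)) = Some x \<and>
        S = {v. \<exists>i\<ge>1. Some v \<in> set (\<pi> (Some (CX i), Some (CX (i + 1))))})"

definition linking_fan_centre :: "'v pair_pre_digraph \<Rightarrow> 'v set \<Rightarrow> 'v \<Rightarrow> bool" where
  "linking_fan_centre D B0 c \<longleftrightarrow>
     (\<exists>D' B' \<phi> \<pi>. subdimaze D' B' D B0 \<and> subdivides_dimaze Finf Finf_exits \<phi> \<pi> D' B' \<and>
        \<phi> (Some Centre) = Some c)"


section \<open>Gammoids\<close>

text \<open>
  Only the vertex sets of the paths \<open>P x\<close> matter for their disjointness, so \<open>P x\<close> is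
  taken to be that vertex set.
\<close>

definition topological_path ::
  "'v pair_pre_digraph \<Rightarrow> 'v set \<Rightarrow> 'v \<Rightarrow> 'v set \<Rightarrow> bool" where
  "topological_path D B0 x S \<longleftrightarrow>
     outgoing_comb_spine D B0 x S \<or>
     (\<exists>p. vpath p (with_proj D) \<and> hd p = x \<and> S = set p \<and>
        (linking_fan_centre D B0 (last p) \<or> last p \<in> B0))"

definition topologically_linkable :: "'v pair_pre_digraph \<Rightarrow> 'v set \<Rightarrow> 'v set \<Rightarrow> bool" where
  "topologically_linkable D B0 A \<longleftrightarrow> A \<subseteq> pverts D \<and>
     (\<exists>P. (\<forall>x \<in> A. topological_path D B0 x (P x)) \<and> disjoint_family_on P A)"

definition M_TL :: "'v pair_pre_digraph \<Rightarrow> 'v set \<Rightarrow> 'v set_system" where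
  "M_TL D B0 = (pverts D, {A. topologically_linkable D B0 A})"

text \<open>
  HOL cannot quantify over the type of the vertices, so the type \<open>'v\<close> of the vertices of the
  presenting dimaze is a parameter. The ground set of a gammoid may be too small a type to contain
  the strict gammoid of which it is a restriction; therefore restrictions are taken up to
  isomorphism.
\<close>

definition strict_gammoid :: "'v itself \<Rightarrow> 'a set_system \<Rightarrow> bool" where
  "strict_gammoid _ M \<longleftrightarrow> matroid M \<and>
     (\<exists>(D :: 'v pair_pre_digraph) B0. dimaze D B0 \<and> isomorphic M (M_L D B0))"

definition gammoid :: "'v itself \<Rightarrow> 'a set_system \<Rightarrow> bool" where
  "gammoid v M \<longleftrightarrow> matroid M \<and>
     (\<exists>(S :: 'v set_system) X. strict_gammoid v S \<and> X \<subseteq> ground S \<and>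
        isomorphic M (restrict_to S X))"

definition finitary_gammoid :: "'v itself \<Rightarrow> 'a set_system \<Rightarrow> bool" where
  "finitary_gammoid v M \<longleftrightarrow> gammoid v M \<and> finitary M"

definition strict_topological_gammoid :: "'v set_system \<Rightarrow> bool" where
  "strict_topological_gammoid S \<longleftrightarrow> matroid S \<and> (\<exists>D B0. dimaze D B0 \<and> S = M_TL D B0)"

definition topological_gammoid :: "'v itself \<Rightarrow> 'a set_system \<Rightarrow> bool" where
  "topological_gammoid _ M \<longleftrightarrow> matroid M \<and>
     (\<exists>(S :: 'v set_system) X. strict_topological_gammoid S \<and> X \<subseteq> ground S \<and>
        isomorphic M (restrict_to S X))"

text \<open>
  A matroid is a gammoid if it is one with respect to some vertex type. Hence a closure property
  of gammoids has the hypothesis for an arbitrary vertex type and needs one vertex type in its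
  conclusion; the following one is infinite and leaves room for adding vertices to a given dimaze.
\<close>

type_synonym 'v enlarged = "('v + nat) set"

end

theory Submission
  imports Defs
begin

text \<open>
  Call \<open>(U, X)\<close> a barrier of a dimaze if no vertex of \<open>U\<close> is an exit, all out-neighbours of \<open>U\<close> lie
  in \<open>X \<supseteq> U\<close>, and \<open>X - U\<close> is finite; call a set independent if it has at most \<open>|X - U|\<close> elements in
  \<open>X\<close>, for every barrier. By Menger's theorem this means that all its finite subsets are linkable, and
  the independent sets form a finitary matroid. Finitary gammoids and topological gammoids are both
  restrictions of such matroids, the latter because a set is topologically linkable iff it is
  independent (Carmesin).

  Fix a maximal independent set \<open>A\<close>. The barriers with equality for \<open>A\<close> form a lattice that exhausts all
  barriers, and finite linkages of \<open>A\<close> inside them can be glued along this lattice to one injection \<open>m\<close>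
  that maps every non-exit \<open>v\<close> contained in a barrier to itself or to an out-neighbour, has range the
  complement of \<open>A\<close>, and has no infinite orbit inside a barrier, neither forwards nor backwards. The orbits of
  the elements of \<open>A\<close> are then the disjoint paths and rays that make \<open>A\<close> topologically linkable.

  To contract \<open>I \<subseteq> A\<close>, turn the dimaze around along \<open>m\<close>: the exits become \<open>A\<close>, the vertex \<open>m v\<close>
  takes over the neighbourhood of \<open>v\<close>, and \<open>I\<close> is deleted. In the new dimaze every vertex
  reaches only finitely many exits, so that linkable, topologically linkable and
  independent sets coincide.
\<close>

section \<open>Finitary matroids\<close>

text \<open>Barriers are counted because linkability is not of finite character: with
  \<open>Finf\<close> and \<open>Finf_exits\<close> every finite vertex set is linkable, the whole
  vertex set is not. A barrier imposes a finite bound, which is respected as soon as all finite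
  subsets respect it. Gluing is possible because counting forces images: every routing of a taut set
  that avoids \<open>A\<close> maps each taut subset \<open>U\<close> onto the neighbourhood of
  \<open>U\<close> minus \<open>A\<close>. So routings chosen independently of each other do not
  collide. The obstacle is the exclusion of rays. If \<open>m\<close> maps \<open>U\<close> into
  \<open>X\<close>, orbits start in the part of \<open>X\<close> outside the image of
  \<open>U\<close> and end in \<open>X - U\<close>. A forward ray may be a start without an end, a
  backward ray an end without a start. Both must be absent for the two numbers to agree, and this
  agreement is what turns barrier bounds of the old dimaze into barrier bounds of the reversed one.
  A single routing obtained from Menger's theorem moves finitely many vertices, so along a ray the
  taut set in charge would have to change infinitely often; the finiteness of boundaries forbids
  this.\<close>

definition finitary_exchange :: "'a set_system \<Rightarrow> bool" where
  "finitary_exchange M \<longleftrightarrow>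
     indep M \<subseteq> Pow (ground M) \<and> {} \<in> indep M \<and>
     (\<forall>I \<in> indep M. \<forall>J. J \<subseteq> I \<longrightarrow> J \<in> indep M) \<and>
     (\<forall>I \<in> indep M. \<forall>J \<in> indep M. finite I \<and> finite J \<and> card J < card I \<longrightarrow>
        (\<exists>x \<in> I - J. insert x J \<in> indep M)) \<and>
     finitary M"

lemma finitary_exchangeD:
  assumes "finitary_exchange M"
  shows "\<And>I. I \<in> indep M \<Longrightarrow> I \<subseteq> ground M" "{} \<in> indep M"
    "\<And>I J. I \<in> indep M \<Longrightarrow> J \<subseteq> I \<Longrightarrow> J \<in> indep M"
    "\<And>I J. I \<in> indep M \<Longrightarrow> J \<in> indep M \<Longrightarrow> finite I \<Longrightarrow> finite J \<Longrightarrow> card J < card I \<Longrightarrow>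
        \<exists>x \<in> I - J. insert x J \<in> indep M"
    "\<And>A. A \<subseteq> ground M \<Longrightarrow> (\<And>F. F \<subseteq> A \<Longrightarrow> finite F \<Longrightarrow> F \<in> indep M) \<Longrightarrow> A \<in> indep M"
proof -
  have a: "indep M \<subseteq> Pow (ground M)" "{} \<in> indep M"
    "\<forall>I \<in> indep M. \<forall>J. J \<subseteq> I \<longrightarrow> J \<in> indep M"
    "\<forall>I \<in> indep M. \<forall>J \<in> indep M. finite I \<and> finite J \<and> card J < card I \<longrightarrow>
        (\<exists>x \<in> I - J. insert x J \<in> indep M)"
    "\<forall>A \<subseteq> ground M. (\<forall>F \<subseteq> A. finite F \<longrightarrow> F \<in> indep M) \<longrightarrow> A \<in> indep M"
    by (insert assms, unfold finitary_exchange_def finitary_def, (elim conjE, assumption)+)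
  show "\<And>I. I \<in> indep M \<Longrightarrow> I \<subseteq> ground M" using a(1) by blast
  show "{} \<in> indep M" by (fact a(2))
  show "\<And>I J. I \<in> indep M \<Longrightarrow> J \<subseteq> I \<Longrightarrow> J \<in> indep M" using a(3) by simp
  show "\<And>I J. I \<in> indep M \<Longrightarrow> J \<in> indep M \<Longrightarrow> finite I \<Longrightarrow> finite J \<Longrightarrow> card J < card I \<Longrightarrow>
        \<exists>x \<in> I - J. insert x J \<in> indep M" using a(4) by simp
  show "\<And>A. A \<subseteq> ground M \<Longrightarrow> (\<And>F. F \<subseteq> A \<Longrightarrow> finite F \<Longrightarrow> F \<in> indep M) \<Longrightarrow> A \<in> indep M"
    using a(5) by simp
qed

lemma finite_augment:
  assumes M: "finitary_exchange M" and "I \<in> indep M" "J \<in> indep M" "finite I" "finite J"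
    and "card J \<le> card I"
  shows "\<exists>K \<in> indep M. J \<subseteq> K \<and> K \<subseteq> I \<union> J \<and> card K = card I"
  using assms(3,5,6)
proof (induction "card I - card J" arbitrary: J)
  case 0
  then show ?case by (intro bexI[of _ J]) auto
next
  case (Suc n)
  then have "card J < card I" by simp
  then obtain x where x: "x \<in> I - J" "insert x J \<in> indep M"
    using finitary_exchangeD(4)[OF M assms(2) Suc.prems(1) assms(4) Suc.prems(2)] by blast
  have "n = card I - card (insert x J)" "card (insert x J) \<le> card I"
    using Suc.hyps(2) x \<open>finite J\<close> \<open>card J < card I\<close> by auto
  from Suc.hyps(1)[OF this(1) x(2) _ this(2)] \<open>finite J\<close>
  obtain K where "K \<in> indep M" "insert x J \<subseteq> K" "K \<subseteq> I \<union> insert x J" "card K = card I" by blast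
  then show ?case using x by (intro bexI[of _ K]) auto
qed

lemma maximal_extension:
  assumes M: "finitary_exchange M" and I: "I \<in> indep M" "I \<subseteq> X" and X: "X \<subseteq> ground M"
  shows "\<exists>J \<in> indep M. I \<subseteq> J \<and> J \<subseteq> X \<and> (\<forall>K \<in> indep M. J \<subseteq> K \<and> K \<subseteq> X \<longrightarrow> K = J)"
proof -
  let ?A = "{J \<in> indep M. I \<subseteq> J \<and> J \<subseteq> X}"
  have "\<exists>J \<in> ?A. \<forall>K \<in> ?A. J \<subseteq> K \<longrightarrow> K = J"
  proof (rule subset_Zorn_nonempty)
    show "?A \<noteq> {}" using I by blast
    fix \<C> assume \<C>: "\<C> \<noteq> {}" "subset.chain ?A \<C>"
    then have sub: "\<C> \<subseteq> ?A" by (simp add: subset.chain_def)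
    have "\<Union>\<C> \<in> indep M"
    proof (rule finitary_exchangeD(5)[OF M])
      show "\<Union>\<C> \<subseteq> ground M" using sub X by auto
      fix F assume F: "F \<subseteq> \<Union>\<C>" "finite F"
      obtain C where "C \<in> \<C>" "F \<subseteq> C"
        using finite_subset_Union_chain[OF F(2,1) \<C>] by metis
      then show "F \<in> indep M" using sub finitary_exchangeD(3)[OF M, of C F] by auto
    qed
    moreover have "\<Union>\<C> \<subseteq> X" using sub by auto
    moreover have "I \<subseteq> \<Union>\<C>" using sub \<C>(1) by auto
    ultimately show "\<Union>\<C> \<in> ?A" by simp
  qed
  then obtain J where "J \<in> ?A" "\<forall>K \<in> ?A. J \<subseteq> K \<longrightarrow> K = J" by (rule bexE)
  then show ?thesis by (intro bexI[of _ J]) auto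
qed

lemma dependent_finite_subset:
  assumes "finitary_exchange M" "A \<subseteq> ground M" "A \<notin> indep M"
  obtains F where "F \<subseteq> A" "finite F" "F \<notin> indep M"
  using finitary_exchangeD(5)[OF assms(1,2)] assms(3) by blast

lemma insert_dependent_finite:
  assumes M: "finitary_exchange M" and I: "I \<in> indep M" and x: "x \<in> ground M" "insert x I \<notin> indep M"
  obtains F where "F \<subseteq> I" "finite F" "insert x F \<notin> indep M"
proof -
  obtain F where F: "F \<subseteq> insert x I" "finite F" "F \<notin> indep M"
    using dependent_finite_subset[OF M _ x(2)] x(1) finitary_exchangeD(1)[OF M I] by blast
  have "insert x (F - {x}) \<notin> indep M"
    using finitary_exchangeD(3)[OF M, of "insert x (F - {x})" F] F(3) by auto
  then show thesis using that[of "F - {x}"] F by auto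
qed

text \<open>Finite character turns dependence on \<open>I\<close> into dependence on a finite part
  of \<open>I\<close>. Collecting these parts for the elements of \<open>F\<close> reduces questions
  on infinite sets to comparisons of finite cardinalities.\<close>

lemma finite_span:
  assumes M: "finitary_exchange M" and I: "I \<in> indep M" and F: "finite F" "F \<subseteq> ground M"
    and dep: "\<And>x. x \<in> F - I \<Longrightarrow> insert x I \<notin> indep M"
  obtains I1 where "I1 \<subseteq> I" "finite I1" "\<And>x. x \<in> F - I1 \<Longrightarrow> insert x I1 \<notin> indep M"
proof -
  have "\<exists>G. G \<subseteq> I \<and> finite G \<and> insert x G \<notin> indep M" if "x \<in> F - I" for x
  proof -
    have "x \<in> ground M" using that F by auto
    from insert_dependent_finite[OF M I this dep[OF that]] show ?thesis by metis
  qed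
  then obtain G where G: "\<And>x. x \<in> F - I \<Longrightarrow> G x \<subseteq> I \<and> finite (G x) \<and> insert x (G x) \<notin> indep M"
    by metis
  let ?I = "(F \<inter> I) \<union> (\<Union>x\<in>F - I. G x)"
  have "insert x ?I \<notin> indep M" if "x \<in> F - ?I" for x
  proof -
    have x: "x \<in> F - I" using that by auto
    then have "insert x (G x) \<subseteq> insert x ?I" by auto
    then show ?thesis using G[OF x] finitary_exchangeD(3)[OF M, of "insert x ?I" "insert x (G x)"] by metis
  qed
  moreover have "finite ?I" "?I \<subseteq> I" using F G by auto
  ultimately show thesis using that[of ?I] by simp
qed

text \<open>The work is axiom (I3). If no element of the base \<open>B\<close> can be added to
  \<open>I\<close>, but some \<open>y\<close> can, then \<open>y\<close> depends on a finite part
  \<open>B1\<close> of \<open>B\<close>, and \<open>B1\<close> on a finite part \<open>I1\<close> of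
  \<open>I\<close>. A count among finite sets then contradicts the independence of
  \<open>insert y I1\<close>.\<close>

lemma finitary_exchange_matroid:
  assumes M: "finitary_exchange M"
  shows "matroid M"
proof -
  have I3: "\<exists>x \<in> B - I. insert x I \<in> indep M"
    if I: "I \<in> indep M - bases M" and B: "B \<in> bases M" for I B
  proof (rule ccontr)
    assume neg: "\<not> ?thesis"
    obtain I' where I': "I' \<in> indep M" "I \<subseteq> I'" "I' \<noteq> I" using I unfolding bases_def by blast
    then obtain y where y: "y \<in> I'" "y \<notin> I" by blast
    then have yI: "insert y I \<in> indep M" using I' finitary_exchangeD(3)[OF M, of I' "insert y I"] by auto
    then have yB: "y \<notin> B" using neg y by blast
    have Bi: "B \<in> indep M" using B unfolding bases_def by blast
    have "insert y B \<notin> indep M" using B yB unfolding bases_def by blast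
    moreover have yg: "y \<in> ground M" using finitary_exchangeD(1)[OF M yI] by auto
    ultimately obtain B1 where B1: "B1 \<subseteq> B" "finite B1" "insert y B1 \<notin> indep M"
      using insert_dependent_finite[OF M Bi] by (metis (no_types))
    have "B1 \<subseteq> ground M" using B1 finitary_exchangeD(1)[OF M Bi] by auto
    moreover have "insert x I \<notin> indep M" if "x \<in> B1 - I" for x using that neg B1 by blast
    ultimately obtain I1 where I1: "I1 \<subseteq> I" "finite I1" "\<And>x. x \<in> B1 - I1 \<Longrightarrow> insert x I1 \<notin> indep M"
      using finite_span[OF M _ B1(2), of I] I by (metis (no_types, lifting) DiffD1)
    have y1: "insert y I1 \<in> indep M" "I1 \<in> indep M" "B1 \<in> indep M" "y \<notin> I1"
      using finitary_exchangeD(3)[OF M yI, of "insert y I1"] finitary_exchangeD(3)[OF M yI, of I1]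
        finitary_exchangeD(3)[OF M Bi] I1 B1 y by auto
    have "card B1 \<le> card I1"
    proof (rule ccontr)
      assume "\<not> ?thesis"
      then show False using finitary_exchangeD(4)[OF M y1(3,2) B1(2) I1(2)] I1(3) by auto
    qed
    \<comment> \<open>\<open>K\<close> has one element more than \<open>I1\<close> but cannot
      contain \<open>y\<close>, since \<open>y\<close> depends on \<open>B1\<close>. So it lies in
      the span of \<open>I1\<close> and is too large for it.\<close>
    then obtain K where K: "K \<in> indep M" "B1 \<subseteq> K" "K \<subseteq> insert y I1 \<union> B1" "card K = Suc (card I1)"
      using finite_augment[OF M y1(1,3)] I1 B1 y1 by auto
    have "insert y B1 \<subseteq> K \<Longrightarrow> False" using B1 finitary_exchangeD(3)[OF M K(1)] by metis
    then have "K \<subseteq> I1 \<union> B1" using K by auto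
    moreover have "finite K" using K I1 B1 by (meson finite.insertI finite_UnI finite_subset)
    ultimately obtain x where "x \<in> K - I1" "insert x I1 \<in> indep M"
      using finitary_exchangeD(4)[OF M K(1) y1(2) _ I1(2)] K(4) by auto
    moreover have "x \<in> B1 - I1" if "x \<in> K - I1" for x using that \<open>K \<subseteq> I1 \<union> B1\<close> by auto
    ultimately show False using I1(3) by metis
  qed
  show ?thesis
    unfolding matroid_def
  proof (intro conjI ballI allI impI)
    show "indep M \<subseteq> Pow (ground M)" using finitary_exchangeD(1)[OF M] by auto
    show "{} \<in> indep M" by (rule finitary_exchangeD(2)[OF M])
    show "\<And>I J. I \<in> indep M \<Longrightarrow> J \<subseteq> I \<Longrightarrow> J \<in> indep M" by (rule finitary_exchangeD(3)[OF M])
    show "\<And>I B. I \<in> indep M - bases M \<Longrightarrow> B \<in> bases M \<Longrightarrow> \<exists>x\<in>B - I. insert x I \<in> indep M" by (rule I3)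
    show "\<exists>J\<in>indep M. I \<subseteq> J \<and> J \<subseteq> X \<and> (\<forall>K\<in>indep M. J \<subseteq> K \<and> K \<subseteq> X \<longrightarrow> K = J)"
      if "I \<in> indep M" "I \<subseteq> X \<and> X \<subseteq> ground M" for I X
      using maximal_extension[OF M that(1)] that(2) by simp
  qed
qed

text \<open>\<open>I'\<close> spans \<open>C\<close>, so any independent subset of \<open>C\<close>
  may stand in for it next to \<open>J\<close>. On finite parts: extend \<open>I0\<close> inside
  \<open>I1 \<union> J0 \<union> I0\<close> to the size of \<open>I1 \<union> J0\<close>; at most
  \<open>card I1\<close> elements of the extension lie in the span of \<open>I1\<close>, which
  forces all of \<open>J0\<close> into it.\<close>

lemma replace_spanned:
  assumes M: "finitary_exchange M" and I: "I \<in> indep M" "I \<subseteq> C"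
    and I': "I' \<subseteq> C" "\<And>x. x \<in> C - I' \<Longrightarrow> insert x I' \<notin> indep M"
    and J: "J \<inter> C = {}" "I' \<union> J \<in> indep M"
  shows "I \<union> J \<in> indep M"
proof (rule finitary_exchangeD(5)[OF M])
  show g: "I \<union> J \<subseteq> ground M" using finitary_exchangeD(1)[OF M] I J by blast
  fix F assume F: "F \<subseteq> I \<union> J" "finite F"
  define I0 J0 where "I0 = F \<inter> I" and "J0 = F \<inter> J"
  have fin: "finite I0" "finite J0" "F \<subseteq> I0 \<union> J0" "I0 \<subseteq> I" "J0 \<subseteq> J" using F by (auto simp: I0_def J0_def)
  have I'i: "I' \<in> indep M" using finitary_exchangeD(3)[OF M J(2)] by auto
  have "I0 \<subseteq> ground M" using fin g by auto
  moreover have "insert x I' \<notin> indep M" if "x \<in> I0 - I'" for x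
    by (rule I'(2)) (use that fin I in auto)
  ultimately obtain I1 where I1: "I1 \<subseteq> I'" "finite I1" "\<And>x. x \<in> I0 - I1 \<Longrightarrow> insert x I1 \<notin> indep M"
    using finite_span[OF M I'i fin(1)] by (metis (no_types))
  have "I1 \<union> J0 \<subseteq> I' \<union> J" using I1 fin by auto
  then have ind: "I1 \<union> J0 \<in> indep M" "I0 \<in> indep M" "I1 \<in> indep M"
    using finitary_exchangeD(3)[OF M J(2), of "I1 \<union> J0"] finitary_exchangeD(3)[OF M I(1), of I0]
      finitary_exchangeD(3)[OF M I'i, of I1] I1 fin by auto
  have disj: "I1 \<inter> J0 = {}" using I1 fin J I' by blast
  have c0: "card K \<le> card I1" if K: "K \<in> indep M" "K \<subseteq> I0 \<union> I1" for K
  proof (rule ccontr)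
    assume "\<not> ?thesis"
    moreover have "finite K" using K(2) I1 fin by (meson finite_UnI finite_subset)
    ultimately obtain x where "x \<in> K - I1" "insert x I1 \<in> indep M"
      using finitary_exchangeD(4)[OF M K(1) ind(3) _ I1(2)] by (meson not_le)
    moreover have "x \<in> I0 - I1" using \<open>x \<in> K - I1\<close> K(2) by auto
    ultimately show False using I1(3) by metis
  qed
  have "card I0 \<le> card (I1 \<union> J0)" using c0[OF ind(2)] I1 fin by (simp add: card_Un_disjoint disj)
  then obtain K where K: "K \<in> indep M" "I0 \<subseteq> K" "K \<subseteq> I1 \<union> J0 \<union> I0" "card K = card (I1 \<union> J0)"
    using finite_augment[OF M ind(1,2)] I1(2) fin(1,2) by (metis (no_types, lifting) finite_UnI)
  have fK: "finite K" using K I1 fin by (meson finite_UnI finite_subset)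
  have "card (K - J0) \<le> card I1"
    by (rule c0) (use K finitary_exchangeD(3)[OF M K(1)] in auto)
  moreover have "card K = card (K - J0) + card (K \<inter> J0)"
    using fK by (metis Int_Diff_Un Int_Diff_disjoint add.commute card_Un_disjoint finite_Diff finite_Int)
  ultimately have "card J0 \<le> card (K \<inter> J0)"
    using K(4) disj I1 fin by (simp add: card_Un_disjoint)
  then have "K \<inter> J0 = J0" using fin by (meson card_seteq inf_le2)
  then have "F \<subseteq> K" using K fin by auto
  then show "F \<in> indep M" by (rule finitary_exchangeD(3)[OF M K(1)])
qed

lemma extend_to_base:
  assumes M: "finitary_exchange M" and I: "I \<in> indep M"
  obtains B where "B \<in> bases M" "I \<subseteq> B"
proof -
  obtain B where B: "B \<in> indep M" "I \<subseteq> B" "\<forall>K \<in> indep M. B \<subseteq> K \<and> K \<subseteq> ground M \<longrightarrow> K = B"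
    using maximal_extension[OF M I, of "ground M"] finitary_exchangeD(1)[OF M I] by auto
  then have "B \<in> bases M" using finitary_exchangeD(1)[OF M] unfolding bases_def by simp
  then show thesis using B(2) that by simp
qed

text \<open>\<open>contract\<close> dualises twice. The bases of the restricted dual are the
  complements in \<open>ground M - C\<close> of those bases \<open>B\<close> of \<open>M\<close> for
  which \<open>B \<inter> C\<close> is maximal in \<open>C\<close>; by
  \<open>replace_spanned\<close> it does not matter which maximal subset of \<open>C\<close>
  occurs.\<close>

lemma indep_contract:
  assumes M: "finitary_exchange M" and C: "C \<subseteq> ground M"
    and I: "I \<in> indep M" "I \<subseteq> C" "\<And>x. x \<in> C - I \<Longrightarrow> insert x I \<notin> indep M"
  shows "indep (contract M C) = {J. J \<subseteq> ground M - C \<and> I \<union> J \<in> indep M}"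
proof -
  define R where "R = restrict_to (dual M) (ground M - C)"
  have Rind: "A \<in> indep R \<longleftrightarrow> A \<subseteq> ground M - C \<and> (\<exists>B \<in> bases M. A \<inter> B = {})" for A
    by (auto simp: R_def restrict_to_def dual_def)
  have Rg: "ground R = ground M - C" by (simp add: R_def restrict_to_def)
  have baseD: "B \<in> indep M" "B \<subseteq> ground M" if "B \<in> bases M" for B
    using that finitary_exchangeD(1)[OF M] by (auto simp: bases_def)
  \<comment> \<open>Otherwise a base inside \<open>insert x B\<close> keeps
    \<open>B \<inter> C\<close>, gains \<open>x\<close> and so loses some \<open>b\<close> outside
    \<open>C\<close>; then \<open>insert b A\<close> avoids this base, against the maximality of
    \<open>A\<close>.\<close>
  have max: "insert x (B \<inter> C) \<notin> indep M"
    if B: "B \<in> bases M" and A: "A \<in> bases R" "A \<inter> B = {}" and x: "x \<in> C - B" for A B x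
  proof
    assume "insert x (B \<inter> C) \<in> indep M"
    then obtain B' where B': "B' \<in> indep M" "insert x (B \<inter> C) \<subseteq> B'" "B' \<subseteq> insert x B"
      and B'max: "\<forall>K \<in> indep M. B' \<subseteq> K \<and> K \<subseteq> insert x B \<longrightarrow> K = B'"
      using maximal_extension[OF M \<open>insert x (B \<inter> C) \<in> indep M\<close>, of "insert x B"] baseD[OF B] x C
      by (smt (verit, best) Diff_iff inf_le1 insert_mono insert_subset subsetD)
    have B'base: "B' \<in> bases M"
    proof (rule ccontr)
      assume "B' \<notin> bases M"
      then obtain b where "b \<in> B - B'" "insert b B' \<in> indep M"
        using finitary_exchange_matroid[OF M] B' B unfolding matroid_def by (metis DiffI)
      then show False using B'max B' by blast
    qed
    have "insert x B \<notin> indep M" using B x unfolding bases_def by auto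
    then obtain b where b: "b \<in> B" "b \<notin> B'" using B' by (metis insert_subset subsetI subset_antisym)
    then have bC: "b \<notin> C" using B' by blast
    have "insert b A \<in> indep R"
    proof -
      have "insert b A \<inter> B' = {}" using b A B' x by (auto simp: bases_def Rind)
      then show ?thesis using A bC b baseD[OF B] B'base by (auto simp: bases_def Rind)
    qed
    then have "insert b A = A" using A by (auto simp: bases_def)
    then show False using b A by blast
  qed
  have "J \<in> indep (contract M C) \<longleftrightarrow> J \<subseteq> ground M - C \<and> I \<union> J \<in> indep M" for J
  proof
    assume "J \<in> indep (contract M C)"
    then obtain A where A: "A \<in> bases R" and J: "J \<subseteq> ground M - C - A"
      unfolding contract_def R_def[symmetric] by (auto simp: dual_def Rg)
    then obtain B where B: "B \<in> bases M" "A \<inter> B = {}" "A \<subseteq> ground M - C" by (auto simp: bases_def Rind)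
    have "ground M - C - B \<in> indep R" using B by (auto simp: Rind)
    moreover have "A \<subseteq> ground M - C - B" using B by auto
    ultimately have "A = ground M - C - B" using A by (auto simp: bases_def)
    then have JB: "J \<subseteq> B - C" using J by auto
    have "I \<union> J \<in> indep M"
    proof (rule replace_spanned[OF M I(1,2), of "B \<inter> C"])
      show "insert x (B \<inter> C) \<notin> indep M" if "x \<in> C - B \<inter> C" for x
        using max[OF B(1) A B(2)] that by auto
      show "B \<inter> C \<union> J \<in> indep M" using finitary_exchangeD(3)[OF M baseD(1)[OF B(1)], of "B \<inter> C \<union> J"] JB by auto
    qed (use J in auto)
    then show "J \<subseteq> ground M - C \<and> I \<union> J \<in> indep M" using J by auto
  next
    assume J: "J \<subseteq> ground M - C \<and> I \<union> J \<in> indep M"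
    then obtain B where B: "B \<in> bases M" "I \<union> J \<subseteq> B" using extend_to_base[OF M] by blast
    have BC: "B \<inter> C = I"
    proof -
      have "insert x I \<in> indep M" if "x \<in> B \<inter> C" for x
        using that B finitary_exchangeD(3)[OF M baseD(1)[OF B(1)], of "insert x I"] by auto
      then show ?thesis using I B by blast
    qed
    define A where "A = ground M - C - B"
    have "A \<in> bases R"
      unfolding bases_def
    proof (intro CollectI conjI ballI impI)
      show "A \<in> indep R" using B by (auto simp: Rind A_def)
      fix A' assume A': "A' \<in> indep R" "A \<subseteq> A'"
      then obtain B' where B': "B' \<in> bases M" "A' \<inter> B' = {}" and A'C: "A' \<subseteq> ground M - C" by (auto simp: Rind)
      have sub: "B' - C \<subseteq> B - C" using B' A' baseD[OF B'(1)] by (auto simp: A_def)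
      show "A' = A"
      proof (rule ccontr)
        assume "A' \<noteq> A"
        then obtain b where b: "b \<in> A'" "b \<in> B" using A' A'C by (auto simp: A_def)
        then have b': "b \<notin> I" "b \<notin> B'" using A'C I B' by auto
        \<comment> \<open>\<open>?K\<close> is a proper subset of the base \<open>B\<close> because
          it misses \<open>b\<close>. So (I3) against \<open>B'\<close> adds an element, which must
          lie in \<open>B' \<inter> C\<close> and would enlarge \<open>I\<close> inside
          \<open>C\<close>.\<close>
        let ?K = "I \<union> (B' - C)"
        have KB: "?K \<subseteq> B" using B sub by auto
        then have "?K \<in> indep M - bases M"
          using finitary_exchangeD(3)[OF M baseD(1)[OF B(1)]] b b' baseD(1)[OF B(1)] unfolding bases_def by blast
        then obtain x where x: "x \<in> B' - ?K" "insert x ?K \<in> indep M"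
          using finitary_exchange_matroid[OF M] B'(1) unfolding matroid_def by metis
        then have "insert x I \<in> indep M" using finitary_exchangeD(3)[OF M x(2), of "insert x I"] by auto
        then show False using x I by auto
      qed
    qed
    moreover have "J \<subseteq> ground M - C - A" using J B by (auto simp: A_def)
    ultimately show "J \<in> indep (contract M C)"
      unfolding contract_def R_def[symmetric] by (auto simp: dual_def Rg)
  qed
  then show ?thesis by blast
qed

text \<open>A minor depends on the contracted set only through a maximal independent subset
  \<open>I\<close>: the other contracted elements are absent from the ground set of
  \<open>N\<close>. Hence it suffices to contract independent sets.\<close>

lemma indep_minor:
  assumes M: "finitary_exchange M" and N: "minor_of N M"
  obtains I where "I \<in> indep M" "ground N \<subseteq> ground M - I"
    "\<And>J. J \<in> indep N \<longleftrightarrow> J \<subseteq> ground N \<and> I \<union> J \<in> indep M"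
proof -
  obtain C Y where C: "C \<subseteq> ground M" and N: "N = restrict_to (contract M C) (ground M - C - Y)"
    using N unfolding minor_of_def by blast
  obtain I where I: "I \<in> indep M" "I \<subseteq> C" "\<forall>K \<in> indep M. I \<subseteq> K \<and> K \<subseteq> C \<longrightarrow> K = I"
    using maximal_extension[OF M finitary_exchangeD(2)[OF M] _ C] by blast
  then have "insert x I \<notin> indep M" if "x \<in> C - I" for x using that by blast
  note ic = indep_contract[OF M C I(1,2) this]
  show thesis
  proof (rule that[OF I(1)])
    show "ground N \<subseteq> ground M - I" using I by (auto simp: N restrict_to_def)
    show "J \<in> indep N \<longleftrightarrow> J \<subseteq> ground N \<and> I \<union> J \<in> indep M" for J
      using ic by (auto simp: N restrict_to_def)
  qed
qed

section \<open>Systems of neighbourhoods and barriers\<close>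

text \<open>The fixed points lie both in \<open>R\<close> and in its image and cancel: inside the
  finite set \<open>Y\<close> of the remaining points of \<open>X\<close>, the two differences are
  the complements of \<open>E\<close> and of its image.\<close>

lemma card_image_fixing_cofinite:
  assumes inj: "inj_on m R" and fin: "finite {v \<in> R. m v \<noteq> v}" and X: "R \<subseteq> X" "m ` R \<subseteq> X" "finite (X - R)"
  shows "finite (X - m ` R)" "card (X - m ` R) = card (X - R)"
proof -
  define E where "E = {v \<in> R. m v \<noteq> v}"
  define Y where "Y = X - (R - E)"
  have fx: "m v = v" if "v \<in> R - E" for v using that by (auto simp: E_def)
  have mR: "m ` R = m ` E \<union> (R - E)"
  proof -
    have "m ` (R - E) = R - E" using fx by force
    moreover have "R = E \<union> (R - E)" by (auto simp: E_def)
    ultimately show ?thesis by (metis image_Un)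
  qed
  have disj: "m ` E \<inter> (R - E) = {}"
  proof -
    have False if "e \<in> E" "m e \<in> R - E" for e
    proof -
      have "m (m e) = m e" using fx that by blast
      then have "m e = e" using inj that by (auto simp: E_def inj_on_def)
      then show False using that by (auto simp: E_def)
    qed
    then show ?thesis by blast
  qed
  have fE: "finite E" using fin by (simp add: E_def)
  have sub: "E \<subseteq> Y" "m ` E \<subseteq> Y" using X disj by (auto simp: Y_def E_def)
  have cE: "card (m ` E) = card E" by (rule card_image, rule inj_on_subset[OF inj]) (auto simp: E_def)
  have e1: "X - R = Y - E" by (auto simp: Y_def E_def)
  have e2: "X - m ` R = Y - m ` E" unfolding mR Y_def by auto
  have fY: "finite Y" using fE X(3) e1 by (metis finite_Diff2)
  then show "finite (X - m ` R)" using e2 by auto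
  show "card (X - m ` R) = card (X - R)"
    unfolding e1 e2 using fY sub fE cE by (simp add: card_Diff_subset)
qed

text \<open>Formally \<open>card X - card U\<close> is modular in the pair. Since the sets may be
  infinite, the differences are cut into common pieces instead.\<close>

lemma card_boundary_modular:
  assumes "U \<subseteq> X" "U' \<subseteq> X'" "finite (X - U)" "finite (X' - U')"
  shows "card ((X \<union> X') - (U \<union> U')) + card ((X \<inter> X') - (U \<inter> U')) = card (X - U) + card (X' - U')"
    and "finite ((X \<union> X') - (U \<union> U'))" and "finite ((X \<inter> X') - (U \<inter> U'))"
proof -
  define P P' where "P = X - U" and "P' = X' - U'"
  have f: "finite P" "finite P'" using assms by (auto simp: P_def P'_def)
  have u: "(X \<union> X') - (U \<union> U') = (P - X') \<union> ((P' - X) \<union> (P \<inter> P'))"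
    and i: "(X \<inter> X') - (U \<inter> U') = (P \<inter> P') \<union> ((P \<inter> U') \<union> (P' \<inter> U))"
    and p: "P = (P - X') \<union> ((P \<inter> P') \<union> (P \<inter> U'))" and p': "P' = (P' - X) \<union> ((P \<inter> P') \<union> (P' \<inter> U))"
    using assms(1,2) by (auto simp: P_def P'_def)
  show "finite ((X \<union> X') - (U \<union> U'))" "finite ((X \<inter> X') - (U \<inter> U'))" unfolding u i using f by auto
  have "card ((X \<union> X') - (U \<union> U')) = card (P - X') + (card (P' - X) + card (P \<inter> P'))"
    unfolding u using f assms(1,2) by (subst card_Un_disjoint; (subst card_Un_disjoint)?) (auto simp: P_def P'_def)
  moreover have "card ((X \<inter> X') - (U \<inter> U')) = card (P \<inter> P') + (card (P \<inter> U') + card (P' \<inter> U))"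
    unfolding i using f assms(1,2) by (subst card_Un_disjoint; (subst card_Un_disjoint)?) (auto simp: P_def P'_def)
  moreover have "card P = card (P - X') + (card (P \<inter> P') + card (P \<inter> U'))"
    by (subst p, subst card_Un_disjoint; (subst card_Un_disjoint)?) (use f assms(1,2) in \<open>auto simp: P_def P'_def\<close>)
  moreover have "card P' = card (P' - X) + (card (P \<inter> P') + card (P' \<inter> U))"
    by (subst p', subst card_Un_disjoint; (subst card_Un_disjoint)?) (use f assms(1,2) in \<open>auto simp: P_def P'_def\<close>)
  ultimately show "card ((X \<union> X') - (U \<union> U')) + card ((X \<inter> X') - (U \<inter> U')) = card (X - U) + card (X' - U')"
    by (simp add: P_def P'_def)
qed

lemma card_modular:
  assumes "finite (A \<inter> X)" "finite (A \<inter> X')"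
  shows "card (A \<inter> (X \<union> X')) + card (A \<inter> (X \<inter> X')) = card (A \<inter> X) + card (A \<inter> X')"
proof -
  have "A \<inter> (X \<union> X') = (A \<inter> X) \<union> (A \<inter> X')" "A \<inter> (X \<inter> X') = (A \<inter> X) \<inter> (A \<inter> X')" by auto
  then show ?thesis using card_Un_Int[OF assms] by simp
qed

text \<open>
  For a dimaze, \<open>W\<close> consists of the vertices that are not exits, and \<open>N v\<close> of \<open>v\<close> and its
  out-neighbours. Every path from \<open>X\<close> to an exit leaves a barrier through \<open>X - U\<close>.
\<close>

locale nbhd_system =
  fixes V W :: "'v set" and N :: "'v \<Rightarrow> 'v set"
  assumes W_sub: "W \<subseteq> V" and N_self: "v \<in> W \<Longrightarrow> v \<in> N v" and N_sub: "v \<in> W \<Longrightarrow> N v \<subseteq> V"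
begin

text \<open>\<open>X\<close> need not be the neighbourhood of \<open>U\<close>: the intersection of
  two neighbourhoods can exceed the neighbourhood of the intersection, and a free \<open>X\<close>
  keeps barriers closed under intersection.\<close>

definition barrier :: "'v set \<Rightarrow> 'v set \<Rightarrow> bool" where
  "barrier U X \<longleftrightarrow> U \<subseteq> W \<and> X \<subseteq> V \<and> U \<subseteq> X \<and> (\<forall>u \<in> U. N u \<subseteq> X) \<and> finite (X - U)"

definition ind :: "'v set \<Rightarrow> bool" where
  "ind A \<longleftrightarrow> A \<subseteq> V \<and> (\<forall>U X. barrier U X \<longrightarrow> finite (A \<inter> X) \<and> card (A \<inter> X) \<le> card (X - U))"

definition tight :: "'v set \<Rightarrow> 'v set \<Rightarrow> 'v set \<Rightarrow> bool" where
  "tight A U X \<longleftrightarrow> barrier U X \<and> card (A \<inter> X) = card (X - U)"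

lemma barrierD:
  assumes "barrier U X"
  shows "U \<subseteq> W" "X \<subseteq> V" "U \<subseteq> X" "\<And>u. u \<in> U \<Longrightarrow> N u \<subseteq> X" "finite (X - U)"
  using assms unfolding barrier_def by auto

lemma indD:
  assumes "ind A"
  shows "A \<subseteq> V" "\<And>U X. barrier U X \<Longrightarrow> finite (A \<inter> X)" "\<And>U X. barrier U X \<Longrightarrow> card (A \<inter> X) \<le> card (X - U)"
  using assms unfolding ind_def by auto

lemma tightD: "tight A U X \<Longrightarrow> barrier U X" "tight A U X \<Longrightarrow> card (A \<inter> X) = card (X - U)"
  unfolding tight_def by auto

lemma barrier_Un:
  assumes "barrier U X" "barrier U' X'" shows "barrier (U \<union> U') (X \<union> X')"
  using barrierD[OF assms(1)] barrierD[OF assms(2)] card_boundary_modular(2)[of U X U' X']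
  unfolding barrier_def by blast

lemma barrier_Int:
  assumes "barrier U X" "barrier U' X'" shows "barrier (U \<inter> U') (X \<inter> X')"
  using barrierD[OF assms(1)] barrierD[OF assms(2)] card_boundary_modular(3)[of U X U' X']
  unfolding barrier_def by blast

lemma ind_subset: assumes "ind A" "B \<subseteq> A" shows "ind B"
  unfolding ind_def
proof (intro conjI allI impI)
  show "B \<subseteq> V" using indD(1)[OF assms(1)] assms(2) by auto
  fix U X assume b: "barrier U X"
  note f = indD(2)[OF assms(1) b]
  have s: "B \<inter> X \<subseteq> A \<inter> X" using assms(2) by auto
  show "finite (B \<inter> X)" using f s by (rule rev_finite_subset)
  show "card (B \<inter> X) \<le> card (X - U)" using card_mono[OF f s] indD(3)[OF assms(1) b] by simp
qed

lemma ind_empty: "ind {}" by (simp add: ind_def)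

lemma ind_finite_character:
  assumes "A \<subseteq> V" "\<And>F. F \<subseteq> A \<Longrightarrow> finite F \<Longrightarrow> ind F" shows "ind A"
  unfolding ind_def
proof (intro conjI allI impI)
  show "A \<subseteq> V" by fact
  fix U X assume b: "barrier U X"
  have "finite (A \<inter> X) \<and> card (A \<inter> X) \<le> card (X - U)"
  proof (rule finite_if_finite_subsets_card_bdd)
    fix G assume G: "G \<subseteq> A \<inter> X" "finite G"
    then have "ind G" using assms(2) by auto
    moreover have "G \<inter> X = G" using G by auto
    ultimately show "card G \<le> card (X - U)" using indD(3)[OF _ b] by metis
  qed
  then show "finite (A \<inter> X)" "card (A \<inter> X) \<le> card (X - U)" by auto
qed

text \<open>Uncrossing: both sides of the barrier inequality are modular, and the inequality holds
  for union and intersection, so equality of the sums forces equality in each.\<close>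

lemma tight_Un_Int:
  assumes A: "ind A" and t: "tight A U X" "tight A U' X'"
  shows "tight A (U \<union> U') (X \<union> X')" "tight A (U \<inter> U') (X \<inter> X')"
proof -
  note b = tightD(1)[OF t(1)] tightD(1)[OF t(2)]
  have m1: "card ((X \<union> X') - (U \<union> U')) + card ((X \<inter> X') - (U \<inter> U')) = card (X - U) + card (X' - U')"
    by (rule card_boundary_modular(1)) (use barrierD[OF b(1)] barrierD[OF b(2)] in auto)
  have m2: "card (A \<inter> (X \<union> X')) + card (A \<inter> (X \<inter> X')) = card (A \<inter> X) + card (A \<inter> X')"
    by (rule card_modular) (use indD(2)[OF A b(1)] indD(2)[OF A b(2)] in auto)
  note bu = barrier_Un[OF b] and bi = barrier_Int[OF b]
  have "card (A \<inter> (X \<union> X')) \<le> card ((X \<union> X') - (U \<union> U'))" "card (A \<inter> (X \<inter> X')) \<le> card ((X \<inter> X') - (U \<inter> U'))"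
    using indD(3)[OF A bu] indD(3)[OF A bi] by auto
  then show "tight A (U \<union> U') (X \<union> X')" "tight A (U \<inter> U') (X \<inter> X')"
    using m1 m2 tightD(2)[OF t(1)] tightD(2)[OF t(2)] bu bi unfolding tight_def by auto
qed

lemma tight_empty: "tight A {} {}" by (simp add: tight_def barrier_def)

lemma tight_finite_cover:
  assumes A: "ind A" and "finite F" and "\<And>x. x \<in> F \<Longrightarrow> \<exists>U X. tight A U X \<and> x \<in> X"
  shows "\<exists>U X. tight A U X \<and> F \<subseteq> X"
  using assms(2,3)
proof (induction F rule: finite_induct)
  case empty
  then show ?case using tight_empty by blast
next
  case (insert x F)
  then obtain U X where "tight A U X" "F \<subseteq> X" by auto
  moreover obtain U' X' where "tight A U' X'" "x \<in> X'" using insert.prems by blast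
  ultimately show ?case using tight_Un_Int(1)[OF A, of U X U' X'] by blast
qed

text \<open>The violated barrier must contain \<open>y\<close>, and one element raises the count by
  at most one, so the barrier was already tight for \<open>J\<close>.\<close>

lemma tight_if_insert_dependent:
  assumes J: "ind J" "finite J" and y: "y \<in> V" "\<not> ind (insert y J)"
  obtains U X where "tight J U X" "y \<in> X"
proof -
  obtain U X where b: "barrier U X" and c: "\<not> (finite (insert y J \<inter> X) \<and> card (insert y J \<inter> X) \<le> card (X - U))"
    using y indD(1)[OF J(1)] unfolding ind_def by auto
  have c': "card (insert y J \<inter> X) > card (X - U)" using c J(2) by auto
  note le = indD(3)[OF J(1) b]
  have yX: "y \<in> X"
  proof (rule ccontr)
    assume "y \<notin> X"
    then have "insert y J \<inter> X = J \<inter> X" by auto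
    then show False using c' le by simp
  qed
  then have "insert y J \<inter> X = insert y (J \<inter> X)" by auto
  then have "card (insert y J \<inter> X) \<le> Suc (card (J \<inter> X))"
    by (metis card_insert_le_m1 diff_Suc_1 card_insert_if finite_Int J(2) le_Suc_eq order_refl)
  then have "card (J \<inter> X) = card (X - U)" using c' le by simp
  then have "tight J U X" using b by (simp add: tight_def)
  then show thesis using that yX by blast
qed

text \<open>If nothing in \<open>I - J\<close> can be added, a union of tight barriers of
  \<open>J\<close> contains all of \<open>I - J\<close>. Inside it \<open>I\<close> has more
  elements than \<open>J\<close>, hence more than the boundary allows.\<close>

lemma ind_exchange:
  assumes I: "ind I" "finite I" and J: "ind J" "finite J" and less: "card J < card I"
  shows "\<exists>x \<in> I - J. ind (insert x J)"
proof (rule ccontr)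
  assume neg: "\<not> ?thesis"
  have "\<exists>U X. tight J U X \<and> x \<in> X" if x: "x \<in> I - J" for x
  proof -
    have "x \<in> V" "\<not> ind (insert x J)" using x neg indD(1)[OF I(1)] by auto
    from tight_if_insert_dependent[OF J this] show ?thesis by metis
  qed
  then obtain U X where t: "tight J U X" "I - J \<subseteq> X"
    using tight_finite_cover[OF J(1), of "I - J"] I(2) by auto
  have "card I = card (I - J) + card (I \<inter> J)" "card J = card (J - I) + card (I \<inter> J)"
    using card_Int_Diff[OF I(2), of J] card_Int_Diff[OF J(2), of I] by (simp_all add: Int_commute)
  then have "card (J - I) < card (I - J)" using less by simp
  moreover have "I \<inter> X = (I - J) \<union> (I \<inter> J \<inter> X)" using t(2) by auto
  then have "card (I \<inter> X) = card (I - J) + card (I \<inter> J \<inter> X)"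
    using I(2) by (metis (no_types, lifting) Diff_disjoint Int_assoc card_Un_disjoint finite_Diff finite_Int inf_bot_left inf_commute)
  moreover have "card (J \<inter> X) \<le> card (J - I) + card (I \<inter> J \<inter> X)"
  proof -
    have "J \<inter> X \<subseteq> (J - I) \<union> (I \<inter> J \<inter> X)" by auto
    then have "card (J \<inter> X) \<le> card ((J - I) \<union> (I \<inter> J \<inter> X))" using J(2) I(2) by (intro card_mono) auto
    also have "\<dots> \<le> card (J - I) + card (I \<inter> J \<inter> X)" by (rule card_Un_le)
    finally show ?thesis .
  qed
  moreover have "card (I \<inter> X) \<le> card (X - U)" by (rule indD(3)[OF I(1) tightD(1)[OF t(1)]])
  ultimately show False using tightD(2)[OF t(1)] by simp
qed

lemma finitary_exchange_ind: "finitary_exchange (V, {A. ind A})"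
  unfolding finitary_exchange_def finitary_def fst_conv snd_conv mem_Collect_eq
proof (intro conjI ballI allI impI)
  show "{A. ind A} \<subseteq> Pow V" using indD(1) by auto
  show "ind {}" by (rule ind_empty)
  show "ind J" if "I \<in> {A. ind A}" "J \<subseteq> I" for I J using that ind_subset by simp
  show "\<exists>x\<in>I - J. ind (insert x J)"
    if "I \<in> {A. ind A}" "J \<in> {A. ind A}" "finite I \<and> finite J \<and> card J < card I" for I J
    using that ind_exchange by simp
  show "ind A" if "A \<subseteq> V" "\<forall>F\<subseteq>A. finite F \<longrightarrow> ind F" for A
    by (rule ind_finite_character) (use that in auto)
qed

section \<open>Menger's theorem\<close>

text \<open>
  A linkage of \<open>J\<close>: \<open>m\<close> maps each non-exit on one of its paths to the next vertex and
  fixes the other ones.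
\<close>

definition routing :: "'v set \<Rightarrow> ('v \<Rightarrow> 'v) \<Rightarrow> bool" where
  "routing J m \<longleftrightarrow> inj_on m W \<and> (\<forall>v \<in> W. m v \<in> N v) \<and> finite {v \<in> W. m v \<noteq> v} \<and> m ` W \<inter> J = {}"

text \<open>Augmentation along an alternating path: every vertex of \<open>p\<close> takes over the
  image of its successor and the last one takes the free vertex \<open>u\<close>, which releases the
  image of \<open>hd p\<close>. The second conjunct serves the induction: the head must still have
  its old image after the tail has been changed.\<close>

lemma shift_along_path:
  assumes "routing J m" "p \<noteq> []" "distinct p" "set p \<subseteq> W"
    and "successively (\<lambda>v v'. m v' \<in> N v) p" and "u \<in> N (last p)" "u \<notin> m ` W" "u \<notin> J"
  shows "\<exists>m'. routing (insert (m (hd p)) J) m' \<and> (\<forall>v. v \<notin> set p \<longrightarrow> m' v = m v)"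
  using assms(2-8)
proof (induction p rule: induct_list012)
  case 1
  then show ?case by simp
next
  case (2 v)
  let ?m = "m(v := u)"
  have r: "inj_on m W" "\<forall>v \<in> W. m v \<in> N v" "finite {v \<in> W. m v \<noteq> v}" "m ` W \<inter> J = {}"
    using assms(1) by (auto simp: routing_def)
  have v: "v \<in> W" using 2 by auto
  have "inj_on ?m W" using r(1) 2(6) by (auto simp: inj_on_def)
  moreover have "\<forall>v \<in> W. ?m v \<in> N v" using r(2) 2(5) by auto
  moreover have "finite {w \<in> W. ?m w \<noteq> w}"
    by (rule finite_subset[OF _ finite.insertI[OF r(3), of v]]) auto
  moreover have "?m ` W \<inter> insert (m v) J = {}"
  proof -
    have "?m w \<noteq> m v" if "w \<in> W" for w using that v r(1) 2(6) by (auto simp: inj_on_def)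
    moreover have "?m w \<notin> J" if "w \<in> W" for w using that r(4) 2(7) by auto
    ultimately show ?thesis by blast
  qed
  ultimately have "routing (insert (m v) J) ?m" unfolding routing_def by (intro conjI)
  then have "routing (insert (m (hd [v])) J) ?m" by (simp only: list.sel)
  moreover have "\<forall>w. w \<notin> set [v] \<longrightarrow> ?m w = m w" by simp
  ultimately show ?case by (intro exI[of _ ?m] conjI)
next
  case (3 v v1 p)
  have "\<exists>m'. routing (insert (m (hd (v1 # p))) J) m' \<and> (\<forall>w. w \<notin> set (v1 # p) \<longrightarrow> m' w = m w)"
    by (rule "3.IH"(2)) (use "3.prems" in simp_all)
  then obtain m' where m': "routing (insert (m v1) J) m'" "\<forall>w. w \<notin> set (v1 # p) \<longrightarrow> m' w = m w"
    by (elim exE conjE) simp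
  let ?m = "m'(v := m v1)"
  have r: "inj_on m' W" "\<forall>v \<in> W. m' v \<in> N v" "finite {v \<in> W. m' v \<noteq> v}" "m' ` W \<inter> insert (m v1) J = {}"
    using m'(1) by (auto simp: routing_def)
  have v: "v \<in> W" "v1 \<in> W" "m' v = m v" "m v1 \<in> N v" "v \<noteq> v1" using "3.prems" m'(2) by simp_all
  have mm: "inj_on m W" "m ` W \<inter> J = {}" using assms(1) by (auto simp: routing_def)
  have "m' w \<noteq> m v1" if "w \<in> W" for w using r(4) that by blast
  then have "inj_on ?m W" using r(1) unfolding inj_on_def by (metis fun_upd_apply)
  moreover have "\<forall>v \<in> W. ?m v \<in> N v" using r(2) v(4) by auto
  moreover have "finite {w \<in> W. ?m w \<noteq> w}"
    by (rule finite_subset[OF _ finite.insertI[OF r(3), of v]]) auto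
  moreover have "?m ` W \<inter> insert (m v) J = {}"
  proof -
    have "?m w \<noteq> m v" if "w \<in> W" for w
    proof (cases "w = v")
      case True
      then show ?thesis using mm(1) v by (auto simp: inj_on_def)
    next
      case False
      then have "m' w \<noteq> m' v" using r(1) that v(1) by (auto simp: inj_on_def)
      then show ?thesis using False v(3) by simp
    qed
    moreover have "?m w \<notin> J" if "w \<in> W" for w using that r(4) mm(2) v(2) by auto
    ultimately show ?thesis by blast
  qed
  ultimately have "routing (insert (m v) J) ?m" unfolding routing_def by (intro conjI)
  then have "routing (insert (m (hd (v # v1 # p))) J) ?m" by (simp only: list.sel)
  moreover have "\<forall>w. w \<notin> set (v # v1 # p) \<longrightarrow> ?m w = m w" using m'(2) by simp
  ultimately show ?case by (intro exI[of _ ?m] conjI)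
qed

end

lemma rtranclp_distinct_path:
  assumes "r\<^sup>*\<^sup>* a b"
  shows "\<exists>p. p \<noteq> [] \<and> hd p = a \<and> last p = b \<and> distinct p \<and> successively r p"
  using assms
proof (induction rule: rtranclp_induct)
  case base
  show ?case by (intro exI[of _ "[a]"]) auto
next
  case (step y z)
  then obtain p where p: "p \<noteq> []" "hd p = a" "last p = y" "distinct p" "successively r p" by blast
  show ?case
  proof (cases "z \<in> set p")
    case True
    then obtain q q' where q: "p = q @ z # q'" by (meson split_list)
    then have "successively r (q @ [z])" using p(5) by (simp add: successively_append_iff)
    moreover have "hd (q @ [z]) = a" using p(2) q by (cases q) auto
    ultimately show ?thesis using p(4) q by (intro exI[of _ "q @ [z]"]) auto
  next
    case False
    then show ?thesis using p step(2) by (intro exI[of _ "p @ [z]"]) (auto simp: successively_append_iff)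
  qed
qed

context nbhd_system
begin

text \<open>If \<open>y\<close> is occupied as the image of \<open>v0\<close>, an augmenting path is
  sought from \<open>v0\<close>. If there is none, the vertices reached form a barrier whose
  boundary has only \<open>card J\<close> elements, although its \<open>X\<close> contains
  \<open>insert y J\<close>.\<close>

lemma routing_insert:
  assumes r: "routing J m" and J: "finite J" "J \<subseteq> V" and y: "y \<in> V" and ind: "ind (insert y J)"
  shows "\<exists>m'. routing (insert y J) m'"
proof (cases "y \<in> m ` W \<and> y \<notin> J")
  case False
  then show ?thesis using r by (cases "y \<in> J") (auto simp: routing_def insert_absorb)
next
  case True
  have r': "inj_on m W" "\<forall>v \<in> W. m v \<in> N v" "finite {v \<in> W. m v \<noteq> v}" "m ` W \<inter> J = {}"
    using r by (auto simp: routing_def)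
  obtain v0 where v0: "v0 \<in> W" "m v0 = y" using True by blast
  \<comment> \<open>An arc of the search: \<open>v\<close> may take over the present image of
    \<open>v'\<close>.\<close>
  define E where "E v v' \<longleftrightarrow> v \<in> W \<and> v' \<in> W \<and> m v' \<in> N v" for v v'
  define R where "R = {v. E\<^sup>*\<^sup>* v0 v}"
  have RW: "R \<subseteq> W"
  proof
    fix v assume "v \<in> R"
    then have "E\<^sup>*\<^sup>* v0 v" by (simp add: R_def)
    then show "v \<in> W" by (cases rule: rtranclp.cases) (auto simp: v0 E_def)
  qed
  have "\<exists>v\<in>R. \<exists>u \<in> N v. u \<notin> m ` W \<and> u \<notin> J"
  proof (rule ccontr)
    assume neg: "\<not> ?thesis"
    \<comment> \<open>Closed under the neighbourhoods of \<open>R\<close>: a neighbour that is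
      neither in \<open>J\<close> nor free is an image, and then its preimage is reached
      too.\<close>
    define X where "X = m ` R \<union> J"
    have NX: "N v \<subseteq> X" if v: "v \<in> R" for v
    proof
      fix u assume u: "u \<in> N v"
      show "u \<in> X"
      proof (cases "u \<in> J")
        case False
        then obtain v' where v': "v' \<in> W" "u = m v'" using neg u v by blast
        then have "E v v'" using u v RW by (auto simp: E_def)
        then have "v' \<in> R" using v by (auto simp: R_def intro: rtranclp.rtrancl_into_rtrancl)
        then show ?thesis using v' by (auto simp: X_def)
      qed (auto simp: X_def)
    qed
    have RX: "R \<subseteq> X" using NX N_self RW by blast
    have mRX: "m ` R \<subseteq> X" by (auto simp: X_def)
    have finR: "finite {v \<in> R. m v \<noteq> v}" by (rule finite_subset[OF _ r'(3)]) (use RW in auto)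
    have injR: "inj_on m R" using r'(1) RW by (rule inj_on_subset)
    have XmR: "X - m ` R = J" using r'(4) RW by (auto simp: X_def)
    have "X - R \<subseteq> J \<union> m ` {v \<in> R. m v \<noteq> v}" by (force simp: X_def)
    then have fin: "finite (X - R)" using J(1) finR by (meson finite_UnI finite_imageI finite_subset)
    have card: "card (X - R) = card J"
      using card_image_fixing_cofinite(2)[OF injR finR RX mRX fin] XmR by simp
    have "X \<subseteq> V"
    proof -
      have "m v \<in> V" if "v \<in> R" for v using that RW r'(2) N_sub by blast
      then show ?thesis using J(2) by (auto simp: X_def)
    qed
    then have b: "barrier R X" using RW RX NX fin by (simp add: barrier_def)
    have "y \<in> X" using v0 by (auto simp: X_def R_def)
    then have "insert y J \<inter> X = insert y J" by (auto simp: X_def)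
    then have "card (insert y J) \<le> card J" using indD(3)[OF ind b] card by simp
    then show False using True J(1) by simp
  qed
  then obtain v u where vu: "v \<in> R" "u \<in> N v" "u \<notin> m ` W" "u \<notin> J" by blast
  obtain p where p: "p \<noteq> []" "hd p = v0" "last p = v" "distinct p" "successively E p"
    using rtranclp_distinct_path[of E v0 v] vu(1) by (auto simp: R_def)
  have "set p \<subseteq> W"
  proof (cases p)
    case (Cons a q)
    have "set q \<subseteq> W" if "successively E (a # q)" for a q
      using that by (induction q arbitrary: a) (auto simp: E_def)
    then show ?thesis using Cons p v0 by auto
  qed (use p in auto)
  moreover have "successively (\<lambda>v v'. m v' \<in> N v) p"
    by (rule successively_mono[OF p(5)]) (auto simp: E_def)
  ultimately have "\<exists>m'. routing (insert (m (hd p)) J) m' \<and> (\<forall>v. v \<notin> set p \<longrightarrow> m' v = m v)"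
    using shift_along_path[OF r p(1,4)] vu p(3) by simp
  then show ?thesis using p(2) v0(2) by auto
qed

theorem menger:
  assumes "finite J" "ind J"
  shows "\<exists>m. routing J m"
  using assms
proof (induction J rule: finite_induct)
  case empty
  have "routing {} (\<lambda>v. v)" using N_self by (auto simp: routing_def)
  then show ?case by blast
next
  case (insert y J)
  then obtain m where "routing J m" using ind_subset by blast
  then show ?case using routing_insert insert indD(1)[OF insert.prems] by auto
qed

end

section \<open>Shifting along a maximal independent set\<close>

definition no_ray :: "('v \<Rightarrow> 'v) \<Rightarrow> 'v set \<Rightarrow> bool" where
  "no_ray m U \<longleftrightarrow> \<not> (\<exists>f :: nat \<Rightarrow> 'v. inj f \<and> range f \<subseteq> U \<and> (\<forall>i. f (Suc i) = m (f i)))"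

text \<open>Injectivity traces a repetition in the orbit back to a return to \<open>z\<close>, which
  has no preimage.\<close>

lemma inj_on_funpow:
  assumes inj: "inj_on m U" and z: "z \<notin> m ` U" and U: "\<And>i. i < k \<Longrightarrow> (m ^^ i) z \<in> U"
  shows "inj_on (\<lambda>i. (m ^^ i) z) {..k}"
proof -
  have "(m ^^ i) z \<noteq> (m ^^ (i + Suc d)) z" if "i + Suc d \<le> k" for i d
    using that
  proof (induction i)
    case 0
    then show ?case using z U[of d] by auto
  next
    case (Suc i)
    have "(m ^^ Suc i) z = m ((m ^^ i) z)" "(m ^^ (Suc i + Suc d)) z = m ((m ^^ (i + Suc d)) z)" by simp_all
    then show ?case using inj_onD[OF inj _ U[of i] U[of "i + Suc d"]] Suc by (metis Suc_leD Suc_le_lessD add_Suc less_add_Suc1 order_le_less_trans order_less_le_trans)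
  qed
  then have "(m ^^ i) z \<noteq> (m ^^ j) z" if "i < j" "j \<le> k" for i j
    using that less_iff_Suc_add[of i j] by auto
  then show ?thesis by (intro inj_onI) (metis atMost_iff nat_neq_iff)
qed

lemma inj_funpow:
  assumes "inj_on m U" "z \<notin> m ` U" "\<And>i. (m ^^ i) z \<in> U"
  shows "inj (\<lambda>i. (m ^^ i) z)"
proof (rule injI)
  fix i j assume "(m ^^ i) z = (m ^^ j) z"
  moreover have "inj_on (\<lambda>i. (m ^^ i) z) {..max i j}" by (rule inj_on_funpow) (use assms in auto)
  ultimately show "i = j" by (auto dest: inj_onD)
qed

text \<open>
  Restricting \<open>m\<close> to the finitely many orbits that start in \<open>Z\<close> reduces the claim to maps that move
  finitely many points.
\<close>

lemma card_sources_le: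
  fixes m :: "'a \<Rightarrow> 'a"
  assumes inj: "inj_on m U" and X: "U \<subseteq> X" "m ` U \<subseteq> X" "finite (X - U)" and nr: "no_ray m U"
  shows "finite (X - m ` U) \<and> card (X - m ` U) \<le> card (X - U)"
proof (rule finite_if_finite_subsets_card_bdd)
  fix Z assume Z: "Z \<subseteq> X - m ` U" "finite Z"
  define orb where "orb z = {(m ^^ i) z | i. \<forall>j\<le>i. (m ^^ j) z \<in> U}" for z
  have fin: "finite (orb z)" if "z \<in> Z" for z
  proof -
    have "\<exists>k. (m ^^ k) z \<notin> U"
    proof (rule ccontr)
      assume "\<not> ?thesis"
      then have all: "(m ^^ i) z \<in> U" for i by auto
      have "z \<notin> m ` U" using that Z by auto
      from inj_funpow[OF inj this all] have "inj (\<lambda>i. (m ^^ i) z)" .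
      moreover have "range (\<lambda>i. (m ^^ i) z) \<subseteq> U" using all by auto
      moreover have "\<forall>i. (m ^^ Suc i) z = m ((m ^^ i) z)" by simp
      ultimately have "\<exists>f :: nat \<Rightarrow> 'a. inj f \<and> range f \<subseteq> U \<and> (\<forall>i. f (Suc i) = m (f i))"
        by (intro exI[of _ "\<lambda>i. (m ^^ i) z"] conjI)
      then show False using nr unfolding no_ray_def by contradiction
    qed
    then obtain k where k: "(m ^^ k) z \<notin> U" by blast
    have "orb z \<subseteq> (\<lambda>i. (m ^^ i) z) ` {..<k}"
    proof
      fix y assume "y \<in> orb z"
      then obtain i where i: "y = (m ^^ i) z" "\<forall>j\<le>i. (m ^^ j) z \<in> U" by (auto simp: orb_def)
      then have "i < k" using k not_le by blast
      then show "y \<in> (\<lambda>i. (m ^^ i) z) ` {..<k}" using i(1) by simp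
    qed
    then show ?thesis by (rule finite_subset) simp
  qed
  define E where "E = (\<Union>z\<in>Z. orb z)"
  have EU: "E \<subseteq> U" by (auto simp: E_def orb_def)
  have fE: "finite E" using fin Z by (auto simp: E_def)
  have step: "m e \<in> E" if e: "e \<in> E" "m e \<in> U" for e
  proof -
    obtain z i where z: "z \<in> Z" "e = (m ^^ i) z" "\<forall>j\<le>i. (m ^^ j) z \<in> U"
      using e(1) unfolding E_def orb_def by blast
    then have "m e = (m ^^ Suc i) z" "\<forall>j\<le>Suc i. (m ^^ j) z \<in> U" using e(2) by (auto simp: le_Suc_eq)
    then have "m e \<in> orb z" unfolding orb_def by blast
    then show ?thesis using z(1) by (auto simp: E_def)
  qed
  have start: "z \<in> E" if "z \<in> Z" "z \<in> U" for z
  proof -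
    have "z \<in> orb z" unfolding orb_def using that by (intro CollectI exI[of _ 0]) auto
    then show ?thesis using that by (auto simp: E_def)
  qed
  \<comment> \<open>Identity off the orbits. Inside \<open>U\<close> the set \<open>E\<close> is
    closed under \<open>m\<close>, so \<open>m'\<close> is still injective, and it moves only the
    finitely many points of \<open>E\<close>.\<close>
  define m' where "m' u = (if u \<in> E then m u else u)" for u
  have mE: "inj_on m E" using inj EU by (rule inj_on_subset)
  have "inj_on m' U"
  proof (rule inj_onI)
    fix u v assume u: "u \<in> U" "v \<in> U" "m' u = m' v"
    consider "u \<in> E" "v \<in> E" | "u \<in> E" "v \<notin> E" | "u \<notin> E" "v \<in> E" | "u \<notin> E" "v \<notin> E" by blast
    then show "u = v"
    proof cases
      case 1 then show ?thesis using u mE by (auto simp: m'_def inj_on_def)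
    next
      case 2 then show ?thesis using u step[of u] by (auto simp: m'_def)
    next
      case 3 then show ?thesis using u step[of v] by (auto simp: m'_def)
    next
      case 4 then show ?thesis using u by (auto simp: m'_def)
    qed
  qed
  moreover have "finite {v \<in> U. m' v \<noteq> v}" by (rule finite_subset[OF _ fE]) (auto simp: m'_def)
  moreover have "m' ` U \<subseteq> X" using X EU by (auto simp: m'_def)
  ultimately have c: "finite (X - m' ` U)" "card (X - m' ` U) = card (X - U)"
    using card_image_fixing_cofinite[of m' U X] X by auto
  have "Z \<inter> m' ` U = {}"
  proof -
    have False if z: "z \<in> Z" "u \<in> U" "z = m' u" for z u
    proof (cases "u \<in> E")
      case True
      then show ?thesis using z Z EU by (auto simp: m'_def)
    next
      case False
      then show ?thesis using z start[of z] by (auto simp: m'_def)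
    qed
    then show ?thesis by blast
  qed
  then have "Z \<subseteq> X - m' ` U" using Z by auto
  then show "card Z \<le> card (X - U)" using card_mono[OF c(1)] c(2) by metis
qed

context nbhd_system
begin

section \<open>The lattice of taut sets\<close>

definition nb :: "'v set \<Rightarrow> 'v set" where "nb U = (\<Union>u\<in>U. N u)"

text \<open>Tightness with the least possible \<open>X\<close>, so that a tight barrier is described
  by a single set and hulls can be formed. By \<open>tight_taut\<close>, whatever is dropped from
  \<open>X\<close> lies in \<open>A\<close>.\<close>

definition taut :: "'v set \<Rightarrow> 'v set \<Rightarrow> bool" where "taut A U \<longleftrightarrow> tight A U (nb U)"

lemma nb_mono: "U \<subseteq> U' \<Longrightarrow> nb U \<subseteq> nb U'"
  by (auto simp: nb_def)

lemma nb_Un: "nb (U \<union> U') = nb U \<union> nb U'"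
  by (auto simp: nb_def)

lemma sub_nb: "U \<subseteq> W \<Longrightarrow> U \<subseteq> nb U"
  using N_self by (auto simp: nb_def)

lemma barrier_nb:
  assumes "barrier U X" shows "barrier U (nb U)" "nb U \<subseteq> X"
proof -
  show s: "nb U \<subseteq> X" using barrierD(4)[OF assms] by (simp add: nb_def UN_least)
  have "finite (nb U - U)" by (rule finite_subset[OF _ barrierD(5)[OF assms]]) (use s in auto)
  moreover have "nb U \<subseteq> V" using s barrierD[OF assms] by auto
  moreover have "\<forall>u\<in>U. N u \<subseteq> nb U" by (auto simp: nb_def)
  ultimately show "barrier U (nb U)"
    unfolding barrier_def using sub_nb barrierD(1)[OF assms] by simp
qed

text \<open>Passing from \<open>nb U\<close> to \<open>X\<close> adds every new vertex to the
  boundary but only those of \<open>A\<close> to the count. So tightness of the larger pair forces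
  the new vertices into \<open>A\<close> and the smaller pair to be tight.\<close>

lemma tight_taut:
  assumes A: "ind A" and t: "tight A U X"
  shows "taut A U" "X - A \<subseteq> nb U"
proof -
  note b = tightD(1)[OF t]
  note b' = barrier_nb[OF b]
  have U: "U \<subseteq> nb U" using sub_nb barrierD(1)[OF b] by auto
  have fX: "finite (X - U)" "finite (A \<inter> X)" using barrierD(5)[OF b] indD(2)[OF A b] by auto
  have fd: "finite (X - nb U)" by (rule finite_subset[OF _ fX(1)]) (use U in auto)
  have "X - U = (nb U - U) \<union> (X - nb U)" using U b'(2) by auto
  then have c1: "card (X - U) = card (nb U - U) + card (X - nb U)"
    using fd barrierD(5)[OF b'(1)] by (simp add: card_Un_disjoint disjoint_iff)
  have "A \<inter> X = (A \<inter> nb U) \<union> (A \<inter> (X - nb U))" using b'(2) by auto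
  moreover have "(A \<inter> nb U) \<inter> (A \<inter> (X - nb U)) = {}" by auto
  ultimately have c2: "card (A \<inter> X) = card (A \<inter> nb U) + card (A \<inter> (X - nb U))"
    using fd indD(2)[OF A b'(1)] by (metis card_Un_disjoint finite_Int)
  have c3: "card (A \<inter> nb U) \<le> card (nb U - U)" by (rule indD(3)[OF A b'(1)])
  have c4: "card (A \<inter> (X - nb U)) \<le> card (X - nb U)" by (rule card_mono[OF fd]) auto
  have e: "card (A \<inter> nb U) = card (nb U - U)" "card (A \<inter> (X - nb U)) = card (X - nb U)"
    using c1 c2 c3 c4 tightD(2)[OF t] by auto
  then show "taut A U" using b' by (simp add: taut_def tight_def)
  have "A \<inter> (X - nb U) = X - nb U" by (rule card_subset_eq[OF fd _ e(2)]) auto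
  then show "X - A \<subseteq> nb U" by auto
qed

lemma tautD:
  assumes "taut A U"
  shows "tight A U (nb U)" "barrier U (nb U)" "U \<subseteq> W" "U \<subseteq> nb U" "finite (nb U - U)" "nb U \<subseteq> V"
    "card (A \<inter> nb U) = card (nb U - U)"
  using assms barrierD[of U "nb U"] unfolding taut_def tight_def by auto

lemma taut_Int:
  assumes "ind A" "taut A U" "taut A U'"
  shows "taut A (U \<inter> U')" "nb U \<inter> nb U' - A \<subseteq> nb (U \<inter> U')"
  using tight_taut[OF assms(1) tight_Un_Int(2)[OF assms(1) tautD(1)[OF assms(2)] tautD(1)[OF assms(3)]]] by auto

text \<open>Below a member \<open>U0\<close> with the fewest elements of \<open>A\<close> in its
  neighbourhood, \<open>A \<inter> nb U\<close> and hence the boundary size are constant. Any finite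
  set disjoint from the intersection is missed by some member below \<open>U0\<close>, so the
  boundary of the intersection is no larger. The third claim serves to exclude backward
  rays.\<close>

lemma taut_Inter:
  assumes A: "ind A" and ne: "\<U> \<noteq> {}" and t: "\<And>U. U \<in> \<U> \<Longrightarrow> taut A U"
    and cl: "\<And>U U'. U \<in> \<U> \<Longrightarrow> U' \<in> \<U> \<Longrightarrow> U \<inter> U' \<in> \<U>"
  shows "taut A (\<Inter>\<U>)" "(\<Inter>U\<in>\<U>. nb U) - A \<subseteq> nb (\<Inter>\<U>)"
    "\<exists>U0\<in>\<U>. \<exists>T. finite T \<and> (\<forall>U\<in>\<U>. U \<subseteq> U0 \<longrightarrow> nb U - U \<subseteq> T)"
proof -
  define X where "X = (\<Inter>U\<in>\<U>. nb U)"
  obtain U0 where U0: "U0 \<in> \<U>" "\<And>U. U \<in> \<U> \<Longrightarrow> card (A \<inter> nb U0) \<le> card (A \<inter> nb U)"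
    using ne ex_has_least_nat[of "\<lambda>U. U \<in> \<U>" _ "\<lambda>U. card (A \<inter> nb U)"] by blast
  have finA: "finite (A \<inter> nb U)" if "U \<in> \<U>" for U using indD(2)[OF A tautD(2)[OF t[OF that]]] .
  have const: "A \<inter> nb U = A \<inter> nb U0" if "U \<in> \<U>" "U \<subseteq> U0" for U
  proof (rule card_seteq[OF finA[OF U0(1)]])
    show "A \<inter> nb U \<subseteq> A \<inter> nb U0" using nb_mono[OF that(2)] by auto
    show "card (A \<inter> nb U0) \<le> card (A \<inter> nb U)" by (rule U0(2)[OF that(1)])
  qed
  have bnd: "card (nb U - U) = card (A \<inter> nb U0)" if "U \<in> \<U>" "U \<subseteq> U0" for U
    using tautD(7)[OF t[OF that(1)]] const[OF that] by simp
  have avoid: "\<exists>U\<in>\<U>. U \<subseteq> U0 \<and> Y \<inter> U = {}" if "finite Y" "Y \<inter> \<Inter>\<U> = {}" for Y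
    using that
  proof (induction Y rule: finite_induct)
    case empty
    then show ?case using U0 by auto
  next
    case (insert y Y)
    then obtain U where U: "U \<in> \<U>" "U \<subseteq> U0" "Y \<inter> U = {}" by auto
    obtain U' where "U' \<in> \<U>" "y \<notin> U'" using insert.prems by auto
    then show ?case using U cl[OF U(1), of U'] by (intro bexI[of _ "U \<inter> U'"]) auto
  qed
  have AX: "A \<inter> nb U0 \<subseteq> A \<inter> X"
  proof -
    have "A \<inter> nb U0 \<subseteq> nb U" if "U \<in> \<U>" for U
      using const[OF cl[OF that U0(1)]] nb_mono[of "U \<inter> U0" U] by auto
    then show ?thesis by (auto simp: X_def)
  qed
  have fT: "finite (X - \<Inter>\<U>) \<and> card (X - \<Inter>\<U>) \<le> card (A \<inter> nb U0)"
  proof (rule finite_if_finite_subsets_card_bdd)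
    fix G assume G: "G \<subseteq> X - \<Inter>\<U>" "finite G"
    then obtain U where U: "U \<in> \<U>" "U \<subseteq> U0" "G \<inter> U = {}" using avoid[of G] by blast
    then have "G \<subseteq> nb U - U" using G by (auto simp: X_def)
    then have "card G \<le> card (nb U - U)" by (rule card_mono[OF tautD(5)[OF t[OF U(1)]]])
    then show "card G \<le> card (A \<inter> nb U0)" using bnd[OF U(1,2)] by simp
  qed
  have b: "barrier (\<Inter>\<U>) X"
    unfolding barrier_def
  proof (intro conjI ballI)
    show "\<Inter>\<U> \<subseteq> W" using U0(1) tautD(3)[OF t[OF U0(1)]] by auto
    show "X \<subseteq> V" using U0(1) tautD(6)[OF t[OF U0(1)]] by (auto simp: X_def)
    show "\<Inter>\<U> \<subseteq> X" using tautD(4)[OF t] by (force simp: X_def)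
    show "N u \<subseteq> X" if "u \<in> \<Inter>\<U>" for u using that by (auto simp: X_def nb_def)
    show "finite (X - \<Inter>\<U>)" using fT by simp
  qed
  have "card (A \<inter> nb U0) \<le> card (A \<inter> X)" by (rule card_mono[OF indD(2)[OF A b] AX])
  then have t': "tight A (\<Inter>\<U>) X" using fT indD(3)[OF A b] b by (simp add: tight_def)
  have cT: "card (X - \<Inter>\<U>) = card (A \<inter> nb U0)"
    using \<open>card (A \<inter> nb U0) \<le> card (A \<inter> X)\<close> fT indD(3)[OF A b] by simp
  show "taut A (\<Inter>\<U>)" "(\<Inter>U\<in>\<U>. nb U) - A \<subseteq> nb (\<Inter>\<U>)"
    using tight_taut[OF A t'] by (simp_all add: X_def)
  obtain U1 where U1: "U1 \<in> \<U>" "U1 \<subseteq> U0" "(X - \<Inter>\<U>) \<inter> U1 = {}"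
    using avoid[of "X - \<Inter>\<U>"] fT by blast
  have "nb U - U \<subseteq> X - \<Inter>\<U>" if U: "U \<in> \<U>" "U \<subseteq> U1" for U
  proof -
    have "X - \<Inter>\<U> \<subseteq> nb U - U" using U U1 by (auto simp: X_def)
    then have "X - \<Inter>\<U> = nb U - U"
      by (rule card_subset_eq[OF tautD(5)[OF t[OF U(1)]]]) (use cT bnd[OF U(1)] U U1 in auto)
    then show ?thesis by simp
  qed
  then show "\<exists>U0\<in>\<U>. \<exists>T. finite T \<and> (\<forall>U\<in>\<U>. U \<subseteq> U0 \<longrightarrow> nb U - U \<subseteq> T)"
    using U1(1) fT by (intro bexI[of _ U1] exI[of _ "X - \<Inter>\<U>"]) auto
qed

text \<open>Counterpart for unions, meant for forward rays: the upper bound \<open>U1\<close> bounds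
  \<open>card (A \<inter> nb U)\<close>, so a maximum is attained, and from some member on the
  boundary is that of the union.\<close>

lemma taut_Union:
  assumes A: "ind A" and ne: "\<U> \<noteq> {}" and t: "\<And>U. U \<in> \<U> \<Longrightarrow> taut A U"
    and cl: "\<And>U U'. U \<in> \<U> \<Longrightarrow> U' \<in> \<U> \<Longrightarrow> U \<union> U' \<in> \<U>"
    and U1: "taut A U1" "\<And>U. U \<in> \<U> \<Longrightarrow> U \<subseteq> U1"
  shows "\<exists>U0\<in>\<U>. \<forall>U\<in>\<U>. U0 \<subseteq> U \<longrightarrow> nb U - U = nb (\<Union>\<U>) - \<Union>\<U>"
proof -
  have finA: "finite (A \<inter> nb U1)" by (rule indD(2)[OF A tautD(2)[OF U1(1)]])
  have sub1: "A \<inter> nb U \<subseteq> A \<inter> nb U1" if "U \<in> \<U>" for U using nb_mono[OF U1(2)[OF that]] by auto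
  have "\<exists>x. x \<in> \<U> \<and> (\<forall>y. y \<in> \<U> \<longrightarrow> card (A \<inter> nb y) \<le> card (A \<inter> nb x))"
  proof -
    obtain U where "U \<in> \<U>" using ne by blast
    moreover have "\<forall>y. y \<in> \<U> \<longrightarrow> card (A \<inter> nb y) < Suc (card (A \<inter> nb U1))"
      using card_mono[OF finA sub1] by (simp add: less_Suc_eq_le)
    ultimately show ?thesis using ex_has_greatest_nat[of "\<lambda>U. U \<in> \<U>" U "\<lambda>U. card (A \<inter> nb U)"] by blast
  qed
  then obtain U0 where U0: "U0 \<in> \<U>" "\<And>U. U \<in> \<U> \<Longrightarrow> card (A \<inter> nb U) \<le> card (A \<inter> nb U0)" by blast
  have fin: "finite (A \<inter> nb U)" if "U \<in> \<U>" for U by (rule finite_subset[OF sub1[OF that] finA])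
  have const: "A \<inter> nb U = A \<inter> nb U0" if "U \<in> \<U>" "U0 \<subseteq> U" for U
  proof (rule card_seteq[OF fin[OF that(1)], symmetric])
    show "A \<inter> nb U0 \<subseteq> A \<inter> nb U" using nb_mono[OF that(2)] by auto
    show "card (A \<inter> nb U) \<le> card (A \<inter> nb U0)" by (rule U0(2)[OF that(1)])
  qed
  have bnd: "card (nb U - U) = card (A \<inter> nb U0)" if "U \<in> \<U>" "U0 \<subseteq> U" for U
    using tautD(7)[OF t[OF that(1)]] const[OF that] by simp
  have cover: "\<exists>U\<in>\<U>. U0 \<subseteq> U \<and> Y \<subseteq> nb U" if "finite Y" "Y \<subseteq> nb (\<Union>\<U>)" for Y
    using that
  proof (induction Y rule: finite_induct)
    case empty
    then show ?case using U0 by auto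
  next
    case (insert y Y)
    then obtain U where U: "U \<in> \<U>" "U0 \<subseteq> U" "Y \<subseteq> nb U" by auto
    obtain U' where "U' \<in> \<U>" "y \<in> nb U'" using insert.prems by (auto simp: nb_def)
    then show ?case using U cl[OF U(1), of U'] by (intro bexI[of _ "U \<union> U'"]) (auto simp: nb_Un)
  qed
  define T where "T = nb (\<Union>\<U>) - \<Union>\<U>"
  have fT: "finite T \<and> card T \<le> card (A \<inter> nb U0)"
  proof (rule finite_if_finite_subsets_card_bdd)
    fix G assume G: "G \<subseteq> T" "finite G"
    then obtain U where U: "U \<in> \<U>" "U0 \<subseteq> U" "G \<subseteq> nb U" using cover[of G] by (auto simp: T_def)
    then have "G \<subseteq> nb U - U" using G by (auto simp: T_def)
    then have "card G \<le> card (nb U - U)" by (rule card_mono[OF tautD(5)[OF t[OF U(1)]]])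
    then show "card G \<le> card (A \<inter> nb U0)" using bnd[OF U(1,2)] by simp
  qed
  have b: "barrier (\<Union>\<U>) (nb (\<Union>\<U>))"
    unfolding barrier_def
  proof (intro conjI ballI)
    show W': "\<Union>\<U> \<subseteq> W" using tautD(3)[OF t] by auto
    show "nb (\<Union>\<U>) \<subseteq> V" using W' N_sub by (auto simp: nb_def)
    show "\<Union>\<U> \<subseteq> nb (\<Union>\<U>)" using sub_nb[OF W'] .
    show "N u \<subseteq> nb (\<Union>\<U>)" if "u \<in> \<Union>\<U>" for u using that by (auto simp: nb_def)
    show "finite (nb (\<Union>\<U>) - \<Union>\<U>)" using fT by (simp add: T_def)
  qed
  have "A \<inter> nb U0 \<subseteq> A \<inter> nb (\<Union>\<U>)" using nb_mono[of U0 "\<Union>\<U>"] U0(1) by auto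
  then have "card (A \<inter> nb U0) \<le> card (A \<inter> nb (\<Union>\<U>))" by (rule card_mono[OF indD(2)[OF A b]])
  then have cT: "card T = card (A \<inter> nb U0)" using fT indD(3)[OF A b] by (simp add: T_def)
  obtain U2 where U2: "U2 \<in> \<U>" "U0 \<subseteq> U2" "T \<subseteq> nb U2" using cover[of T] fT by (auto simp: T_def)
  have "nb U - U = T" if U: "U \<in> \<U>" "U2 \<subseteq> U" for U
  proof -
    have "T \<subseteq> nb U - U" using U U2 nb_mono[OF U(2)] by (auto simp: T_def)
    then have "T = nb U - U"
      by (rule card_subset_eq[OF tautD(5)[OF t[OF U(1)]]]) (use cT bnd[OF U(1)] U U2 in auto)
    then show ?thesis by simp
  qed
  then show ?thesis using U2(1) by (intro bexI[of _ U2]) (auto simp: T_def)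
qed

section \<open>Routings of taut sets and their gluing\<close>

definition partial_routing :: "'v set \<Rightarrow> 'v set \<Rightarrow> ('v \<Rightarrow> 'v) \<Rightarrow> bool" where
  "partial_routing A U s \<longleftrightarrow>
     inj_on s U \<and> (\<forall>u \<in> U. s u \<in> N u) \<and> finite {u \<in> U. s u \<noteq> u} \<and> s ` U \<inter> A = {}"

text \<open>Menger's theorem applies to the finite set \<open>A \<inter> nb U\<close>. On
  \<open>U\<close> the routing stays in \<open>nb U\<close>, so missing this part of
  \<open>A\<close> means missing all of \<open>A\<close>.\<close>

lemma partial_routing_exists:
  assumes A: "ind A" and t: "taut A U"
  shows "\<exists>s. partial_routing A U s"
proof -
  have "ind (A \<inter> nb U)" by (rule ind_subset[OF A]) auto
  then obtain s where s: "routing (A \<inter> nb U) s" using menger indD(2)[OF A tautD(2)[OF t]] by blast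
  note U = tautD(3)[OF t]
  have "inj_on s U" using s U by (auto simp: routing_def intro: inj_on_subset)
  moreover have N: "\<forall>u \<in> U. s u \<in> N u" using s U by (auto simp: routing_def)
  moreover have "finite {u \<in> U. s u \<noteq> u}"
    by (rule finite_subset[of _ "{u \<in> W. s u \<noteq> u}"]) (use s U in \<open>auto simp: routing_def\<close>)
  moreover have "s ` U \<inter> A = {}"
  proof -
    have "s ` U \<subseteq> nb U" using N by (auto simp: nb_def)
    moreover have "s ` U \<inter> (A \<inter> nb U) = {}" using s U by (auto simp: routing_def)
    ultimately show ?thesis by auto
  qed
  ultimately show ?thesis unfolding partial_routing_def by blast
qed

text \<open>The image misses \<open>A \<inter> nb U'\<close>, and by tightness it misses exactly as
  many vertices of \<open>nb U'\<close> as that set has. So the image of each taut subset does not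
  depend on the routing.\<close>

lemma partial_routing_image:
  assumes A: "ind A" and s: "partial_routing A U s" and t: "taut A U'" and U: "U' \<subseteq> U"
  shows "s ` U' = nb U' - A"
proof -
  have inj: "inj_on s U'" and fin: "finite {u \<in> U'. s u \<noteq> u}" and sub: "s ` U' \<subseteq> nb U'" and dj: "s ` U' \<inter> A = {}"
    using s U unfolding partial_routing_def nb_def
    by (auto intro: inj_on_subset rev_finite_subset[of "{u \<in> U. s u \<noteq> u}"])
  note c = card_image_fixing_cofinite[OF inj fin tautD(4)[OF t] sub tautD(5)[OF t]]
  have "A \<inter> nb U' \<subseteq> nb U' - s ` U'" using dj by auto
  then have "A \<inter> nb U' = nb U' - s ` U'" by (rule card_subset_eq[OF c(1)]) (use c(2) tautD(7)[OF t] in simp)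
  then show ?thesis using sub dj by auto
qed

text \<open>
  The gluing: \<open>v\<close> is moved by a routing chosen for the smallest taut set that contains \<open>v\<close>.
\<close>

definition thull :: "'v set \<Rightarrow> 'v \<Rightarrow> 'v set" where
  "thull A v = \<Inter>{U. taut A U \<and> v \<in> U}"

definition shift :: "'v set \<Rightarrow> 'v \<Rightarrow> 'v" where
  "shift A v = (SOME s. partial_routing A (thull A v) s) v"

text \<open>For maximal independent \<open>A\<close> these are the vertices on which
  \<open>shift A\<close> is meaningful. In a dimaze, a non-exit outside this set is the centre of a
  linking fan.\<close>

definition barred :: "'v set" where
  "barred = \<Union>{U. \<exists>X. barrier U X}"

lemma thull:
  assumes A: "ind A" and U: "taut A U" "v \<in> U"
  shows "taut A (thull A v)" "v \<in> thull A v" "thull A v \<subseteq> U"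
proof -
  show "taut A (thull A v)" unfolding thull_def by (rule taut_Inter(1)[OF A]) (use U taut_Int(1)[OF A] in auto)
  show "v \<in> thull A v" "thull A v \<subseteq> U" using U by (auto simp: thull_def)
qed

text \<open>The \<open>SOME\<close> in \<open>shift\<close> depends on \<open>v\<close> only through
  its hull, so all vertices with the same hull are moved by one and the same routing.\<close>

lemma shift_eq:
  assumes A: "ind A" and U: "taut A U" "v \<in> U"
  shows "\<exists>s. partial_routing A (thull A v) s \<and> (\<forall>w \<in> thull A v. thull A w = thull A v \<longrightarrow> shift A w = s w)"
proof -
  have "partial_routing A (thull A v) (SOME s. partial_routing A (thull A v) s)"
    using partial_routing_exists[OF A thull(1)[OF A U]] by (rule someI_ex)
  then show ?thesis by (intro exI[of _ "SOME s. partial_routing A (thull A v) s"]) (auto simp: shift_def)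
qed

text \<open>For the third claim: the routing of the hull already fills \<open>nb U' - A\<close> with
  the images of \<open>U'\<close>, which leaves no room there for the image of
  \<open>v\<close>.\<close>

lemma shift_props:
  assumes A: "ind A" and U: "taut A U" "v \<in> U"
  shows "shift A v \<in> N v" "shift A v \<notin> A" "\<And>U'. taut A U' \<Longrightarrow> v \<notin> U' \<Longrightarrow> U' \<subseteq> thull A v \<Longrightarrow> shift A v \<notin> nb U'"
proof -
  note h = thull[OF A U]
  obtain s where s: "partial_routing A (thull A v) s" "shift A v = s v"
    using shift_eq[OF A U] h(2) by blast
  show "shift A v \<in> N v" "shift A v \<notin> A" using s h unfolding partial_routing_def by auto
  fix U' assume U': "taut A U'" "v \<notin> U'" "U' \<subseteq> thull A v"
  have "s ` U' = nb U' - A" by (rule partial_routing_image[OF A s(1) U'(1,3)])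
  moreover have "s v \<notin> s ` U'" using U' h(2) s(1) unfolding partial_routing_def inj_on_def by blast
  ultimately show "shift A v \<notin> nb U'" using s \<open>shift A v \<notin> A\<close> by auto
qed

text \<open>A common image lies in the neighbourhoods of both hulls, hence by
  \<open>taut_Int\<close> in that of their intersection. The third part of
  \<open>shift_props\<close> then puts \<open>v\<close> and \<open>w\<close> into this intersection,
  so the hulls coincide and one injective routing moves both.\<close>

lemma shift_inj:
  assumes A: "ind A" and v: "taut A U" "v \<in> U" and w: "taut A U'" "w \<in> U'" and eq: "shift A v = shift A w"
  shows "v = w"
proof -
  let ?I = "thull A v \<inter> thull A w"
  note hv = thull[OF A v] and hw = thull[OF A w]
  note pv = shift_props[OF A v] and pw = shift_props[OF A w]
  have I: "taut A ?I" "nb (thull A v) \<inter> nb (thull A w) - A \<subseteq> nb ?I"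
    using taut_Int[OF A hv(1) hw(1)] by auto
  have "shift A v \<in> nb (thull A v)" "shift A w \<in> nb (thull A w)" using hv(2) hw(2) pv(1) pw(1) by (auto simp: nb_def)
  then have m: "shift A v \<in> nb ?I" using I(2) eq pv(2) by auto
  have "v \<in> ?I" using pv(3)[OF I(1)] m by auto
  moreover have "w \<in> ?I" using pw(3)[OF I(1)] m eq by auto
  ultimately have "thull A v \<subseteq> thull A w" "thull A w \<subseteq> thull A v" using thull(3)[OF A I(1)] by auto
  then have e: "thull A w = thull A v" by auto
  obtain s where s: "partial_routing A (thull A v) s" "\<forall>w \<in> thull A v. thull A w = thull A v \<longrightarrow> shift A w = s w"
    using shift_eq[OF A v] by blast
  then have "s v = s w" using eq e hv(2) hw(2) by metis
  then show ?thesis using s(1) e hv(2) hw(2) unfolding partial_routing_def inj_on_def by auto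
qed

text \<open>Take the smallest taut set with \<open>x\<close> in its neighbourhood. By minimality it
  is the hull of any of its vertices that some routing sends to \<open>x\<close>.\<close>

lemma shift_onto:
  assumes A: "ind A" and U: "taut A U" and x: "x \<in> nb U" "x \<notin> A"
  shows "\<exists>u\<in>U. shift A u = x"
proof -
  define \<U> where "\<U> = {U. taut A U \<and> x \<in> nb U}"
  have cl: "U \<inter> U' \<in> \<U>" if "U \<in> \<U>" "U' \<in> \<U>" for U U'
    using that taut_Int[OF A, of U U'] x(2) by (auto simp: \<U>_def)
  have "U \<in> \<U>" using U x by (simp add: \<U>_def)
  then have ne: "\<U> \<noteq> {}" by auto
  have "taut A U'" if "U' \<in> \<U>" for U' using that by (simp add: \<U>_def)
  note tI = taut_Inter(1,2)[OF A ne this cl]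
  have "x \<in> (\<Inter>U\<in>\<U>. nb U) - A" using x by (simp add: \<U>_def)
  then have xI: "x \<in> nb (\<Inter>\<U>)" using tI(2) by (rule rev_subsetD)
  obtain s where s: "partial_routing A (\<Inter>\<U>) s" using partial_routing_exists[OF A tI(1)] by blast
  have "x \<in> s ` \<Inter>\<U>" using partial_routing_image[OF A s tI(1) subset_refl] xI x by simp
  then obtain u where u: "u \<in> \<Inter>\<U>" "x = s u" by blast
  note h = thull[OF A tI(1) u(1)]
  have "s u \<in> N u" using s u(1) unfolding partial_routing_def by blast
  then have "x \<in> nb (thull A u)" using u(2) h(2) unfolding nb_def by blast
  then have "thull A u \<in> \<U>" using h(1) by (simp add: \<U>_def)
  then have e: "thull A u = \<Inter>\<U>" using h(3) by (simp add: Inter_lower subset_antisym)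
  \<comment> \<open>The role of \<open>s\<close> was to show that the smallest set is a hull. The
    routing \<open>s'\<close> behind \<open>shift\<close> may send another vertex to
    \<open>x\<close>, hence the second round.\<close>
  obtain s' where s': "partial_routing A (\<Inter>\<U>) s'" "\<forall>w \<in> \<Inter>\<U>. thull A w = \<Inter>\<U> \<longrightarrow> shift A w = s' w"
    using shift_eq[OF A tI(1) u(1)] unfolding e by blast
  have "x \<in> s' ` \<Inter>\<U>" using partial_routing_image[OF A s'(1) tI(1) subset_refl] xI x by simp
  then obtain u' where u': "u' \<in> \<Inter>\<U>" "x = s' u'" by blast
  note h' = thull[OF A tI(1) u'(1)]
  have "s' u' \<in> N u'" using s'(1) u'(1) unfolding partial_routing_def by blast
  then have "x \<in> nb (thull A u')" using u'(2) h'(2) unfolding nb_def by blast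
  then have "thull A u' \<in> \<U>" using h'(1) by (simp add: \<U>_def)
  then have "thull A u' = \<Inter>\<U>" using h'(3) by (simp add: Inter_lower subset_antisym)
  then have "shift A u' = x" using s'(2) u' by simp
  moreover have "u' \<in> U" using u'(1) \<open>U \<in> \<U>\<close> by (rule InterD)
  ultimately show ?thesis by blast
qed

lemma shift_image:
  assumes A: "ind A" and U: "taut A U"
  shows "shift A ` U = nb U - A"
proof
  show "shift A ` U \<subseteq> nb U - A" using shift_props(1,2)[OF A U] by (auto simp: nb_def)
  show "nb U - A \<subseteq> shift A ` U" using shift_onto[OF A U] by fast
qed

text \<open>\<open>shift_onto\<close> gives a preimage in \<open>U'\<close>, and injectivity
  identifies it with \<open>v\<close>. So taut sets are closed under going backwards, which makes
  hulls monotone along orbits.\<close>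

lemma shift_preimage:
  assumes A: "ind A" and v: "taut A U" "v \<in> U" and U': "taut A U'" "shift A v \<in> nb U'"
  shows "v \<in> U'"
proof -
  obtain w where "w \<in> U'" "shift A w = shift A v"
    using shift_onto[OF A U'(1,2)] shift_props(2)[OF A v] by blast
  then show ?thesis using shift_inj[OF A v U'(1), of w] by auto
qed

text \<open>A single partial routing moves only finitely many vertices.\<close>

lemma hull_not_eventually_constant:
  assumes A: "ind A" and U: "taut A U" "range f \<subseteq> U" and inj: "inj (f :: nat \<Rightarrow> 'v)"
    and moved: "\<And>i. shift A (f i) \<noteq> f i" and const: "\<And>i. i \<ge> k \<Longrightarrow> thull A (f i) = thull A (f k)"
  shows False
proof -
  have fk: "f k \<in> U" using U by auto
  obtain s where s: "partial_routing A (thull A (f k)) s"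
    "\<forall>w \<in> thull A (f k). thull A w = thull A (f k) \<longrightarrow> shift A w = s w"
    using shift_eq[OF A U(1) fk] by blast
  have "f ` {k..} \<subseteq> {u \<in> thull A (f k). s u \<noteq> u}"
  proof
    fix y assume "y \<in> f ` {k..}"
    then obtain i where i: "i \<ge> k" "y = f i" by auto
    have fi: "f i \<in> U" using U by auto
    have "f i \<in> thull A (f k)" using thull(2)[OF A U(1) fi] const[OF i(1)] by simp
    moreover have "s (f i) = shift A (f i)" using s(2) calculation const[OF i(1)] by simp
    ultimately show "y \<in> {u \<in> thull A (f k). s u \<noteq> u}" using moved[of i] i by auto
  qed
  then have "finite (f ` {k..})" using s(1) unfolding partial_routing_def by (auto intro: finite_subset)
  moreover have "infinite (f ` {k..})" using inj by (simp add: finite_image_iff inj_on_subset infinite_Ici)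
  ultimately show False by blast
qed

text \<open>Going forward, hulls grow, and their boundaries eventually equal that of their union.
  The next vertex is in the neighbourhood of the current hull and not in that boundary, so it lies
  in the hull, which is constant from then on.\<close>

lemma shift_no_forward_ray:
  assumes A: "ind A" and U: "taut A U"
  shows "no_ray (shift A) U"
  unfolding no_ray_def
proof
  assume "\<exists>f :: nat \<Rightarrow> 'v. inj f \<and> range f \<subseteq> U \<and> (\<forall>i. f (Suc i) = shift A (f i))"
  then obtain f :: "nat \<Rightarrow> 'v" where f: "inj f" "range f \<subseteq> U" "\<And>i. f (Suc i) = shift A (f i)" by blast
  have fU: "f i \<in> U" for i using f by auto
  let ?h = "\<lambda>i. thull A (f i)"
  note h = thull[OF A U fU]
  have mono1: "?h i \<subseteq> ?h (Suc i)" for i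
  proof (rule thull(3)[OF A h(1)])
    have "f (Suc i) \<in> nb (?h (Suc i))" using h(2)[of "Suc i"] tautD(4)[OF h(1)[of "Suc i"]] by auto
    then show "f i \<in> ?h (Suc i)" using shift_preimage[OF A U fU h(1)] f(3) by metis
  qed
  have mono: "i \<le> j \<Longrightarrow> ?h i \<subseteq> ?h j" for i j using lift_Suc_mono_le[of ?h] mono1 by blast
  have "\<exists>U0\<in>range ?h. \<forall>U\<in>range ?h. U0 \<subseteq> U \<longrightarrow> nb U - U = nb (\<Union>(range ?h)) - \<Union>(range ?h)"
  proof (rule taut_Union[OF A _ _ _ U])
    show "X \<union> Y \<in> range ?h" if XY: "X \<in> range ?h" "Y \<in> range ?h" for X Y
    proof -
      obtain i j where "X = ?h i" "Y = ?h j" using XY by blast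
      then have "X \<union> Y = ?h (max i j)" using mono[of i j] mono[of j i] by (auto simp: max_def)
      then show ?thesis by blast
    qed
  qed (use h in auto)
  then obtain k where k: "\<And>i. ?h k \<subseteq> ?h i \<Longrightarrow> nb (?h i) - ?h i = nb (\<Union>(range ?h)) - \<Union>(range ?h)" by auto
  have const1: "?h (Suc i) = ?h i" if "i \<ge> k" for i
  proof -
    have "f (Suc i) \<in> nb (?h i)" using shift_props(1)[OF A U fU] h(2) f(3) by (auto simp: nb_def)
    moreover have "f (Suc i) \<in> \<Union>(range ?h)" using h(2) by blast
    ultimately have "f (Suc i) \<in> ?h i" using k[OF mono[OF that]] by blast
    then show ?thesis using thull(3)[OF A h(1)] mono1 by blast
  qed
  have const: "?h i = ?h k" if "i \<ge> k" for i using that by (induction i rule: dec_induct) (use const1 in auto)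
  have "shift A (f i) \<noteq> f i" for i using f(1,3) by (metis injD n_not_Suc_n)
  then show False using hull_not_eventually_constant[OF A U f(2,1)] const by blast
qed

text \<open>Going backward, hulls shrink and their boundaries end up inside a finite set
  \<open>T\<close>, which the ray leaves for good. From then on each vertex lies in the hull of its
  preimage on the ray, so the hulls are constant.\<close>

lemma shift_no_backward_ray:
  assumes A: "ind A" and U: "taut A U" and f: "inj f" "range f \<subseteq> U" "\<And>i::nat. f i = shift A (f (Suc i))"
  shows False
proof -
  have fU: "f i \<in> U" for i using f(2) by auto
  let ?h = "\<lambda>i. thull A (f i)"
  note h = thull[OF A U fU]
  have mono1: "?h (Suc i) \<subseteq> ?h i" for i
  proof (rule thull(3)[OF A h(1)])
    have "f i \<in> nb (?h i)" using h(2)[of i] tautD(4)[OF h(1)[of i]] by auto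
    then have "shift A (f (Suc i)) \<in> nb (?h i)" using f(3)[of i] by simp
    then show "f (Suc i) \<in> ?h i" by (rule shift_preimage[OF A U fU h(1)])
  qed
  have mono: "i \<le> j \<Longrightarrow> ?h j \<subseteq> ?h i" for i j using lift_Suc_antimono_le[of ?h] mono1 by blast
  have "\<exists>U0\<in>range ?h. \<exists>T. finite T \<and> (\<forall>U\<in>range ?h. U \<subseteq> U0 \<longrightarrow> nb U - U \<subseteq> T)"
  proof (rule taut_Inter(3)[OF A])
    show "X \<inter> Y \<in> range ?h" if XY: "X \<in> range ?h" "Y \<in> range ?h" for X Y
    proof -
      obtain i j where "X = ?h i" "Y = ?h j" using XY by blast
      then have "X \<inter> Y = ?h (max i j)" using mono[of i j] mono[of j i] by (auto simp: max_def)
      then show ?thesis by blast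
    qed
  qed (use h in auto)
  then obtain k T where T: "finite T" "\<And>i. ?h i \<subseteq> ?h k \<Longrightarrow> nb (?h i) - ?h i \<subseteq> T" by auto
  have "finite {i. f i \<in> T}" using finite_vimageI[OF T(1) f(1)] by (simp add: vimage_def)
  then obtain l where "\<forall>i\<in>{i. f i \<in> T}. i < l" unfolding finite_nat_set_iff_bounded by (elim exE)
  then have l: "f i \<notin> T" if "i \<ge> l" for i using that by auto
  have const1: "?h (Suc i) = ?h i" if "i \<ge> max k l" for i
  proof -
    have "f i \<in> N (f (Suc i))" using shift_props(1)[OF A U fU[of "Suc i"]] f(3)[of i] by simp
    then have "f i \<in> nb (?h (Suc i))" using h(2)[of "Suc i"] unfolding nb_def by blast
    moreover have "nb (?h (Suc i)) - ?h (Suc i) \<subseteq> T" by (rule T(2)[OF mono]) (use that in simp)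
    moreover have "f i \<notin> T" by (rule l) (use that in simp)
    ultimately have "f i \<in> ?h (Suc i)" by blast
    then show ?thesis using thull(3)[OF A h(1)] mono1 by blast
  qed
  have const: "?h i = ?h (max k l)" if "i \<ge> max k l" for i using that by (induction i rule: dec_induct) (use const1 in auto)
  have "shift A (f i) \<noteq> f i" for i
  proof
    assume "shift A (f i) = f i"
    then have "shift A (f i) = shift A (f (Suc i))" using f(3)[of i] by simp
    then have "f i = f (Suc i)" by (rule shift_inj[OF A U fU U fU])
    then show False using f(1) by (metis injD n_not_Suc_n)
  qed
  then show False using hull_not_eventually_constant[OF A U f(2,1)] const by blast
qed

end

context nbhd_system
begin

section \<open>Maximal independent sets and bijectivity of the shift\<close>

definition maxind :: "'v set \<Rightarrow> bool" where
  "maxind A \<longleftrightarrow> ind A \<and> (\<forall>x \<in> V - A. \<not> ind (insert x A))"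

lemma maxind_extension:
  assumes "ind I" obtains A where "maxind A" "I \<subseteq> A"
proof -
  obtain J where J: "ind J" "I \<subseteq> J" "\<forall>K. ind K \<and> J \<subseteq> K \<and> K \<subseteq> V \<longrightarrow> K = J"
    using maximal_extension[OF finitary_exchange_ind, of I V] assms indD(1)[OF assms] by auto
  have "\<not> ind (insert x J)" if "x \<in> V - J" for x
    using that J(3)[rule_format, of "insert x J"] indD(1)[OF J(1)] by auto
  then have "maxind J" using J(1) by (simp add: maxind_def)
  then show thesis using J(2) by (rule that)
qed

text \<open>For \<open>x\<close> in \<open>A\<close> the barrier with \<open>U = {}\<close> and
  \<open>X = {x}\<close> is tight. Otherwise finitely many elements of \<open>A\<close> already
  forbid the addition of \<open>x\<close>, and a barrier tight for them is tight for
  \<open>A\<close>.\<close>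

lemma tight_at:
  assumes A: "maxind A" and x: "x \<in> V"
  shows "\<exists>U X. tight A U X \<and> x \<in> X"
proof (cases "x \<in> A")
  case True
  have "tight A {} {x}" using x True by (simp add: tight_def barrier_def)
  then show ?thesis by blast
next
  case False
  have iA: "ind A" using A by (simp add: maxind_def)
  have "\<not> ind (insert x A)" using A x False by (simp add: maxind_def)
  then obtain F where F: "F \<subseteq> A" "finite F" "\<not> ind (insert x F)"
    using insert_dependent_finite[OF finitary_exchange_ind, of A x] iA x by auto
  have iF: "ind F" by (rule ind_subset[OF iA F(1)])
  obtain U X where t: "tight F U X" "x \<in> X" by (rule tight_if_insert_dependent[OF iF F(2) x F(3)])
  note b = tightD(1)[OF t(1)]
  have "card (F \<inter> X) \<le> card (A \<inter> X)" by (rule card_mono[OF indD(2)[OF iA b]]) (use F in auto)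
  then have "tight A U X" using tightD(2)[OF t(1)] indD(3)[OF iA b] b by (simp add: tight_def)
  then show ?thesis using t(2) by blast
qed

text \<open>The boundary of \<open>(U, X)\<close> is finite, so one tight barrier contains it.
  Joining the two creates no boundary beyond that of the tight one, so the union is tight as
  well.\<close>

lemma barrier_taut:
  assumes A: "maxind A" and b: "barrier U X"
  shows "\<exists>U'. taut A U' \<and> U \<subseteq> U' \<and> X - A \<subseteq> nb U'"
proof -
  have iA: "ind A" using A by (simp add: maxind_def)
  have "\<exists>U X. tight A U X \<and> x \<in> X" if "x \<in> X - U" for x
    using tight_at[OF A] that barrierD(2)[OF b] by blast
  then obtain U1 X1 where t: "tight A U1 X1" "X - U \<subseteq> X1"
    using tight_finite_cover[OF iA barrierD(5)[OF b]] by blast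
  note b1 = tightD(1)[OF t(1)]
  note bU = barrier_Un[OF b b1]
  have "(X \<union> X1) - (U \<union> U1) \<subseteq> X1 - U1" using t(2) by auto
  then have "card ((X \<union> X1) - (U \<union> U1)) \<le> card (X1 - U1)" by (rule card_mono[OF barrierD(5)[OF b1]])
  also have "\<dots> = card (A \<inter> X1)" using tightD(2)[OF t(1)] by simp
  also have "\<dots> \<le> card (A \<inter> (X \<union> X1))" by (rule card_mono[OF indD(2)[OF iA bU]]) auto
  finally have "tight A (U \<union> U1) (X \<union> X1)" using indD(3)[OF iA bU] bU by (simp add: tight_def)
  from tight_taut[OF iA this] show ?thesis by (intro exI[of _ "U \<union> U1"]) auto
qed

lemma barred_taut:
  assumes "maxind A" "v \<in> barred" obtains U where "taut A U" "v \<in> U"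
proof -
  obtain U X where "barrier U X" "v \<in> U" using assms(2) by (auto simp: barred_def)
  then show thesis using barrier_taut[OF assms(1)] that by blast
qed

lemma taut_barred: "taut A U \<Longrightarrow> U \<subseteq> barred"
  using tautD(2) by (auto simp: barred_def)

lemma barred_sub: "barred \<subseteq> W"
  using barrierD(1) by (fastforce simp: barred_def)

lemma shift_bij:
  assumes A: "maxind A"
  shows "bij_betw (shift A) barred (V - A)"
  unfolding bij_betw_def
proof
  have iA: "ind A" using A by (simp add: maxind_def)
  show "inj_on (shift A) barred"
  proof (rule inj_onI)
    fix v w assume v: "v \<in> barred" and w: "w \<in> barred" and eq: "shift A v = shift A w"
    obtain U U' where "taut A U" "v \<in> U" "taut A U'" "w \<in> U'"
      using barred_taut[OF A v] barred_taut[OF A w] by metis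
    then show "v = w" using shift_inj[OF iA _ _ _ _ eq] by blast
  qed
  show "shift A ` barred = V - A"
  proof
    show "shift A ` barred \<subseteq> V - A"
    proof
      fix x assume "x \<in> shift A ` barred"
      then obtain v where v: "v \<in> barred" "x = shift A v" by auto
      obtain U where U: "taut A U" "v \<in> U" using barred_taut[OF A v(1)] .
      then show "x \<in> V - A"
        using shift_props(1,2)[OF iA U] v N_sub[of v] barred_sub by auto
    qed
    show "V - A \<subseteq> shift A ` barred"
    proof
      fix x assume x: "x \<in> V - A"
      then obtain U X where t: "tight A U X" "x \<in> X" using tight_at[OF A, of x] by blast
      have "x \<in> nb U" "taut A U" using tight_taut[OF iA t(1)] t(2) x by auto
      then obtain u where "u \<in> U" "shift A u = x" using shift_onto[OF iA, of U x] x by auto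
      then show "x \<in> shift A ` barred" using taut_barred[OF \<open>taut A U\<close>] by auto
    qed
  qed
qed

lemma shift_nb: "maxind A \<Longrightarrow> v \<in> barred \<Longrightarrow> shift A v \<in> N v"
  using barred_taut shift_props(1) unfolding maxind_def by metis

lemma no_ray_subset: "no_ray m U \<Longrightarrow> U' \<subseteq> U \<Longrightarrow> no_ray m U'"
  unfolding no_ray_def by (meson subset_trans)

lemma card_shift_sources:
  assumes A: "ind A" and U: "taut A U1" "U \<subseteq> U1" and X: "U \<subseteq> X" "shift A ` U \<subseteq> X" "finite (X - U)"
  shows "finite (X - shift A ` U)" "card (X - shift A ` U) \<le> card (X - U)"
proof -
  have "inj_on (shift A) U"
    by (rule inj_onI, rule shift_inj[OF A U(1) _ U(1)]) (use U(2) in auto)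
  then show "finite (X - shift A ` U)" "card (X - shift A ` U) \<le> card (X - U)"
    using card_sources_le[OF _ X no_ray_subset[OF shift_no_forward_ray[OF A U(1)] U(2)]] by auto
qed

text \<open>\<open>card_sources_le\<close> for the inverse of the shift, whose rays are backward
  rays of the shift.\<close>

lemma card_shift_targets:
  assumes A: "ind A" and U: "taut A U1" "U \<subseteq> U1" and X: "U \<subseteq> X" "shift A ` U \<subseteq> X" "finite (X - shift A ` U)"
  shows "finite (X - U)" "card (X - U) \<le> card (X - shift A ` U)"
proof -
  define n where "n = the_inv_into U (shift A)"
  have inj: "inj_on (shift A) U"
    by (rule inj_onI, rule shift_inj[OF A U(1) _ U(1)]) (use U(2) in auto)
  have n: "n ` shift A ` U = U" "inj_on n (shift A ` U)"
    using the_inv_into_onto[OF inj] inj_on_the_inv_into[OF inj] by (simp_all add: n_def)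
  have "no_ray n (shift A ` U)"
    unfolding no_ray_def
  proof
    assume "\<exists>f :: nat \<Rightarrow> 'v. inj f \<and> range f \<subseteq> shift A ` U \<and> (\<forall>i. f (Suc i) = n (f i))"
    then obtain f :: "nat \<Rightarrow> 'v" where f: "inj f" "range f \<subseteq> shift A ` U" "\<And>i. f (Suc i) = n (f i)" by blast
    have fi: "f i \<in> shift A ` U" for i using f(2) by auto
    have s: "shift A (f (Suc i)) = f i" for i
      unfolding f(3) n_def by (rule f_the_inv_into_f[OF inj fi])
    \<comment> \<open>\<open>f 0\<close> is known only to lie in the image of \<open>U\<close>,
      hence the index shifted by one.\<close>
    have fU: "f (Suc i) \<in> U" for i
      unfolding f(3) using n(1) fi by blast
    have "inj (\<lambda>i. f (Suc i))" using f(1) by (auto simp: inj_def)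
    moreover have "range (\<lambda>i. f (Suc i)) \<subseteq> U1" using fU U(2) by auto
    ultimately show False by (rule shift_no_backward_ray[OF A U(1)]) (simp add: s)
  qed
  then have "finite (X - n ` shift A ` U) \<and> card (X - n ` shift A ` U) \<le> card (X - shift A ` U)"
    by (intro card_sources_le) (use n X in auto)
  then show "finite (X - U)" "card (X - U) \<le> card (X - shift A ` U)" using n(1) by auto
qed

lemma no_ray_barrier:
  assumes A: "maxind A" and b: "barrier U X"
  shows "no_ray (shift A) U"
  using barrier_taut[OF A b] shift_no_forward_ray no_ray_subset A unfolding maxind_def by metis

end

section \<open>Contraction\<close>

text \<open>
  Contracting a subset \<open>I\<close> of \<open>A\<close>: the system is turned around so that \<open>A\<close> becomes the set of
  exits, with \<open>shift A v\<close> taking over the neighbourhood of \<open>v\<close>, and then \<open>I\<close> is deleted.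
\<close>

locale contraction = nbhd_system +
  fixes A I
  assumes A: "maxind A" and IA: "I \<subseteq> A"
begin

definition N' :: "'a \<Rightarrow> 'a set" where "N' x = N (the_inv_into barred (shift A) x) - I"

lemma iA: "ind A" using A by (simp add: maxind_def)

lemma N'_shift: "v \<in> barred \<Longrightarrow> N' (shift A v) = N v - I"
  using shift_bij[OF A] by (simp add: N'_def bij_betw_def the_inv_into_f_f)

lemma shiftE: assumes "x \<in> V - A" obtains v where "v \<in> barred" "x = shift A v"
  using shift_bij[OF A] assms unfolding bij_betw_def by blast

sublocale C: nbhd_system "V - I" "V - A" N'
proof
  show "V - A \<subseteq> V - I" using IA by auto
  fix x assume x: "x \<in> V - A"
  then obtain v where v: "v \<in> barred" "x = shift A v" by (rule shiftE)
  show "x \<in> N' x" using shift_nb[OF A v(1)] x IA by (auto simp: v N'_shift)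
  show "N' x \<subseteq> V - I" using N_sub[of v] v barred_sub by (auto simp: N'_shift)
qed

text \<open>A barrier \<open>(U, X)\<close> corresponds to the pair of the shifted \<open>U\<close>
  and \<open>X - I\<close>. Without rays, shifting preserves the size of the boundary; the shifted
  boundary contains \<open>I \<inter> X\<close>, and deleting it accounts for the elements of
  \<open>I\<close> in \<open>I \<union> J\<close>.\<close>

lemma ind_contraction:
  assumes J: "J \<subseteq> V - I"
  shows "C.ind J \<longleftrightarrow> ind (I \<union> J)"
proof
  assume IJ: "ind (I \<union> J)"
  show "C.ind J"
    unfolding C.ind_def
  proof (intro conjI allI impI)
    show "J \<subseteq> V - I" by fact
    fix U' X' assume b': "C.barrier U' X'"
    note b'D = C.barrierD[OF b']
    have "finite (J \<inter> X') \<and> card (J \<inter> X') \<le> card (X' - U')"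
    proof (rule finite_if_finite_subsets_card_bdd)
      fix G assume G: "G \<subseteq> J \<inter> X'" "finite G"
      have "\<exists>U X. tight A U X \<and> x \<in> X" if "x \<in> G \<union> (X' - U')" for x
        by (rule tight_at[OF A]) (use that G J b'D(2) in auto)
      \<comment> \<open>The preimage of \<open>U'\<close> under the shift need not lie in one taut
        set, as \<open>card_shift_targets\<close> demands. So the barrier is cut down to a tight one
        around the finite set \<open>G\<close> and the boundary.\<close>
      then obtain U1 X1 where t: "tight A U1 X1" "G \<union> (X' - U') \<subseteq> X1"
        using tight_finite_cover[OF iA, of "G \<union> (X' - U')"] G(2) b'D(5) by blast
      note b1 = tightD(1)[OF t(1)]
      note b1D = barrierD[OF b1]
      note ta = tight_taut[OF iA t(1)]
      have mU1: "shift A ` U1 = X1 - A" using shift_image[OF iA ta(1)] ta(2) barrier_nb(2)[OF b1] by auto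
      note tb = taut_barred[OF ta(1)]
      define U where "U = {u \<in> U1. shift A u \<in> U'}"
      define X where "X = X1 \<inter> (X' \<union> I)"
      have mU: "shift A ` U = U' \<inter> X1"
      proof
        show "shift A ` U \<subseteq> U' \<inter> X1" using mU1 by (auto simp: U_def)
        show "U' \<inter> X1 \<subseteq> shift A ` U"
        proof
          fix x assume x: "x \<in> U' \<inter> X1"
          then have "x \<in> shift A ` U1" using mU1 b'D(1) by auto
          then show "x \<in> shift A ` U" using x by (auto simp: U_def)
        qed
      qed
      have disj: "I \<inter> U' = {}" "I \<inter> X' = {}" using b'D(1,2) IA by auto
      have XmU: "X - shift A ` U = (X' - U') \<union> (X1 \<inter> I)"
        using t(2) disj unfolding mU X_def by auto
      have finI: "finite (X1 \<inter> I)"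
        by (rule finite_subset[OF _ indD(2)[OF iA b1]]) (use IA in auto)
      have UU1: "U \<subseteq> U1" by (auto simp: U_def)
      have NX: "N u \<subseteq> X" if u: "u \<in> U" for u
      proof -
        have "N' (shift A u) \<subseteq> X'" using b'D(4) u by (auto simp: U_def)
        then have "N u - I \<subseteq> X'" using N'_shift[of u] u UU1 tb by auto
        moreover have "N u \<subseteq> X1" using b1D(4) u UU1 by auto
        ultimately show ?thesis by (auto simp: X_def)
      qed
      have UX: "U \<subseteq> X" using NX N_self UU1 b1D(1) by blast
      have mX: "shift A ` U \<subseteq> X" by (auto simp: mU X_def b'D(3)[THEN subsetD])
      have fin: "finite (X - shift A ` U)" unfolding XmU using b'D(5) finI by simp
      note ct = card_shift_targets[OF iA ta(1) UU1 UX mX fin]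
      have b: "barrier U X"
        unfolding barrier_def using UU1 b1D(1,2) UX NX ct(1) by (auto simp: X_def)
      have "card G + card (X1 \<inter> I) = card (G \<union> (X1 \<inter> I))"
        by (rule card_Un_disjoint[symmetric]) (use G finI J in auto)
      also have "\<dots> \<le> card ((I \<union> J) \<inter> X)"
        by (rule card_mono[OF indD(2)[OF IJ b]]) (use G t(2) in \<open>auto simp: X_def\<close>)
      also have "\<dots> \<le> card (X - U)" by (rule indD(3)[OF IJ b])
      also have "\<dots> \<le> card (X - shift A ` U)" by (rule ct(2))
      also have "\<dots> \<le> card (X' - U') + card (X1 \<inter> I)" unfolding XmU by (rule card_Un_le)
      finally show "card G \<le> card (X' - U')" by simp
    qed
    then show "finite (J \<inter> X')" "card (J \<inter> X') \<le> card (X' - U')" by auto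
  qed
next
  assume J': "C.ind J"
  show "ind (I \<union> J)"
    unfolding ind_def
  proof (intro conjI allI impI)
    show "I \<union> J \<subseteq> V" using J IA indD(1)[OF iA] by auto
    fix U X assume b: "barrier U X"
    note bD = barrierD[OF b]
    obtain U1 where U1: "taut A U1" "U \<subseteq> U1" using barrier_taut[OF A b] by blast
    have Ub: "U \<subseteq> barred" using taut_barred[OF U1(1)] U1(2) by auto
    have mX: "shift A ` U \<subseteq> X" using shift_nb[OF A] Ub bD(4) by blast
    note cs = card_shift_sources[OF iA U1 bD(3) mX bD(5)]
    have mA: "shift A ` U \<subseteq> V - A" using shift_bij[OF A] Ub by (auto simp: bij_betw_def)
    have split: "X - shift A ` U = ((X - I) - shift A ` U) \<union> (I \<inter> X)" using mA IA by auto
    have fin: "finite ((X - I) - shift A ` U)" "finite (I \<inter> X)" using cs(1) unfolding split by auto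
    have b': "C.barrier (shift A ` U) (X - I)"
      unfolding C.barrier_def
    proof (intro conjI ballI)
      show "shift A ` U \<subseteq> V - A" by (rule mA)
      show "X - I \<subseteq> V - I" using bD(2) by auto
      show "shift A ` U \<subseteq> X - I" using mX mA IA by auto
      show "finite (X - I - shift A ` U)" by (rule fin(1))
      show "N' y \<subseteq> X - I" if y: "y \<in> shift A ` U" for y
      proof -
        obtain u where u: "u \<in> U" "y = shift A u" using y by auto
        then have "N' y = N u - I" using N'_shift Ub by auto
        then show ?thesis using bD(4)[OF u(1)] by auto
      qed
    qed
    have JX: "J \<inter> X = J \<inter> (X - I)" using J by auto
    have eq: "(I \<union> J) \<inter> X = (I \<inter> X) \<union> (J \<inter> X)" by auto
    show "finite ((I \<union> J) \<inter> X)" unfolding eq JX using fin C.indD(2)[OF J' b'] by simp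
    have "card ((I \<union> J) \<inter> X) \<le> card (I \<inter> X) + card (J \<inter> X)" unfolding eq by (rule card_Un_le)
    also have "\<dots> \<le> card (I \<inter> X) + card ((X - I) - shift A ` U)" unfolding JX using C.indD(3)[OF J' b'] by simp
    also have "\<dots> = card (X - shift A ` U)" unfolding split using fin by (subst card_Un_disjoint) auto
    also have "\<dots> \<le> card (X - U)" by (rule cs(2))
    finally show "card ((I \<union> J) \<inter> X) \<le> card (X - U)" .
  qed
qed

text \<open>Every vertex of the contraction reaches only finitely many exits.\<close>

lemma closed_barrier:
  assumes x: "x \<in> V - I"
  shows "\<exists>X. x \<in> X \<and> C.barrier (X \<inter> (V - A)) X"
proof -
  obtain U1 X1 where t: "tight A U1 X1" "x \<in> X1" using tight_at[OF A, of x] x by auto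
  note b1 = tightD(1)[OF t(1)]
  note b1D = barrierD[OF b1]
  note ta = tight_taut[OF iA t(1)]
  \<comment> \<open>Shifting makes a tight barrier closed: every vertex of \<open>X1\<close> outside
    \<open>A\<close> is the image of one in \<open>U1\<close>, whose neighbourhood lies in
    \<open>X1\<close>. The exits in \<open>X1\<close> belong to the finite set
    \<open>A \<inter> X1\<close>.\<close>
  have mU1: "shift A ` U1 = X1 - A" using shift_image[OF iA ta(1)] ta(2) barrier_nb(2)[OF b1] by auto
  have "C.barrier ((X1 - I) \<inter> (V - A)) (X1 - I)"
    unfolding C.barrier_def
  proof (intro conjI ballI)
    show "X1 - I \<subseteq> V - I" using b1D(2) by auto
    have "X1 - I - (X1 - I) \<inter> (V - A) \<subseteq> A \<inter> X1" using b1D(2) by auto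
    then show "finite (X1 - I - (X1 - I) \<inter> (V - A))" using indD(2)[OF iA b1] by (rule finite_subset)
    show "N' y \<subseteq> X1 - I" if y: "y \<in> (X1 - I) \<inter> (V - A)" for y
    proof -
      have "y \<in> shift A ` U1" using y mU1 by auto
      then obtain u where u: "u \<in> U1" "y = shift A u" by auto
      then have "N' y = N u - I" using N'_shift taut_barred[OF ta(1)] by auto
      then show ?thesis using b1D(4)[OF u(1)] by auto
    qed
  qed auto
  then show ?thesis using t(2) x by (intro exI[of _ "X1 - I"]) auto
qed

end

section \<open>Orbits of an injection\<close>

text \<open>The orbit stops at the first vertex outside \<open>Q\<close>, where \<open>m\<close>
  carries no information; that vertex is still included, as the end of the path.\<close>

inductive_set orbit :: "('v \<Rightarrow> 'v) \<Rightarrow> 'v set \<Rightarrow> 'v \<Rightarrow> 'v set" for m Q a where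
  orbit_start: "a \<in> orbit m Q a"
| orbit_step: "x \<in> orbit m Q a \<Longrightarrow> x \<in> Q \<Longrightarrow> m x \<in> orbit m Q a"

lemma orbit_disjoint:
  assumes inj: "inj_on m Q" and a: "a \<notin> m ` Q" and b: "b \<notin> m ` Q"
    and x: "x \<in> orbit m Q a" "x \<in> orbit m Q b"
  shows "a = b"
  using x
proof (induction rule: orbit.induct)
  case orbit_start
  then show ?case using a by (cases rule: orbit.cases) auto
next
  case (orbit_step y)
  from orbit_step.prems show ?case
  proof (cases rule: orbit.cases)
    case orbit_start
    then show ?thesis using b orbit_step.hyps(2) by auto
  next
    case (orbit_step z)
    then show ?thesis using inj \<open>y \<in> Q\<close> orbit_step.IH by (auto dest: inj_onD)
  qed
qed

lemma funpow_orbit: "(\<And>j. j < i \<Longrightarrow> (m ^^ j) a \<in> Q) \<Longrightarrow> (m ^^ i) a \<in> orbit m Q a"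
  by (induction i) (auto intro: orbit.intros)

lemma orbit_cases:
  assumes inj: "inj_on m Q" and a: "a \<notin> m ` Q"
  obtains (ray) f :: "nat \<Rightarrow> 'v" where "inj f" "f 0 = a" "\<And>i. f i \<in> Q" "\<And>i. f (Suc i) = m (f i)"
      "range f \<subseteq> orbit m Q a"
  | (path) p where "p \<noteq> []" "distinct p" "hd p = a" "last p \<notin> Q"
      "successively (\<lambda>u v. u \<in> Q \<and> v = m u) p" "set p \<subseteq> orbit m Q a"
proof (cases "\<forall>i. (m ^^ i) a \<in> Q")
  case True
  show thesis
  proof (rule ray[of "\<lambda>i. (m ^^ i) a"])
    show "inj (\<lambda>i. (m ^^ i) a)" using inj_funpow[OF inj a] True by simp
    have "(m ^^ i) a \<in> orbit m Q a" for i by (rule funpow_orbit) (use True in simp)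
    then show "range (\<lambda>i. (m ^^ i) a) \<subseteq> orbit m Q a" by auto
    show "(m ^^ i) a \<in> Q" for i using True by simp
  qed simp_all
next
  case False
  define k where "k = (LEAST i. (m ^^ i) a \<notin> Q)"
  have k: "(m ^^ k) a \<notin> Q" unfolding k_def using LeastI_ex[of "\<lambda>i. (m ^^ i) a \<notin> Q"] False by simp
  have less: "(m ^^ i) a \<in> Q" if "i < k" for i using not_less_Least[of i "\<lambda>i. (m ^^ i) a \<notin> Q"] that unfolding k_def by simp
  let ?p = "map (\<lambda>i. (m ^^ i) a) [0..<Suc k]"
  show thesis
  proof (rule path[of ?p])
    have "inj_on (\<lambda>i. (m ^^ i) a) {..k}" using inj_on_funpow[OF inj a less] .
    then have "inj_on (\<lambda>i. (m ^^ i) a) (set [0..<Suc k])" by (rule inj_on_subset) auto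
    then show "distinct ?p" unfolding distinct_map by (intro conjI distinct_upt)
    have "[0..<Suc k] = 0 # [Suc 0..<Suc k]" by (rule upt_conv_Cons) simp
    then show "hd ?p = a" by (simp only: list.map list.sel funpow_0)
    show "last ?p \<notin> Q" using k by simp
    show "successively (\<lambda>u v. u \<in> Q \<and> v = m u) ?p"
      unfolding successively_conv_nth
    proof (intro allI impI)
      fix i assume "Suc i < length ?p"
      then have "i < k" "?p ! i = (m ^^ i) a" "?p ! Suc i = m ((m ^^ i) a)" by (simp_all del: upt_Suc)
      then show "?p ! i \<in> Q \<and> ?p ! Suc i = m (?p ! i)" using less by simp
    qed
    show "set ?p \<subseteq> orbit m Q a"
    proof
      fix y assume "y \<in> set ?p"
      then obtain i where "i < Suc k" "y = (m ^^ i) a" unfolding set_map set_upt by auto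
      then show "y \<in> orbit m Q a" using funpow_orbit[of i m a Q] less by simp
    qed
  qed simp
qed

section \<open>Paths in digraphs\<close>

lemma successively_vwalk_arcs: "successively P p \<longleftrightarrow> (\<forall>(u, v) \<in> set (vwalk_arcs p). P u v)"
  by (induction p rule: vwalk_arcs.induct) auto

lemma vwalk_arcs_map: "vwalk_arcs (map f p) = map (map_prod f f) (vwalk_arcs p)"
  by (induction p rule: vwalk_arcs.induct) auto

lemma vwalk_arcs_verts: "(u, v) \<in> set (vwalk_arcs p) \<Longrightarrow> u \<in> set p \<and> v \<in> set p"
  by (induction p rule: vwalk_arcs.induct) auto

lemma vpath_iff:
  "vpath p (with_proj D) \<longleftrightarrow>
     p \<noteq> [] \<and> distinct p \<and> set p \<subseteq> pverts D \<and> successively (\<lambda>u v. (u, v) \<in> parcs D) p"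
  by (auto simp: vpath_def vwalk_def successively_vwalk_arcs)

lemma vpath_append: "vpath (p @ q) (with_proj D) \<Longrightarrow> q \<noteq> [] \<Longrightarrow> vpath q (with_proj D)"
  by (auto simp: vpath_iff successively_append_iff)

lemma set_path_cases: "p \<noteq> [] \<Longrightarrow> set p \<subseteq> {hd p, last p} \<union> inner_verts p"
proof (cases p rule: rev_cases)
  case (snoc q y)
  then show ?thesis by (cases q) (auto simp: inner_verts_def)
qed simp

lemma inner_verts_sub: "inner_verts p \<subseteq> set (tl p)"
  by (auto simp: inner_verts_def dest: in_set_butlastD)

lemma inner_verts_distinct: "distinct p \<Longrightarrow> hd p \<notin> inner_verts p \<and> last p \<notin> inner_verts p"
proof (cases p rule: rev_cases)
  case (snoc q y)
  then show "distinct p \<Longrightarrow> ?thesis" by (cases q) (auto simp: inner_verts_def dest: in_set_butlastD)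
qed (simp add: inner_verts_def)

lemma inner_verts_map: "inner_verts (map f p) = f ` inner_verts p"
  by (simp add: inner_verts_def map_butlast[symmetric] map_tl[symmetric])

definition dnb :: "'v pair_pre_digraph \<Rightarrow> 'v \<Rightarrow> 'v set" where
  "dnb D v = insert v {w. (v, w) \<in> parcs D}"

locale dimaze_system =
  fixes D :: "'v pair_pre_digraph" and B0
  assumes dimaze: "dimaze D B0"
begin

lemma arc_verts: "(u, v) \<in> parcs D \<Longrightarrow> u \<in> pverts D \<and> v \<in> pverts D"
proof -
  interpret pair_loopfree_digraph D using dimaze by (simp add: dimaze_def)
  show "(u, v) \<in> parcs D \<Longrightarrow> ?thesis" using wellformed' by blast
qed

lemma exits: "B0 \<subseteq> pverts D" "b \<in> B0 \<Longrightarrow> (b, v) \<notin> parcs D"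
  using dimaze by (auto simp: dimaze_def)

sublocale nbhd_system "pverts D" "pverts D - B0" "dnb D"
  by unfold_locales (use arc_verts in \<open>auto simp: dnb_def\<close>)

lemma path_verts:
  assumes "successively (\<lambda>u v. (u, v) \<in> parcs D) p" "hd p \<in> pverts D"
  shows "set p \<subseteq> pverts D"
  using assms
proof (induction p rule: induct_list012)
  case (3 x y zs)
  then show ?case using arc_verts by auto
qed auto

lemma vpath_shift:
  assumes "p \<noteq> []" "distinct p" "hd p \<in> pverts D" "successively (\<lambda>u v. u \<in> Q \<and> v = m u) p"
    and m: "\<And>v. v \<in> Q \<Longrightarrow> m v \<in> dnb D v"
  shows "vpath p (with_proj D)"
proof -
  have "successively (\<lambda>u v. (u, v) \<in> parcs D) p"
    using assms(2,4)
  proof (induction p rule: induct_list012)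
    case (3 x y zs)
    then have "x \<in> Q" "y = m x" "x \<noteq> y" by auto
    then have "(x, y) \<in> parcs D" using m[of x] by (auto simp: dnb_def)
    then show ?case using 3 by auto
  qed auto
  then show ?thesis using assms path_verts by (simp add: vpath_iff)
qed

text \<open>The orbits of the elements of \<open>A\<close> are disjoint. Without rays each of them
  is a finite path that stops outside the non-exits, thus at an exit.\<close>

lemma linkable_if_no_ray:
  assumes A: "A \<subseteq> pverts D" and inj: "inj_on m (pverts D - B0)"
    and m: "\<And>v. v \<in> pverts D - B0 \<Longrightarrow> m v \<in> dnb D v" and Am: "A \<inter> m ` (pverts D - B0) = {}"
    and nr: "\<And>f :: nat \<Rightarrow> 'v. inj f \<Longrightarrow> f 0 \<in> A \<Longrightarrow> (\<And>i. f i \<in> pverts D - B0) \<Longrightarrow> (\<And>i. f (Suc i) = m (f i)) \<Longrightarrow> False"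
  shows "linkable D B0 A"
proof -
  let ?W = "pverts D - B0"
  have "\<exists>p. vpath p (with_proj D) \<and> last p \<in> B0 \<and> hd p = a \<and> set p \<subseteq> orbit m ?W a" if a: "a \<in> A" for a
  proof -
    have a': "a \<notin> m ` ?W" using a Am by auto
    show ?thesis
    proof (cases rule: orbit_cases[OF inj a'])
      case (1 f)
      have "f 0 \<in> A" using 1(2) a by simp
      from nr[OF 1(1) this 1(3,4)] show ?thesis by (rule FalseE)
    next
      case (2 p)
      have "hd p \<in> pverts D" using 2(3) a A by auto
      then have v: "vpath p (with_proj D)" by (rule vpath_shift[OF 2(1,2) _ 2(5) m])
      then have "last p \<in> pverts D" using last_in_set[OF 2(1)] by (auto simp: vpath_iff)
      then have "last p \<in> B0" using 2(4) by simp
      then show ?thesis using v 2(3,6) by (intro exI[of _ p] conjI)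
    qed
  qed
  then obtain P where P: "\<And>a. a \<in> A \<Longrightarrow> vpath (P a) (with_proj D) \<and> last (P a) \<in> B0 \<and> hd (P a) = a \<and> set (P a) \<subseteq> orbit m ?W a"
    by metis
  have "linkage D B0 (P ` A)"
    unfolding linkage_def
  proof (intro conjI ballI impI)
    fix p q assume pq: "p \<in> P ` A" "q \<in> P ` A" "p \<noteq> q"
    then obtain a b where ab: "a \<in> A" "b \<in> A" "p = P a" "q = P b" by auto
    show "set p \<inter> set q = {}"
    proof (rule ccontr)
      assume "\<not> ?thesis"
      then obtain x where x: "x \<in> set (P a)" "x \<in> set (P b)" using ab by auto
      have "a \<notin> m ` ?W" "b \<notin> m ` ?W" using Am ab by auto
      moreover have "x \<in> orbit m ?W a" "x \<in> orbit m ?W b" using P[OF ab(1)] P[OF ab(2)] x by auto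
      ultimately have "a = b" by (rule orbit_disjoint[OF inj])
      then show False using pq ab by simp
    qed
  next
    fix p assume "p \<in> P ` A"
    then obtain a where "a \<in> A" "p = P a" by auto
    then show "vpath p (with_proj D)" "last p \<in> B0" using P[of a] by simp_all
  qed
  moreover have "hd ` P ` A = A"
  proof -
    have "hd ` P ` A = (\<lambda>a. hd (P a)) ` A" by (simp only: image_image)
    also have "\<dots> = (\<lambda>a. a) ` A" by (rule image_cong) (use P in simp_all)
    finally show ?thesis by simp
  qed
  ultimately show ?thesis unfolding linkable_def by blast
qed

text \<open>A routing moves finitely many vertices, while a ray would move infinitely many.\<close>

lemma finite_ind_linkable:
  assumes "finite A" "ind A"
  shows "linkable D B0 A"
proof -
  obtain m where m: "routing A m" using menger[OF assms] by blast
  then have r: "inj_on m (pverts D - B0)" "\<And>v. v \<in> pverts D - B0 \<Longrightarrow> m v \<in> dnb D v"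
    "finite {v \<in> pverts D - B0. m v \<noteq> v}" "A \<inter> m ` (pverts D - B0) = {}"
    unfolding routing_def by (simp_all add: Int_commute)
  show ?thesis
  proof (rule linkable_if_no_ray[OF indD(1)[OF assms(2)] r(1,2,4)])
    fix f :: "nat \<Rightarrow> 'v" assume f: "inj f" "\<And>i. f i \<in> pverts D - B0" "\<And>i. f (Suc i) = m (f i)"
    have "m (f i) \<noteq> f i" for i using injD[OF f(1), of "Suc i" i] f(3)[of i] by auto
    then have "range f \<subseteq> {v \<in> pverts D - B0. m v \<noteq> v}" using f(2) by blast
    then have "finite (range f)" using r(3) by (rule finite_subset)
    then show False using range_inj_infinite[OF f(1)] by contradiction
  qed
qed

text \<open>By \<open>cl\<close> every non-exit is barred, so finite orbits of the shift end at
  exits. A ray would stay in the closed set around its start, hence inside a barrier, where rays are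
  excluded.\<close>

lemma ind_linkable_if_closed:
  assumes cl: "\<And>x. x \<in> pverts D \<Longrightarrow> \<exists>X. x \<in> X \<and> barrier (X \<inter> (pverts D - B0)) X" and I: "ind I"
  shows "linkable D B0 I"
proof -
  obtain A where A: "maxind A" "I \<subseteq> A" using maxind_extension[OF I] .
  have Q: "barred = pverts D - B0"
  proof
    show "pverts D - B0 \<subseteq> barred"
    proof
      fix x assume x: "x \<in> pverts D - B0"
      then obtain X where "x \<in> X" "barrier (X \<inter> (pverts D - B0)) X" using cl[of x] by auto
      then show "x \<in> barred" using x by (auto simp: barred_def)
    qed
  qed (rule barred_sub)
  note bij = shift_bij[OF A(1)]
  show ?thesis
  proof (rule linkable_if_no_ray[OF indD(1)[OF I]])
    show "inj_on (shift A) (pverts D - B0)" using bij unfolding Q bij_betw_def by simp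
    show "shift A v \<in> dnb D v" if "v \<in> pverts D - B0" for v using shift_nb[OF A(1)] that Q by simp
    show "I \<inter> shift A ` (pverts D - B0) = {}" using bij A(2) unfolding Q bij_betw_def by auto
    fix f :: "nat \<Rightarrow> 'v"
    assume f: "inj f" "f 0 \<in> I" "\<And>i. f i \<in> pverts D - B0" "\<And>i. f (Suc i) = shift A (f i)"
    obtain X where X: "f 0 \<in> X" "barrier (X \<inter> (pverts D - B0)) X" using cl[of "f 0"] f(3)[of 0] by auto
    have "f i \<in> X" for i
    proof (induction i)
      case (Suc i)
      then have "dnb D (f i) \<subseteq> X" using barrierD(4)[OF X(2)] f(3) by blast
      then show ?case using shift_nb[OF A(1), of "f i"] f(3)[of i] f(4)[of i] Q by auto
    qed (rule X(1))
    then have "range f \<subseteq> X \<inter> (pverts D - B0)" using f(3) by auto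
    then show False using no_ray_barrier[OF A(1) X(2)] f(1,4) unfolding no_ray_def by blast
  qed
qed

section \<open>Topologically linkable sets are independent\<close>

text \<open>The walk runs in the subdivision with the extra vertex \<open>None\<close>, which it
  cannot reach from \<open>U\<close>: arcs into \<open>None\<close> start at exits, and
  \<open>U\<close> contains none.\<close>

lemma walk_stays:
  assumes b: "barrier U X" and D': "subdimaze D' B' D B0" and H: "D' = del_sink H" "B' = {b. (Some b, None) \<in> parcs H}"
    and p: "successively (\<lambda>x y. (x, y) \<in> parcs H) p" "p \<noteq> []" "hd p \<in> Some ` U" "set p \<inter> Some ` (X - U) = {}"
  shows "set p \<subseteq> Some ` U"
  using p
proof (induction p rule: induct_list012)
  case (3 x y zs)
  then obtain u where u: "x = Some u" "u \<in> U" by auto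
  have xy: "(Some u, y) \<in> parcs H" using 3 u by simp
  have "y \<in> Some ` U"
  proof (cases y)
    case None
    then have "u \<in> B0" using xy D' H by (auto simp: subdimaze_def)
    then show ?thesis using barrierD(1)[OF b] u by auto
  next
    case (Some v)
    then have "(u, v) \<in> parcs D'" using xy H by (simp add: del_sink_def)
    then have "(u, v) \<in> parcs D" using D' by (auto simp: subdimaze_def subgraph_def)
    then have "v \<in> X" using barrierD(4)[OF b u(2)] by (auto simp: dnb_def)
    then show ?thesis using 3 Some by auto
  qed
  then show ?case using 3 u by auto
qed auto

text \<open>A path from \<open>U\<close> to an exit meets \<open>X - U\<close>, and so do infinitely many disjoint ones.\<close>

lemma no_infinite_teeth:
  fixes l :: "nat \<Rightarrow> 'c"
  assumes b: "barrier U X" and D': "subdimaze D' B' D B0" and H: "D' = del_sink H" "B' = {b. (Some b, None) \<in> parcs H}"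
    and sd: "subdivides (add_sink C C0) \<phi> \<pi> H" and N: "\<phi> None = None"
    and l: "inj l" "\<And>i. l i \<in> C0" "\<And>i. (r i, l i) \<in> parcs C" "\<And>i. r i \<in> pverts C" "\<And>i. l i \<in> pverts C"
    and r: "\<And>i. \<phi> (Some (r i)) \<in> Some ` U"
  shows False
proof -
  let ?G = "add_sink C C0"
  have inj: "inj_on \<phi> (pverts ?G)" using sd by (simp add: subdivides_def)
  have p: "vpath (\<pi> e) (with_proj H)" "hd (\<pi> e) = \<phi> (fst e)" "last (\<pi> e) = \<phi> (snd e)"
    "inner_verts (\<pi> e) \<inter> \<phi> ` pverts ?G = {}" if "e \<in> parcs ?G" for e
    using sd that by (auto simp: subdivides_def)
  have dj: "inner_verts (\<pi> e) \<inter> inner_verts (\<pi> f) = {}" if "e \<in> parcs ?G" "f \<in> parcs ?G" "e \<noteq> f" for e f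
    using sd that by (auto simp: subdivides_def)
  define e e' where "e i = (Some (r i), Some (l i))" and "e' i = (Some (l i), None :: 'c option)" for i
  have ee: "e i \<in> parcs ?G" "e' i \<in> parcs ?G" for i using l by (auto simp: e_def e'_def add_sink_def)
  have vG: "Some (l i) \<in> pverts ?G" "None \<in> pverts ?G" "Some (r i) \<in> pverts ?G" for i using l by (auto simp: add_sink_def)
  \<comment> \<open>Tooth number \<open>i\<close> up to the sink, without its root and the sink: a
    fan has one root for all teeth, and what remains is disjoint for different
    \<open>i\<close>.\<close>
  define Z where "Z i = inner_verts (\<pi> (e i)) \<union> inner_verts (\<pi> (e' i)) \<union> {\<phi> (Some (l i))}" for i
  have "\<exists>t \<in> X - U. Some t \<in> Z i" for i
  proof (rule ccontr)
    assume neg: "\<not> ?thesis"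
    have s1: "set (\<pi> (e i)) \<subseteq> {\<phi> (Some (r i)), \<phi> (Some (l i))} \<union> inner_verts (\<pi> (e i))"
      using set_path_cases[of "\<pi> (e i)"] p[OF ee(1)] by (auto simp: vpath_iff e_def)
    have s2: "set (\<pi> (e' i)) \<subseteq> {\<phi> (Some (l i)), None} \<union> inner_verts (\<pi> (e' i))"
      using set_path_cases[of "\<pi> (e' i)"] p[OF ee(2)] N by (auto simp: vpath_iff e'_def)
    have "set (\<pi> (e i)) \<subseteq> Some ` U"
    proof (rule walk_stays[OF b D' H])
      show "successively (\<lambda>x y. (x, y) \<in> parcs H) (\<pi> (e i))" "\<pi> (e i) \<noteq> []"
        using p(1)[OF ee(1)] by (auto simp: vpath_iff)
      show "hd (\<pi> (e i)) \<in> Some ` U" using r p(2)[OF ee(1)] by (simp add: e_def)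
      show "set (\<pi> (e i)) \<inter> Some ` (X - U) = {}" using s1 neg r[of i] by (auto simp: Z_def)
    qed
    moreover have "\<phi> (Some (l i)) \<in> set (\<pi> (e i))"
      using p(1,3)[OF ee(1)] last_in_set[of "\<pi> (e i)"] by (auto simp: vpath_iff e_def)
    ultimately have lU: "\<phi> (Some (l i)) \<in> Some ` U" by auto
    have "set (\<pi> (e' i)) \<subseteq> Some ` U"
    proof (rule walk_stays[OF b D' H])
      show "successively (\<lambda>x y. (x, y) \<in> parcs H) (\<pi> (e' i))" "\<pi> (e' i) \<noteq> []"
        using p(1)[OF ee(2)] by (auto simp: vpath_iff)
      show "hd (\<pi> (e' i)) \<in> Some ` U" using lU p(2)[OF ee(2)] by (simp add: e'_def)
      show "set (\<pi> (e' i)) \<inter> Some ` (X - U) = {}" using s2 neg lU by (auto simp: Z_def)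
    qed
    moreover have "None \<in> set (\<pi> (e' i))"
      using p(1,3)[OF ee(2)] last_in_set[of "\<pi> (e' i)"] N by (auto simp: vpath_iff e'_def)
    ultimately show False by auto
  qed
  then obtain t where t: "\<And>i. t i \<in> X - U" "\<And>i. Some (t i) \<in> Z i" by metis
  have Zdj: "Z i \<inter> Z j = {}" if "i \<noteq> j" for i j
  proof -
    have lij: "l i \<noteq> l j" using l(1) that by (auto dest: injD)
    then have "e i \<noteq> e j" "e i \<noteq> e' j" "e' i \<noteq> e j" "e' i \<noteq> e' j" by (auto simp: e_def e'_def)
    moreover have "\<phi> (Some (l i)) \<noteq> \<phi> (Some (l j))" using inj_onD[OF inj _ vG(1) vG(1)] lij by blast
    moreover have "\<phi> (Some (l k)) \<notin> inner_verts (\<pi> (e i'))" "\<phi> (Some (l k)) \<notin> inner_verts (\<pi> (e' i'))" for k i'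
      using p(4)[OF ee(1)[of i']] p(4)[OF ee(2)[of i']] vG(1)[of k] by auto
    ultimately show ?thesis
      using dj[OF ee(1) ee(1), of i j] dj[OF ee(1) ee(2), of i j] dj[OF ee(2) ee(1), of i j] dj[OF ee(2) ee(2), of i j]
      unfolding Z_def by blast
  qed
  have "inj t"
  proof (rule injI, rule ccontr)
    fix i j assume "t i = t j" "i \<noteq> j"
    then show False using Zdj[of i j] t(2)[of i] t(2)[of j] by auto
  qed
  then have "infinite (range t)" using range_inj_infinite by blast
  moreover have "range t \<subseteq> X - U" using t(1) by auto
  ultimately show False using barrierD(5)[OF b] by (metis finite_subset)
qed

lemma fan_centre_not_in_barrier:
  assumes b: "barrier U X" and c: "linking_fan_centre D B0 c"
  shows "c \<notin> U"
proof
  assume cU: "c \<in> U"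
  obtain D' B' \<phi> \<pi> where D': "subdimaze D' B' D B0" "subdivides_dimaze Finf Finf_exits \<phi> \<pi> D' B'" "\<phi> (Some Centre) = Some c"
    using c unfolding linking_fan_centre_def by blast
  then obtain H where H: "subdivides (add_sink Finf Finf_exits) \<phi> \<pi> H" "\<phi> None = None"
    "D' = del_sink H" "B' = {b. (Some b, None) \<in> parcs H}"
    unfolding subdivides_dimaze_def by blast
  show False
    by (rule no_infinite_teeth[OF b D'(1) H(3,4,1,2), of Leaf "\<lambda>_. Centre"])
      (use cU D'(3) in \<open>auto simp: Finf_def Finf_exits_def inj_def\<close>)
qed

text \<open>A spine that starts in \<open>X\<close> and misses the boundary stays in
  \<open>U\<close>; then infinitely many teeth have their roots in \<open>U\<close>.\<close>

lemma comb_spine_meets_boundary: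
  assumes b: "barrier U X" and x: "x \<in> X" and S: "outgoing_comb_spine D B0 x S"
  shows "S \<inter> (X - U) \<noteq> {}"
proof
  assume disj: "S \<inter> (X - U) = {}"
  obtain D' B' \<phi> \<pi> where D': "subdimaze D' B' D B0" "subdivides_dimaze CO CO_exits \<phi> \<pi> D' B'" "\<phi> (Some (CX 1)) = Some x"
    and Seq: "S = {v. \<exists>i\<ge>1. Some v \<in> set (\<pi> (Some (CX i), Some (CX (i + 1))))}"
    using S unfolding outgoing_comb_spine_def by blast
  then obtain H where H: "subdivides (add_sink CO CO_exits) \<phi> \<pi> H" "\<phi> None = None"
    "D' = del_sink H" "B' = {b. (Some b, None) \<in> parcs H}"
    unfolding subdivides_dimaze_def by blast
  define e where "e i = (Some (CX i), Some (CX (i + 1)))" for i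
  have "e i \<in> parcs (add_sink CO CO_exits)" if "i \<ge> 1" for i using that by (auto simp: e_def add_sink_def CO_def)
  then have p: "vpath (\<pi> (e i)) (with_proj H)" "hd (\<pi> (e i)) = \<phi> (Some (CX i))" "last (\<pi> (e i)) = \<phi> (Some (CX (i + 1)))"
    if "i \<ge> 1" for i using H(1) that by (auto simp: subdivides_def e_def)
  have "Some x \<in> set (\<pi> (e 1))" using p(1,2)[of 1] D'(3) hd_in_set[of "\<pi> (e 1)"] by (auto simp: vpath_iff)
  then have "x \<in> S" unfolding Seq e_def by auto
  then have xU: "x \<in> U" using x disj by auto
  have stay: "\<phi> (Some (CX (Suc i))) \<in> Some ` U" for i
  proof (induction i)
    case 0
    then show ?case using D'(3) xU by simp
  next
    case (Suc i)
    have "set (\<pi> (e (Suc i))) \<subseteq> Some ` U"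
    proof (rule walk_stays[OF b D'(1) H(3,4)])
      show "successively (\<lambda>x y. (x, y) \<in> parcs H) (\<pi> (e (Suc i)))" "\<pi> (e (Suc i)) \<noteq> []"
        using p(1)[of "Suc i"] by (auto simp: vpath_iff)
      show "hd (\<pi> (e (Suc i))) \<in> Some ` U" using Suc p(2)[of "Suc i"] by simp
      have "v \<in> S" if "Some v \<in> set (\<pi> (e (Suc i)))" for v
        unfolding Seq using that by (intro CollectI exI[of _ "Suc i"]) (simp add: e_def)
      then show "set (\<pi> (e (Suc i))) \<inter> Some ` (X - U) = {}" using disj by auto
    qed
    moreover have "last (\<pi> (e (Suc i))) \<in> set (\<pi> (e (Suc i)))" using p(1)[of "Suc i"] by (auto simp: vpath_iff)
    ultimately show ?case using p(3)[of "Suc i"] by auto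
  qed
  \<comment> \<open>\<open>CX 1\<close> bears no tooth, hence the offset 2.\<close>
  show False
    by (rule no_infinite_teeth[OF b D'(1) H(3,4,1,2), of "\<lambda>i. CY (i + 2)" "\<lambda>i. CX (i + 2)"])
      (use stay[of "Suc _"] in \<open>auto simp: CO_def CO_exits_def inj_def\<close>)
qed

lemma topological_path_start:
  assumes "topological_path D B0 x S" shows "x \<in> S"
  using assms unfolding topological_path_def
proof (elim disjE exE conjE)
  assume "outgoing_comb_spine D B0 x S"
  then obtain D' B' \<phi> \<pi> where D': "subdivides_dimaze CO CO_exits \<phi> \<pi> D' B'" "\<phi> (Some (CX 1)) = Some x"
    and Seq: "S = {v. \<exists>i\<ge>1. Some v \<in> set (\<pi> (Some (CX i), Some (CX (i + 1))))}"
    unfolding outgoing_comb_spine_def by blast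
  then obtain H where H: "subdivides (add_sink CO CO_exits) \<phi> \<pi> H" unfolding subdivides_dimaze_def by blast
  have "(Some (CX 1), Some (CX (1 + 1))) \<in> parcs (add_sink CO CO_exits)" by (auto simp: add_sink_def CO_def)
  then have "vpath (\<pi> (Some (CX 1), Some (CX (1 + 1)))) (with_proj H)" "hd (\<pi> (Some (CX 1), Some (CX (1 + 1)))) = Some x"
    using H D'(2) by (auto simp: subdivides_def)
  then have "Some x \<in> set (\<pi> (Some (CX 1), Some (CX (1 + 1))))"
    using hd_in_set[of "\<pi> (Some (CX 1), Some (CX (1 + 1)))"] by (auto simp: vpath_iff)
  then show "x \<in> S" unfolding Seq by (intro CollectI exI[of _ 1]) simp
qed (auto simp: vpath_iff)

lemma topological_path_meets_boundary:
  assumes b: "barrier U X" and x: "x \<in> X" and S: "topological_path D B0 x S"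
  shows "S \<inter> (X - U) \<noteq> {}"
proof
  assume disj: "S \<inter> (X - U) = {}"
  have xU: "x \<in> U" using topological_path_start[OF S] x disj by auto
  from S comb_spine_meets_boundary[OF b x] disj
  obtain p where p: "vpath p (with_proj D)" "hd p = x" "S = set p" "linking_fan_centre D B0 (last p) \<or> last p \<in> B0"
    unfolding topological_path_def by blast
  have "set p \<subseteq> U" if "successively (\<lambda>u v. (u, v) \<in> parcs D) p" "p \<noteq> []" "hd p \<in> U" "set p \<inter> (X - U) = {}" for p
    using that
  proof (induction p rule: induct_list012)
    case (3 x y zs)
    then have "y \<in> X" using barrierD(4)[OF b, of x] by (auto simp: dnb_def)
    then show ?case using 3 by auto
  qed auto
  then have "set p \<subseteq> U" using p disj xU by (auto simp: vpath_iff)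
  then have "last p \<in> U" using p(1) by (auto simp: vpath_iff)
  then show False using p(4) fan_centre_not_in_barrier[OF b] barrierD(1)[OF b] by auto
qed

text \<open>Every path that starts in \<open>X\<close> meets the finite boundary, and disjointness
  makes a choice of meeting points injective.\<close>

lemma topologically_linkable_ind:
  assumes A: "topologically_linkable D B0 A"
  shows "ind A"
  unfolding ind_def
proof (intro conjI allI impI)
  show "A \<subseteq> pverts D" using A by (simp add: topologically_linkable_def)
  obtain P where P: "\<And>x. x \<in> A \<Longrightarrow> topological_path D B0 x (P x)" "disjoint_family_on P A"
    using A unfolding topologically_linkable_def by blast
  fix U X assume b: "barrier U X"
  have "\<exists>t. t \<in> P x \<and> t \<in> X - U" if "x \<in> A \<inter> X" for x
    using topological_path_meets_boundary[OF b, of x "P x"] P(1)[of x] that by auto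
  then obtain t where t: "\<And>x. x \<in> A \<inter> X \<Longrightarrow> t x \<in> P x \<and> t x \<in> X - U" by metis
  have inj: "inj_on t (A \<inter> X)"
  proof (rule inj_onI, rule ccontr)
    fix x y assume xy: "x \<in> A \<inter> X" "y \<in> A \<inter> X" "t x = t y" "x \<noteq> y"
    then have "P x \<inter> P y = {}" using P(2) by (auto simp: disjoint_family_on_def)
    then show False using t[OF xy(1)] t[OF xy(2)] xy(3) by auto
  qed
  have sub: "t ` (A \<inter> X) \<subseteq> X - U" using t by auto
  show "finite (A \<inter> X)" "card (A \<inter> X) \<le> card (X - U)"
    using inj_on_finite[OF inj sub] card_inj_on_le[OF inj sub] barrierD(5)[OF b] by auto
qed

end

section \<open>Constructing linking fans and outgoing combs\<close>

text \<open>Arcs into the sink stay unsubdivided, so the exits of the copy are the images of the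
  given exits. The empty list is a dummy: no arc of \<open>add_sink\<close> starts at
  \<open>None\<close>.\<close>

definition lift_paths ::
  "('c \<Rightarrow> 'v) \<Rightarrow> ('c \<times> 'c \<Rightarrow> 'v list) \<Rightarrow> 'c option \<times> 'c option \<Rightarrow> 'v option list" where
  "lift_paths \<phi> \<pi> e =
     (case fst e of None \<Rightarrow> [] | Some u \<Rightarrow>
       (case snd e of None \<Rightarrow> [Some (\<phi> u), None] | Some v \<Rightarrow> map Some (\<pi> (u, v))))"

lemma lift_paths_simps [simp]:
  "lift_paths \<phi> \<pi> (Some u, None) = [Some (\<phi> u), None]"
  "lift_paths \<phi> \<pi> (Some u, Some v) = map Some (\<pi> (u, v))"
  by (simp_all add: lift_paths_def)

context dimaze_system
begin

lemma subdivided_dimaze_exists: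
  assumes inj: "inj_on \<phi> (pverts C)" and V: "\<phi> ` pverts C \<subseteq> pverts D"
    and C: "\<And>u v. (u, v) \<in> parcs C \<Longrightarrow> u \<in> pverts C \<and> v \<in> pverts C"
    and C0: "C0 \<subseteq> pverts C" "\<phi> ` C0 \<subseteq> B0"
    and \<pi>: "\<And>u v. (u, v) \<in> parcs C \<Longrightarrow> vpath (\<pi> (u, v)) (with_proj D) \<and>
        hd (\<pi> (u, v)) = \<phi> u \<and> last (\<pi> (u, v)) = \<phi> v \<and> inner_verts (\<pi> (u, v)) \<inter> \<phi> ` pverts C = {}"
    and dj: "\<And>e f. e \<in> parcs C \<Longrightarrow> f \<in> parcs C \<Longrightarrow> e \<noteq> f \<Longrightarrow> inner_verts (\<pi> e) \<inter> inner_verts (\<pi> f) = {}"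
  shows "\<exists>D' B'. subdimaze D' B' D B0 \<and> subdivides_dimaze C C0 (map_option \<phi>) (lift_paths \<phi> \<pi>) D' B'"
proof -
  let ?G = "add_sink C C0" and ?\<phi> = "map_option \<phi>" and ?\<pi> = "lift_paths \<phi> \<pi>"
  define H where "H = \<lparr> pverts = ?\<phi> ` pverts ?G \<union> (\<Union>e \<in> parcs ?G. set (?\<pi> e)),
                      parcs = (\<Union>e \<in> parcs ?G. set (vwalk_arcs (?\<pi> e))) \<rparr>"
  have Hs: "pverts H = ?\<phi> ` pverts ?G \<union> (\<Union>e \<in> parcs ?G. set (?\<pi> e))"
    "parcs H = (\<Union>e \<in> parcs ?G. set (vwalk_arcs (?\<pi> e)))" by (simp_all add: H_def)
  have Gv: "pverts ?G = insert None (Some ` pverts C)" by (simp add: add_sink_def)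
  have Gcases: "(\<exists>u v. e = (Some u, Some v) \<and> (u, v) \<in> parcs C) \<or> (\<exists>b. e = (Some b, None) \<and> b \<in> C0)"
    if "e \<in> parcs ?G" for e using that by (auto simp: add_sink_def)
  have \<phi>G: "?\<phi> ` pverts ?G = insert None (Some ` \<phi> ` pverts C)" by (auto simp: Gv image_iff)
  have sd: "subdivides ?G ?\<phi> ?\<pi> H"
    unfolding subdivides_def
  proof (intro conjI ballI impI)
    show "inj_on ?\<phi> (pverts ?G)" using inj by (auto simp: Gv inj_on_def)
    show "pverts H = ?\<phi> ` pverts ?G \<union> (\<Union>e \<in> parcs ?G. set (?\<pi> e))" by (rule Hs(1))
    show "parcs H = (\<Union>e \<in> parcs ?G. set (vwalk_arcs (?\<pi> e)))" by (rule Hs(2))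
    fix e assume e: "e \<in> parcs ?G"
    consider (arc) u v where "e = (Some u, Some v)" "(u, v) \<in> parcs C" | (exit) b where "e = (Some b, None)" "b \<in> C0"
      using Gcases[OF e] by blast
    note c = this
    have ne: "?\<pi> e \<noteq> []" "distinct (?\<pi> e)"
      using c by (cases; use \<pi> in \<open>auto simp: vpath_iff distinct_map\<close>)+
    have "set (?\<pi> e) \<subseteq> pverts H" "set (vwalk_arcs (?\<pi> e)) \<subseteq> parcs H" using e by (auto simp: Hs)
    then show "vpath (?\<pi> e) (with_proj H)" using ne by (auto simp: vpath_def vwalk_def)
    show "hd (?\<pi> e) = ?\<phi> (fst e)" using c by (cases; use \<pi> in \<open>auto simp: vpath_iff hd_map\<close>)
    show "last (?\<pi> e) = ?\<phi> (snd e)" using c by (cases; use \<pi> in \<open>auto simp: vpath_iff last_map\<close>)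
    show "inner_verts (?\<pi> e) \<inter> ?\<phi> ` pverts ?G = {}"
      using c
    proof cases
      case (arc u v)
      then show ?thesis using \<pi>[OF arc(2)] by (auto simp: inner_verts_map \<phi>G)
    qed (simp add: inner_verts_def)
    fix f assume f: "f \<in> parcs ?G" "e \<noteq> f"
    show "inner_verts (?\<pi> e) \<inter> inner_verts (?\<pi> f) = {}"
      using c
    proof cases
      case (arc u v)
      note e_arc = this
      show ?thesis
      proof (cases "snd f")
        case None
        then have "inner_verts (?\<pi> f) = {}" using Gcases[OF f(1)] by (auto simp: inner_verts_def)
        then show ?thesis by simp
      next
        case (Some v')
        then obtain u' where f': "f = (Some u', Some v')" "(u', v') \<in> parcs C" using Gcases[OF f(1)] by auto
        then have "(u, v) \<noteq> (u', v')" using f(2) e_arc by auto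
        from dj[OF e_arc(2) f'(2) this] show ?thesis
          by (auto simp: e_arc(1) f'(1) inner_verts_map)
      qed
    qed (simp add: inner_verts_def)
  qed
  define D' B' where "D' = del_sink H" and "B' = {b. (Some b, None) \<in> parcs H}"
  have arcH: "(\<exists>u v. x = Some u \<and> y = Some v \<and> (u, v) \<in> parcs D) \<or> (\<exists>b \<in> B0. x = Some b \<and> y = None)"
    if xy: "(x, y) \<in> parcs H" for x y
  proof -
    obtain e where e: "e \<in> parcs ?G" "(x, y) \<in> set (vwalk_arcs (?\<pi> e))" using xy Hs(2) by blast
    from Gcases[OF e(1)] show ?thesis
    proof (elim disjE exE conjE)
      fix u v assume uv: "e = (Some u, Some v)" "(u, v) \<in> parcs C"
      then obtain a b where ab: "(a, b) \<in> set (vwalk_arcs (\<pi> (u, v)))" "x = Some a" "y = Some b"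
        using e(2) by (auto simp: vwalk_arcs_map)
      have "set (vwalk_arcs (\<pi> (u, v))) \<subseteq> parcs D" using \<pi>[OF uv(2)] by (auto simp: vpath_def vwalk_def)
      then show ?thesis using ab by blast
    next
      fix b assume "e = (Some b, None)" "b \<in> C0"
      then show ?thesis using e(2) C0(2) by auto
    qed
  qed
  have vertH: "v \<in> pverts D" if v: "Some v \<in> pverts H" for v
  proof -
    have "Some v \<in> ?\<phi> ` pverts ?G \<or> (\<exists>e \<in> parcs ?G. Some v \<in> set (?\<pi> e))" using v Hs(1) by blast
    then show ?thesis
    proof (elim disjE bexE)
      assume "Some v \<in> ?\<phi> ` pverts ?G"
      then show ?thesis using V by (auto simp: \<phi>G)
    next
      fix e assume e: "e \<in> parcs ?G" "Some v \<in> set (?\<pi> e)"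
      from Gcases[OF e(1)] show ?thesis
      proof (elim disjE exE conjE)
        fix a b assume ab: "e = (Some a, Some b)" "(a, b) \<in> parcs C"
        then have "v \<in> set (\<pi> (a, b))" using e(2) by auto
        then show ?thesis using \<pi>[OF ab(2)] by (auto simp: vpath_iff)
      next
        fix b assume "e = (Some b, None)" "b \<in> C0"
        then show ?thesis using e(2) C0(1) V by auto
      qed
    qed
  qed
  have arcvertH: "x \<in> pverts H \<and> y \<in> pverts H" if xy: "(x, y) \<in> parcs H" for x y
  proof -
    obtain e where "e \<in> parcs ?G" "(x, y) \<in> set (vwalk_arcs (?\<pi> e))" using xy Hs(2) by blast
    then show ?thesis using vwalk_arcs_verts[of x y "?\<pi> e"] Hs(1) by blast
  qed
  have "subdimaze D' B' D B0"
    unfolding subdimaze_def subgraph_def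
  proof (intro conjI)
    show "verts (with_proj D') \<subseteq> verts (with_proj D)" using vertH by (auto simp: D'_def del_sink_def)
    show "arcs (with_proj D') \<subseteq> arcs (with_proj D)" using arcH by (fastforce simp: D'_def del_sink_def)
    show "wf_digraph (with_proj D)" by unfold_locales (use arc_verts in auto)
    show "wf_digraph (with_proj D')" by unfold_locales (use arcvertH in \<open>auto simp: D'_def del_sink_def\<close>)
    show "compatible (with_proj D) (with_proj D')" by (simp add: compatible_def)
    show "B' \<subseteq> B0" using arcH by (fastforce simp: B'_def)
  qed
  moreover have "subdivides_dimaze C C0 ?\<phi> ?\<pi> D' B'"
    unfolding subdivides_dimaze_def using sd by (auto simp: D'_def B'_def)
  ultimately show ?thesis by blast
qed

text \<open>The vertices reachable from \<open>S - Y\<close> without entering \<open>Y\<close>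
  include no exit, and their other out-neighbours lie in \<open>Y\<close>. Read backwards: where no
  such barrier exists, paths to the exits can avoid any finite set.\<close>

lemma separating_barrier:
  assumes S: "S \<subseteq> pverts D" and Y: "finite Y"
    and sep: "\<And>p. vpath p (with_proj D) \<Longrightarrow> hd p \<in> S \<Longrightarrow> last p \<in> B0 \<Longrightarrow> set p \<inter> Y \<noteq> {}"
  shows "\<exists>U X. barrier U X \<and> S \<subseteq> X \<and> S - Y \<subseteq> U"
proof -
  define r where "r u v \<longleftrightarrow> (u, v) \<in> parcs D \<and> v \<notin> Y" for u v
  define R where "R = {v. \<exists>s \<in> S - Y. r\<^sup>*\<^sup>* s v}"
  have RV: "R \<subseteq> pverts D"
  proof
    fix v assume "v \<in> R"
    then obtain s where "s \<in> S - Y" "r\<^sup>*\<^sup>* s v" by (auto simp: R_def)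
    from this(2,1) show "v \<in> pverts D" using S arc_verts by (induction) (auto simp: r_def)
  qed
  have RB: "R \<inter> B0 = {}"
  proof (rule ccontr)
    assume "\<not> ?thesis"
    then obtain v s where vs: "v \<in> B0" "s \<in> S - Y" "r\<^sup>*\<^sup>* s v" by (auto simp: R_def)
    obtain p where p: "p \<noteq> []" "hd p = s" "last p = v" "distinct p" "successively r p"
      using rtranclp_distinct_path[OF vs(3)] by blast
    have "successively (\<lambda>u v. (u, v) \<in> parcs D) p" by (rule successively_mono[OF p(5)]) (auto simp: r_def)
    moreover have "hd p \<in> pverts D" using p(2) vs(2) S by auto
    ultimately have "vpath p (with_proj D)" using path_verts p(1,4) by (simp add: vpath_iff)
    moreover have "set p \<inter> Y = {}" if "successively r p" "hd p \<notin> Y" for p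
      using that by (induction p rule: induct_list012) (auto simp: r_def)
    then have "set p \<inter> Y = {}" using p(2,5) vs(2) by auto
    ultimately show False using sep[of p] p(2,3) vs by auto
  qed
  have "barrier R (R \<union> (Y \<inter> pverts D))"
    unfolding barrier_def
  proof (intro conjI ballI)
    show "R \<subseteq> pverts D - B0" using RV RB by auto
    show "finite (R \<union> Y \<inter> pverts D - R)" by (rule finite_subset[OF _ Y]) auto
    fix u assume u: "u \<in> R"
    show "dnb D u \<subseteq> R \<union> (Y \<inter> pverts D)"
    proof
      fix w assume "w \<in> dnb D u"
      then consider "w = u" | "(u, w) \<in> parcs D" by (auto simp: dnb_def)
      then show "w \<in> R \<union> (Y \<inter> pverts D)"
      proof cases
        case 2
        show ?thesis
        proof (cases "w \<in> Y")
          case False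
          then have "r u w" using 2 by (simp add: r_def)
          then show ?thesis using u by (auto simp: R_def intro: rtranclp.rtrancl_into_rtrancl)
        qed (use 2 arc_verts in auto)
      qed (use u in simp)
    qed
  qed (use RV in auto)
  moreover have "S - Y \<subseteq> R" by (auto simp: R_def)
  ultimately show ?thesis using S by (intro exI[of _ R] exI[of _ "R \<union> (Y \<inter> pverts D)"]) auto
qed

end

text \<open>Greedy selection: \<open>P Y p\<close> is meant to say that \<open>p\<close> avoids
  \<open>Y\<close>, and \<open>s p\<close> is the finite set that \<open>p\<close> blocks for later
  choices.\<close>

lemma infinite_choice:
  fixes s :: "'p \<Rightarrow> 'v set"
  assumes "\<And>p. finite (s p)" and ex: "\<And>Y. finite Y \<Longrightarrow> \<exists>p. P Y p"
  shows "\<exists>p :: nat \<Rightarrow> 'p. \<forall>n. P (\<Union>i<n. s (p i)) (p n)"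
proof (rule dependent_wellorder_choice)
  fix r :: 'p and f g :: "nat \<Rightarrow> 'p" and x :: nat
  assume "\<And>y. y < x \<Longrightarrow> f y = g y"
  then have "(\<Union>i<x. s (f i)) = (\<Union>i<x. s (g i))" by auto
  then show "P (\<Union>i<x. s (f i)) r = P (\<Union>i<x. s (g i)) r" by simp
next
  fix x :: nat and f :: "nat \<Rightarrow> 'p"
  show "\<exists>r. P (\<Union>i<x. s (f i)) r" by (rule ex) (use assms(1) in auto)
qed

context dimaze_system
begin

text \<open>As \<open>c\<close> is not barred, no finite set without \<open>c\<close> separates it
  from the exits, so infinitely many paths that share only \<open>c\<close> can be picked one after
  another.\<close>

lemma linking_fan_exists:
  assumes c: "c \<in> pverts D - B0" "c \<notin> barred"
  shows "linking_fan_centre D B0 c"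
proof -
  define P where "P Y p \<longleftrightarrow> vpath p (with_proj D) \<and> hd p = c \<and> last p \<in> B0 \<and> set p \<inter> (Y - {c}) = {}" for Y p
  have ex: "\<exists>p. P Y p" if Y: "finite Y" for Y
  proof (rule ccontr)
    assume neg: "\<not> ?thesis"
    have "\<exists>U X. barrier U X \<and> {c} \<subseteq> X \<and> {c} - (Y - {c}) \<subseteq> U"
      by (rule separating_barrier) (use c Y neg in \<open>auto simp: P_def\<close>)
    then show False using c(2) by (auto simp: barred_def)
  qed
  obtain p :: "nat \<Rightarrow> 'v list" where "\<forall>n. P (\<Union>i<n. set (p i)) (p n)"
    using infinite_choice[of set P, OF _ ex] by auto
  then have p: "P (\<Union>i<n. set (p i)) (p n)" for n by (rule spec)
  have v: "vpath (p n) (with_proj D)" "hd (p n) = c" "last (p n) \<in> B0" "p n \<noteq> []" "distinct (p n)" "set (p n) \<subseteq> pverts D" for n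
    using p[of n] by (auto simp: P_def vpath_iff)
  have less: "set (p n) \<inter> set (p i) \<subseteq> {c}" if "i < n" for i n
    using p[of n] that by (auto simp: P_def)
  have meet: "set (p n) \<inter> set (p i) \<subseteq> {c}" if "i \<noteq> n" for i n
    using less[of i n] less[of n i] that by (auto simp: neq_iff)
  have lc: "last (p n) \<noteq> c" for n using v(3)[of n] c(1) by auto
  have lin: "last (p n) \<in> set (p n)" for n using v(4) by simp
  have ll: "last (p n) \<notin> set (p i)" if "i \<noteq> n" for i n using meet[OF that] lin[of n] lc[of n] by auto
  define \<phi> where "\<phi> x = (case x of Centre \<Rightarrow> c | Leaf n \<Rightarrow> last (p n))" for x
  define \<pi> where "\<pi> e = (case snd e of Centre \<Rightarrow> [] | Leaf n \<Rightarrow> p n)" for e :: "fan_vertex \<times> fan_vertex"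
  have \<phi>: "\<phi> Centre = c" "\<phi> (Leaf n) = last (p n)" and \<pi>: "\<pi> (x, Leaf n) = p n" for n x
    by (simp_all add: \<phi>_def \<pi>_def)
  have inner: "inner_verts (p n) \<subseteq> set (p n)" for n
    using inner_verts_sub[of "p n"] by (auto dest: list.set_sel(2)[OF v(4)])
  have ic: "c \<notin> inner_verts (p n)" "last (p n) \<notin> inner_verts (p n)" for n
    using inner_verts_distinct[OF v(5)[of n]] v(2)[of n] by auto
  have "\<exists>D' B'. subdimaze D' B' D B0 \<and> subdivides_dimaze Finf Finf_exits (map_option \<phi>) (lift_paths \<phi> \<pi>) D' B'"
  proof (rule subdivided_dimaze_exists)
    show "inj_on \<phi> (pverts Finf)"
    proof (rule inj_onI)
      have "i = n" if "\<phi> (Leaf i) = \<phi> (Leaf n)" for i n using ll[of n i] lin[of n] that by (auto simp: \<phi>)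
      moreover have "\<phi> (Leaf n) \<noteq> \<phi> Centre" for n using lc by (simp add: \<phi>)
      moreover fix x y assume "\<phi> x = \<phi> y"
      ultimately show "x = y" by (cases x; cases y) metis+
    qed
    have "\<phi> x \<in> pverts D" for x
    proof (cases x)
      case (Leaf n)
      then show ?thesis using v(3)[of n] exits(1) by (auto simp: \<phi>)
    qed (use c(1) in \<open>simp add: \<phi>\<close>)
    then show "\<phi> ` pverts Finf \<subseteq> pverts D" by auto
    show "Finf_exits \<subseteq> pverts Finf" by (auto simp: Finf_exits_def Finf_def)
    show "\<phi> ` Finf_exits \<subseteq> B0" using v(3) by (auto simp: Finf_exits_def \<phi>)
    show "u \<in> pverts Finf \<and> v \<in> pverts Finf" if "(u, v) \<in> parcs Finf" for u v using that by (auto simp: Finf_def)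
    show "vpath (\<pi> (u, w)) (with_proj D) \<and> hd (\<pi> (u, w)) = \<phi> u \<and> last (\<pi> (u, w)) = \<phi> w \<and>
        inner_verts (\<pi> (u, w)) \<inter> \<phi> ` pverts Finf = {}" if uw: "(u, w) \<in> parcs Finf" for u w
    proof -
      obtain n where n: "u = Centre" "w = Leaf n" using uw by (auto simp: Finf_def)
      have "\<phi> x \<notin> inner_verts (p n)" for x
      proof (cases x)
        case (Leaf i)
        then show ?thesis using ic(2)[of n] ll[of n i] inner[of n] by (cases "i = n") (auto simp: \<phi>)
      qed (simp add: \<phi> ic)
      then show ?thesis using v n by (auto simp: \<phi> \<pi>)
    qed
    show "inner_verts (\<pi> e) \<inter> inner_verts (\<pi> f) = {}"
      if ef: "e \<in> parcs Finf" "f \<in> parcs Finf" "e \<noteq> f" for e f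
    proof -
      obtain n i where ni: "e = (Centre, Leaf n)" "f = (Centre, Leaf i)" using ef(1,2) by (auto simp: Finf_def)
      then have "i \<noteq> n" using ef(3) by auto
      then show ?thesis using meet[of i n] inner[of n] inner[of i] ic(1)[of n] by (auto simp: ni \<pi>)
    qed
  qed
  moreover have "map_option \<phi> (Some Centre) = Some c" by (simp add: \<phi>)
  ultimately show ?thesis unfolding linking_fan_centre_def by blast
qed

text \<open>No barrier contains the ray, so paths from it to exits can avoid any finite set and
  teeth can be picked greedily. Starting each path at its last vertex on the ray makes the tooth
  meet the spine in its root only.\<close>

lemma outgoing_comb_exists:
  assumes f: "inj (f :: nat \<Rightarrow> 'v)" "\<And>i. f i \<in> pverts D - B0" "\<And>i. (f i, f (Suc i)) \<in> parcs D"
    and nb: "\<And>U X. barrier U X \<Longrightarrow> \<not> range f \<subseteq> X"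
  shows "outgoing_comb_spine D B0 (f 0) (range f)"
proof -
  define idx where "idx p = inv f (hd p)" for p
  \<comment> \<open>A tooth also blocks the spine up to its root, so that the roots move strictly
    forward.\<close>
  define s where "s p = set p \<union> f ` {..idx p}" for p
  \<comment> \<open>\<open>f 0\<close> is avoided because the first branch vertex
    \<open>CX 1\<close> has no tooth.\<close>
  define P where "P Y p \<longleftrightarrow> vpath p (with_proj D) \<and> hd p \<in> range f \<and> set (tl p) \<inter> range f = {} \<and>
      last p \<in> B0 \<and> set p \<inter> insert (f 0) Y = {}" for Y p
  have ex: "\<exists>p. P Y p" if Y: "finite Y" for Y
  proof -
    have "\<exists>p. vpath p (with_proj D) \<and> hd p \<in> range f \<and> last p \<in> B0 \<and> set p \<inter> insert (f 0) Y = {}"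
    proof (rule ccontr)
      assume neg: "\<not> ?thesis"
      have "\<exists>U X. barrier U X \<and> range f \<subseteq> X \<and> range f - insert (f 0) Y \<subseteq> U"
      proof (rule separating_barrier)
        show "range f \<subseteq> pverts D" using f(2) by auto
        show "finite (insert (f 0) Y)" using Y by simp
        show "set p \<inter> insert (f 0) Y \<noteq> {}" if "vpath p (with_proj D)" "hd p \<in> range f" "last p \<in> B0" for p
          using neg that by blast
      qed
      then show False using nb by blast
    qed
    then obtain p where p: "vpath p (with_proj D)" "hd p \<in> range f" "last p \<in> B0" "set p \<inter> insert (f 0) Y = {}" by blast
    have "\<exists>x \<in> set p. x \<in> range f" using p(1,2) hd_in_set by (auto simp: vpath_iff)
    then obtain ys x zs where q: "p = ys @ x # zs" "x \<in> range f" "\<forall>z \<in> set zs. z \<notin> range f"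
      by (rule split_list_last_propE)
    have "vpath (x # zs) (with_proj D)" using vpath_append[of ys "x # zs"] p(1) q(1) by simp
    then have "P Y (x # zs)" using p q by (auto simp: P_def)
    then show ?thesis by blast
  qed
  have "finite (s p)" for p by (simp add: s_def)
  then obtain p :: "nat \<Rightarrow> 'v list" where "\<forall>n. P (\<Union>i<n. s (p i)) (p n)" using infinite_choice[of s P, OF _ ex] by auto
  then have p: "P (\<Union>i<n. s (p i)) (p n)" for n by (rule spec)
  have v: "vpath (p n) (with_proj D)" "hd (p n) \<in> range f" "set (tl (p n)) \<inter> range f = {}" "last (p n) \<in> B0"
    "f 0 \<notin> set (p n)" "p n \<noteq> []" "distinct (p n)" for n
    using p[of n] by (auto simp: P_def vpath_iff)
  have less: "set (p n) \<inter> s (p i) = {}" if "i < n" for i n using p[of n] that by (auto simp: P_def)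
  have dj: "set (p n) \<inter> set (p i) = {}" if "i \<noteq> n" for i n
    using less[of i n] less[of n i] that by (auto simp: neq_iff s_def)
  define j where "j n = idx (p n)" for n
  have fj: "f (j n) = hd (p n)" for n unfolding j_def idx_def by (rule f_inv_into_f[OF v(2)])
  have hin: "hd (p n) \<in> set (p n)" "last (p n) \<in> set (p n)" for n using v(6)[of n] by auto
  have j_mono: "j i < j n" if "i < n" for i n
  proof (rule ccontr)
    assume "\<not> ?thesis"
    then have "f (j n) \<in> s (p i)" by (auto simp: s_def j_def)
    then show False using less[OF that] fj[of n] hin(1)[of n] by auto
  qed
  have j0: "0 < j n" for n using fj[of n] hin(1)[of n] v(5)[of n] by (cases "j n") auto
  \<comment> \<open>Positions of the branch vertices on the ray: the start, then the roots of the
    teeth.\<close>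
  define g where "g k = (case k of 0 \<Rightarrow> 0 | Suc n \<Rightarrow> j n)" for k
  have g: "g 0 = 0" "g (Suc n) = j n" for n by (simp_all add: g_def)
  have g_step: "g n < g (Suc n)" for n using j0 j_mono by (cases n) (auto simp: g)
  have g_mono: "strict_mono g" using g_step by (simp add: strict_mono_Suc_iff)
  have g_less: "g a < g b \<longleftrightarrow> a < b" "g a \<le> g b \<longleftrightarrow> a \<le> b" "g a = g b \<longleftrightarrow> a = b" for a b
    using g_mono by (simp_all add: strict_mono_less strict_mono_less_eq strict_mono_eq)
  have lf: "last (p n) \<notin> range f" for n using v(4)[of n] f(2) by auto
  have ll: "last (p n) \<notin> set (p i)" if "i \<noteq> n" for i n using dj[OF that] hin(2)[of n] by auto
  \<comment> \<open>For \<open>k \<ge> 2\<close> the vertex \<open>CX k\<close> bears tooth number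
    \<open>k - 2\<close>, whose root has position \<open>g (k - 1) = j (k - 2)\<close>.\<close>
  define \<phi> where "\<phi> x = (case x of CX k \<Rightarrow> f (g (k - 1)) | CY k \<Rightarrow> last (p (k - 2)))" for x
  define \<pi> where "\<pi> e = (case fst e of CY k \<Rightarrow> [] | CX k \<Rightarrow>
      (case snd e of CX k' \<Rightarrow> map f [g (k - 1)..<Suc (g k)] | CY k' \<Rightarrow> p (k - 2)))" for e
  have \<phi>: "\<phi> (CX k) = f (g (k - 1))" "\<phi> (CY k) = last (p (k - 2))" for k by (simp_all add: \<phi>_def)
  have \<pi>: "\<pi> (CX k, CX k') = map f [g (k - 1)..<Suc (g k)]" "\<pi> (CX k, CY k') = p (k - 2)" for k k'
    by (simp_all add: \<pi>_def)
  have CO_arc: "(\<exists>k\<ge>1. e = (CX k, CX (k + 1))) \<or> (\<exists>k\<ge>2. e = (CX k, CY k))" if "e \<in> parcs CO" for e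
    using that by (auto simp: CO_def)
  have CO_vert: "(\<exists>k\<ge>1. x = CX k) \<or> (\<exists>k\<ge>2. x = CY k)" if "x \<in> pverts CO" for x
    using that by (auto simp: CO_def)
  have inner_spine: "inner_verts (map f [a..<Suc b]) = f ` {a<..<b}" if "a < b" for a b
  proof -
    have "[a..<Suc b] = a # [Suc a..<b] @ [b]" using that by (simp add: upt_conv_Cons)
    then have "inner_verts [a..<Suc b] = {a<..<b}" by (auto simp: inner_verts_def butlast_append)
    then show ?thesis by (simp only: inner_verts_map)
  qed
  have spine_inner: "inner_verts (\<pi> (CX k, CX k')) = f ` {g (k - 1)<..<g k}" if "k \<ge> 1" for k k'
    using inner_spine[of "g (k - 1)" "g k"] g_step[of "k - 1"] that by (simp add: \<pi>)
  have tooth_inner: "inner_verts (p n) \<inter> range f = {}" "inner_verts (p n) \<subseteq> set (p n)" "last (p n) \<notin> inner_verts (p n)" for n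
    using inner_verts_sub[of "p n"] v(3)[of n] inner_verts_distinct[OF v(7)[of n]] by (auto dest: list.set_sel(2)[OF v(6)])
  have "\<exists>D' B'. subdimaze D' B' D B0 \<and> subdivides_dimaze CO CO_exits (map_option \<phi>) (lift_paths \<phi> \<pi>) D' B'"
  proof (rule subdivided_dimaze_exists)
    show "inj_on \<phi> (pverts CO)"
    proof (rule inj_onI)
      fix x y assume xy: "x \<in> pverts CO" "y \<in> pverts CO" "\<phi> x = \<phi> y"
      have XY: "f (g (k - 1)) \<noteq> last (p (l - 2))" for k l using lf[of "l - 2"] by (metis rangeI)
      from CO_vert[OF xy(1)] CO_vert[OF xy(2)] show "x = y"
      proof (elim disjE exE conjE)
        fix k l assume kl: "1 \<le> k" "1 \<le> l" "x = CX k" "y = CX l"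
        then have "g (k - 1) = g (l - 1)" using xy(3) f(1) by (auto simp: \<phi> dest: injD)
        then show ?thesis using kl g_less(3) by auto
      next
        fix k l assume kl: "2 \<le> k" "2 \<le> l" "x = CY k" "y = CY l"
        then have "last (p (k - 2)) = last (p (l - 2))" using xy(3) by (simp add: \<phi>)
        then have "k - 2 = l - 2" using ll[of "l - 2" "k - 2"] hin(2)[of "l - 2"] by metis
        then show ?thesis using kl by auto
      next
        fix k l assume "x = CX k" "y = CY l"
        then show ?thesis using xy(3) XY[of k l] by (simp add: \<phi>)
      next
        fix k l assume "x = CY k" "y = CX l"
        then show ?thesis using xy(3) XY[of l k] by (simp add: \<phi>)
      qed
    qed
    have "\<phi> x \<in> pverts D" for x
      using f(2) v(4) exits(1) by (cases x) (auto simp: \<phi>)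
    then show "\<phi> ` pverts CO \<subseteq> pverts D" by auto
    show "CO_exits \<subseteq> pverts CO" by (auto simp: CO_exits_def CO_def)
    show "\<phi> ` CO_exits \<subseteq> B0" using v(4) by (auto simp: CO_exits_def \<phi>)
    show "u \<in> pverts CO \<and> v \<in> pverts CO" if "(u, v) \<in> parcs CO" for u v using that by (auto simp: CO_def)
    show "vpath (\<pi> (u, w)) (with_proj D) \<and> hd (\<pi> (u, w)) = \<phi> u \<and> last (\<pi> (u, w)) = \<phi> w \<and>
        inner_verts (\<pi> (u, w)) \<inter> \<phi> ` pverts CO = {}" if uw: "(u, w) \<in> parcs CO" for u w
      using CO_arc[OF uw]
    proof (elim disjE exE conjE)
      fix k :: nat assume k: "1 \<le> k" "(u, w) = (CX k, CX (k + 1))"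
      have lt: "g (k - 1) < g k" using g_step[of "k - 1"] k(1) by simp
      have "vpath (map f [g (k - 1)..<Suc (g k)]) (with_proj D)"
        unfolding vpath_iff
      proof (intro conjI)
        show "map f [g (k - 1)..<Suc (g k)] \<noteq> []" using lt by simp
        show "distinct (map f [g (k - 1)..<Suc (g k)])"
          unfolding distinct_map using inj_on_subset[OF f(1)] by auto
        show "set (map f [g (k - 1)..<Suc (g k)]) \<subseteq> pverts D" using f(2) by auto
        show "successively (\<lambda>u v. (u, v) \<in> parcs D) (map f [g (k - 1)..<Suc (g k)])"
          unfolding successively_conv_nth using f(3) by (auto simp del: upt_Suc)
      qed
      moreover have "hd (map f [g (k - 1)..<Suc (g k)]) = f (g (k - 1))"
        using lt by (simp add: upt_conv_Cons del: upt_Suc)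
      moreover have "last (map f [g (k - 1)..<Suc (g k)]) = f (g k)" using lt by simp
      moreover have sep: "\<phi> x \<notin> f ` {g (k - 1)<..<g k}" if "x \<in> pverts CO" for x
        using CO_vert[OF that]
      proof (elim disjE exE conjE)
        fix l :: nat assume l: "1 \<le> l" "x = CX l"
        show ?thesis
        proof
          assume "\<phi> x \<in> f ` {g (k - 1)<..<g k}"
          then obtain i where "g (k - 1) < i" "i < g k" "f (g (l - 1)) = f i" by (auto simp: l \<phi>)
          then have "g (k - 1) < g (l - 1)" "g (l - 1) < g k" using f(1) by (auto dest: injD)
          then show False unfolding g_less using l k by simp
        qed
      next
        fix l :: nat assume "x = CY l"
        then show ?thesis using lf[of "l - 2"] by (auto simp: \<phi>)
      qed
      moreover have "inner_verts (\<pi> (CX k, CX (k + 1))) \<inter> \<phi> ` pverts CO = {}"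
        unfolding spine_inner[OF k(1)]
      proof (rule equals0I)
        fix y assume y: "y \<in> f ` {g (k - 1)<..<g k} \<inter> \<phi> ` pverts CO"
        then obtain x where "x \<in> pverts CO" "y = \<phi> x" by blast
        then show False using sep[of x] y by simp
      qed
      ultimately show ?thesis using k(2) by (simp add: \<pi> \<phi> del: upt_Suc)
    next
      fix k :: nat assume k: "2 \<le> k" "(u, w) = (CX k, CY k)"
      have "k - 1 = Suc (k - 2)" using k(1) by simp
      then have "f (g (k - 1)) = hd (p (k - 2))" using fj g(2) by simp
      moreover have "\<phi> x \<notin> inner_verts (p (k - 2))" for x
      proof (cases x)
        case (CX l)
        then show ?thesis using tooth_inner(1)[of "k - 2"] by (auto simp: \<phi>)
      next
        case (CY l)
        then show ?thesis using tooth_inner(2,3)[of "k - 2"] ll[of "k - 2" "l - 2"] by (cases "l - 2 = k - 2") (auto simp: \<phi>)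
      qed
      ultimately show ?thesis using k v(1)[of "k - 2"] by (auto simp: \<pi> \<phi>)
    qed
    have spine_tooth: "f ` {a<..<b} \<inter> inner_verts (p n) = {}" for a b n using tooth_inner(1)[of n] by auto
    show "inner_verts (\<pi> e) \<inter> inner_verts (\<pi> h) = {}"
      if eh: "e \<in> parcs CO" "h \<in> parcs CO" "e \<noteq> h" for e h
      using CO_arc[OF eh(1)] CO_arc[OF eh(2)]
    proof (elim disjE exE conjE)
      fix k l :: nat assume kl: "1 \<le> k" "1 \<le> l" "e = (CX k, CX (k + 1))" "h = (CX l, CX (l + 1))"
      then have "k \<noteq> l" using eh(3) by auto
      then have "g k \<le> g (l - 1) \<or> g l \<le> g (k - 1)" unfolding g_less using kl by auto
      then have "{g (k - 1)<..<g k} \<inter> {g (l - 1)<..<g l} = {}" by auto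
      then show ?thesis
        unfolding kl(3,4) spine_inner[OF kl(1)] spine_inner[OF kl(2)] using f(1) by (metis image_Int image_empty)
    next
      fix k l :: nat assume kl: "1 \<le> k" "2 \<le> l" "e = (CX k, CX (k + 1))" "h = (CX l, CY l)"
      show ?thesis unfolding kl(3,4) spine_inner[OF kl(1)] \<pi>(2) by (rule spine_tooth)
    next
      fix k l :: nat assume kl: "2 \<le> k" "1 \<le> l" "e = (CX k, CY k)" "h = (CX l, CX (l + 1))"
      show ?thesis unfolding kl(3,4) spine_inner[OF kl(2)] \<pi>(2) using spine_tooth by (simp add: Int_commute)
    next
      fix k l :: nat assume kl: "2 \<le> k" "2 \<le> l" "e = (CX k, CY k)" "h = (CX l, CY l)"
      then have "l - 2 \<noteq> k - 2" using eh(3) by auto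
      from dj[OF this] show ?thesis
        unfolding kl(3,4) \<pi>(2) using tooth_inner(2)[of "k - 2"] tooth_inner(2)[of "l - 2"] by auto
    qed
  qed
  then obtain D' B' where D': "subdimaze D' B' D B0" "subdivides_dimaze CO CO_exits (map_option \<phi>) (lift_paths \<phi> \<pi>) D' B'"
    by blast
  \<comment> \<open>The positions \<open>g\<close> are unbounded, so the segments between them
    exhaust the ray and the spine is all of \<open>range f\<close>.\<close>
  have cover: "\<exists>k. g k \<le> i \<and> i < g (Suc k)" for i
  proof -
    have "i < g (Suc i)" using strict_mono_imp_increasing[OF g_mono, of "Suc i"] by simp
    then have "\<exists>k. i < g (Suc k)" by blast
    then have k: "i < g (Suc (LEAST k. i < g (Suc k)))" by (rule LeastI_ex)
    show ?thesis
    proof (cases "LEAST k. i < g (Suc k)")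
      case 0
      then show ?thesis using k g(1) by (intro exI[of _ 0]) auto
    next
      case (Suc l)
      then have "\<not> i < g (Suc l)" using not_less_Least[of l "\<lambda>k. i < g (Suc k)"] by simp
      then show ?thesis using k Suc by (intro exI[of _ "Suc l"]) auto
    qed
  qed
  have "range f = {w. \<exists>i\<ge>1. Some w \<in> set (lift_paths \<phi> \<pi> (Some (CX i), Some (CX (i + 1))))}"
  proof
    show "range f \<subseteq> {w. \<exists>i\<ge>1. Some w \<in> set (lift_paths \<phi> \<pi> (Some (CX i), Some (CX (i + 1))))}"
    proof
      fix y assume "y \<in> range f"
      then obtain i where i: "y = f i" by auto
      obtain k where "g k \<le> i" "i < g (Suc k)" using cover by blast
      then have "i \<in> set [g (Suc k - 1)..<Suc (g (Suc k))]" by (simp del: upt_Suc)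
      then have "Some y \<in> set (lift_paths \<phi> \<pi> (Some (CX (Suc k)), Some (CX (Suc k + 1))))"
        by (simp only: lift_paths_simps \<pi> i set_map) blast
      then show "y \<in> {w. \<exists>i\<ge>1. Some w \<in> set (lift_paths \<phi> \<pi> (Some (CX i), Some (CX (i + 1))))}"
        by (intro CollectI exI[of _ "Suc k"]) simp
    qed
    show "{w. \<exists>i\<ge>1. Some w \<in> set (lift_paths \<phi> \<pi> (Some (CX i), Some (CX (i + 1))))} \<subseteq> range f"
      by (auto simp: \<pi>)
  qed
  moreover have "map_option \<phi> (Some (CX 1)) = Some (f 0)" by (simp add: \<phi> g)
  ultimately show ?thesis unfolding outgoing_comb_spine_def using D' by blast
qed

text \<open>A finite orbit ends outside \<open>barred\<close>, that is, at an exit or at a fan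
  centre. An infinite one is the spine of a comb because no barrier contains it.\<close>

theorem ind_topologically_linkable:
  assumes I: "ind I"
  shows "topologically_linkable D B0 I"
proof -
  obtain A where A: "maxind A" "I \<subseteq> A" using maxind_extension[OF I] .
  let ?m = "shift A"
  have inj: "inj_on ?m barred" and im: "?m ` barred = pverts D - A" using shift_bij[OF A(1)] by (auto simp: bij_betw_def)
  have AV: "A \<subseteq> pverts D" using A(1) indD(1) by (simp add: maxind_def)
  have "\<exists>S. topological_path D B0 a S \<and> S \<subseteq> orbit ?m barred a" if a: "a \<in> A" for a
  proof -
    have a': "a \<notin> ?m ` barred" using im a by auto
    show ?thesis
    proof (cases rule: orbit_cases[OF inj a'])
      case (1 f)
      have fW: "f i \<in> pverts D - B0" for i using 1(3) barred_sub by auto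
      have arc: "(f i, f (Suc i)) \<in> parcs D" for i
      proof -
        have "f (Suc i) \<in> dnb D (f i)" using shift_nb[OF A(1) 1(3)] 1(4) by simp
        moreover have "f (Suc i) \<noteq> f i" using injD[OF 1(1), of "Suc i" i] by auto
        ultimately show ?thesis by (simp add: dnb_def)
      qed
      \<comment> \<open>Only finitely many vertices of the ray could lie in the boundary
        \<open>X - U\<close>, so a tail would be a ray inside \<open>U\<close>.\<close>
      have nb: "\<not> range f \<subseteq> X" if b: "barrier U X" for U X
      proof
        assume sub: "range f \<subseteq> X"
        have "finite (f -` (X - U))" by (rule finite_vimageI[OF barrierD(5)[OF b] 1(1)])
        then obtain l where l: "\<forall>i \<in> f -` (X - U). i < l" unfolding finite_nat_set_iff_bounded by blast
        have "f (i + l) \<in> U" for i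
        proof (rule ccontr)
          assume "f (i + l) \<notin> U"
          then have "i + l \<in> f -` (X - U)" using sub by auto
          then show False using l by auto
        qed
        then have "range (\<lambda>i. f (i + l)) \<subseteq> U" by auto
        moreover have "inj (\<lambda>i. f (i + l))"
          by (rule injI) (use injD[OF 1(1)] in \<open>metis add_right_cancel\<close>)
        moreover have "\<forall>i. f (Suc i + l) = ?m (f (i + l))" using 1(4) by simp
        ultimately have "\<exists>h :: nat \<Rightarrow> 'v. inj h \<and> range h \<subseteq> U \<and> (\<forall>i. h (Suc i) = ?m (h i))"
          by (intro exI[of _ "\<lambda>i. f (i + l)"] conjI)
        then show False using no_ray_barrier[OF A(1) b] unfolding no_ray_def by contradiction
      qed
      have "outgoing_comb_spine D B0 (f 0) (range f)" by (rule outgoing_comb_exists[OF 1(1) fW arc nb])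
      then have "topological_path D B0 a (range f)" using 1(2) by (simp add: topological_path_def)
      then show ?thesis using 1(5) by (intro exI[of _ "range f"] conjI)
    next
      case (2 p)
      have "hd p \<in> pverts D" using 2(3) a AV by auto
      then have v: "vpath p (with_proj D)" by (rule vpath_shift[OF 2(1,2) _ 2(5) shift_nb[OF A(1)]])
      then have "last p \<in> pverts D" using last_in_set[OF 2(1)] by (auto simp: vpath_iff)
      then have "linking_fan_centre D B0 (last p) \<or> last p \<in> B0" using linking_fan_exists[of "last p"] 2(4) by auto
      then have "topological_path D B0 a (set p)" using v 2(3) unfolding topological_path_def by blast
      then show ?thesis using 2(6) by (intro exI[of _ "set p"] conjI)
    qed
  qed
  then obtain P where P: "\<And>a. a \<in> A \<Longrightarrow> topological_path D B0 a (P a) \<and> P a \<subseteq> orbit ?m barred a" by metis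
  have "disjoint_family_on P I"
    unfolding disjoint_family_on_def
  proof (intro ballI impI, rule ccontr)
    fix a b assume ab: "a \<in> I" "b \<in> I" "a \<noteq> b" "P a \<inter> P b \<noteq> {}"
    then have aA: "a \<in> A" "b \<in> A" using A(2) by auto
    obtain x where "x \<in> P a" "x \<in> P b" using ab(4) by auto
    then have "x \<in> orbit ?m barred a" "x \<in> orbit ?m barred b" using P[OF aA(1)] P[OF aA(2)] by auto
    moreover have "a \<notin> ?m ` barred" "b \<notin> ?m ` barred" using im aA by auto
    ultimately have "a = b" by (rule orbit_disjoint[OF inj, rotated 2])
    then show False using ab(3) by contradiction
  qed
  moreover have "\<forall>x \<in> I. topological_path D B0 x (P x)" using P A(2) by auto
  moreover have "I \<subseteq> pverts D" using A(2) AV by auto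
  ultimately show ?thesis unfolding topologically_linkable_def by blast
qed

lemma linkable_topologically_linkable:
  assumes "linkable D B0 A"
  shows "topologically_linkable D B0 A"
proof -
  obtain Q where Q: "linkage D B0 Q" "hd ` Q = A" using assms unfolding linkable_def by blast
  have "\<forall>a \<in> A. \<exists>p. p \<in> Q \<and> hd p = a" using Q(2) by blast
  then obtain p where "\<forall>a \<in> A. p a \<in> Q \<and> hd (p a) = a" by (rule bchoice[THEN exE])
  then have p: "p a \<in> Q \<and> hd (p a) = a" if "a \<in> A" for a using that by (rule bspec)
  have v: "vpath (p a) (with_proj D)" "last (p a) \<in> B0" if "a \<in> A" for a
    using Q(1) p[OF that] unfolding linkage_def by simp_all
  have "topological_path D B0 a (set (p a))" if "a \<in> A" for a
    unfolding topological_path_def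
    by (intro disjI2 exI[of _ "p a"]) (use v[OF that] p[OF that] in simp)
  moreover have "disjoint_family_on (\<lambda>a. set (p a)) A"
    unfolding disjoint_family_on_def
  proof (intro ballI impI)
    fix a b assume ab: "a \<in> A" "b \<in> A" "a \<noteq> b"
    have "hd (p a) \<noteq> hd (p b)" using p[OF ab(1)] p[OF ab(2)] ab(3) by simp
    then have "p a \<noteq> p b" by auto
    moreover have "p a \<in> Q" "p b \<in> Q" using p[OF ab(1)] p[OF ab(2)] by simp_all
    ultimately show "set (p a) \<inter> set (p b) = {}" using Q(1) unfolding linkage_def by simp
  qed
  moreover have "A \<subseteq> pverts D"
  proof
    fix a assume a: "a \<in> A"
    have "hd (p a) \<in> set (p a)" "set (p a) \<subseteq> pverts D" using v(1)[OF a] by (simp_all add: vpath_iff)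
    then show "a \<in> pverts D" using p[OF a] by auto
  qed
  ultimately show ?thesis
    unfolding topologically_linkable_def by (intro conjI exI[of _ "\<lambda>a. set (p a)"]) simp_all
qed

lemma topologically_linkable_iff: "topologically_linkable D B0 A \<longleftrightarrow> ind A"
  by (rule iffI) (rule topologically_linkable_ind ind_topologically_linkable; assumption)+

lemma M_TL_eq: "M_TL D B0 = (pverts D, {A. ind A})"
  by (simp add: M_TL_def topologically_linkable_iff)

lemma linkable_ind: "linkable D B0 A \<Longrightarrow> ind A"
  by (rule topologically_linkable_ind, rule linkable_topologically_linkable)

lemma M_L_eq_if_closed:
  assumes "\<And>x. x \<in> pverts D \<Longrightarrow> \<exists>X. x \<in> X \<and> barrier (X \<inter> (pverts D - B0)) X"
  shows "M_L D B0 = (pverts D, {A. ind A})"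
proof -
  have "linkable D B0 A \<longleftrightarrow> ind A" for A
    using ind_linkable_if_closed[OF assms, of A] linkable_ind by metis
  then show ?thesis by (simp add: M_L_def)
qed

end

section \<open>Closure under minors\<close>

text \<open>Since \<open>u\<close> belongs to \<open>N u\<close>, the condition
  \<open>u \<noteq> v\<close> is what prevents loops. Arcs start in \<open>W\<close> only, which
  makes the other vertices sinks. The injection \<open>g\<close> changes the vertex type.\<close>

definition copy_dimaze ::
  "('v \<Rightarrow> 'w) \<Rightarrow> 'v set \<Rightarrow> 'v set \<Rightarrow> ('v \<Rightarrow> 'v set) \<Rightarrow> 'w pair_pre_digraph" where
  "copy_dimaze g V W N =
     \<lparr> pverts = g ` V, parcs = {(g u, g v) | u v. u \<in> W \<and> v \<in> N u \<and> u \<noteq> v} \<rparr>"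

context nbhd_system
begin

context
  fixes g :: "'v \<Rightarrow> 'w"
  assumes g: "inj g"
begin

lemma copy_dimaze: "dimaze (copy_dimaze g V W N) (g ` (V - W))"
  unfolding dimaze_def
proof (intro conjI ballI allI)
  have sub: "u \<in> V" "v \<in> V" if "u \<in> W" "v \<in> N u" for u v using that W_sub N_sub by auto
  show "pair_loopfree_digraph (copy_dimaze g V W N)"
    by unfold_locales (use sub injD[OF g] in \<open>auto simp: copy_dimaze_def\<close>)
  show "g ` (V - W) \<subseteq> pverts (copy_dimaze g V W N)" by (auto simp: copy_dimaze_def)
  show "(b, v) \<notin> parcs (copy_dimaze g V W N)" if "b \<in> g ` (V - W)" for b v
    using that injD[OF g] by (auto simp: copy_dimaze_def)
qed

interpretation E: dimaze_system "copy_dimaze g V W N" "g ` (V - W)"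
  by unfold_locales (rule copy_dimaze)

lemma copy_verts: "pverts (copy_dimaze g V W N) = g ` V"
  by (simp add: copy_dimaze_def)

lemma copy_nonexits: "g ` V - g ` (V - W) = g ` W"
proof -
  have "g ` V - g ` (V - W) = g ` (V - (V - W))" by (rule image_set_diff[OF g, symmetric])
  moreover have "V - (V - W) = W" using W_sub by auto
  ultimately show ?thesis by simp
qed

lemma copy_dnb: "u \<in> W \<Longrightarrow> dnb (copy_dimaze g V W N) (g u) = g ` N u"
  using N_self[of u] injD[OF g] by (auto simp: dnb_def copy_dimaze_def)

lemma copy_barrier: "E.barrier (g ` U) (g ` X) \<longleftrightarrow> barrier U X"
proof -
  have "g ` X - g ` U = g ` (X - U)" by (rule image_set_diff[OF g, symmetric])
  then have fin: "finite (g ` X - g ` U) \<longleftrightarrow> finite (X - U)"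
    using finite_image_iff[OF inj_on_subset[OF g subset_UNIV]] by simp
  have "(\<forall>u \<in> g ` U. dnb (copy_dimaze g V W N) u \<subseteq> g ` X) \<longleftrightarrow> (\<forall>u \<in> U. N u \<subseteq> X)" if "U \<subseteq> W"
  proof -
    have "dnb (copy_dimaze g V W N) (g u) \<subseteq> g ` X \<longleftrightarrow> N u \<subseteq> X" if u: "u \<in> U" for u
    proof -
      have "u \<in> W" using u \<open>U \<subseteq> W\<close> by auto
      then show ?thesis by (simp only: copy_dnb inj_image_subset_iff[OF g])
    qed
    then show ?thesis by simp
  qed
  then show ?thesis
    unfolding E.barrier_def barrier_def
    unfolding copy_verts copy_nonexits fin inj_image_subset_iff[OF g] by (cases "U \<subseteq> W") simp_all
qed

lemma copy_ind:
  assumes J: "J \<subseteq> V"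
  shows "E.ind (g ` J) \<longleftrightarrow> ind J"
proof -
  have d: "g ` X - g ` U = g ` (X - U)" "g ` J \<inter> g ` X = g ` (J \<inter> X)" for U X
    using image_set_diff[OF g] image_Int[OF g] by auto
  have c: "card (g ` Y) = card Y" "finite (g ` Y) \<longleftrightarrow> finite Y" for Y
    using card_image[of g Y] finite_image_iff[of g Y] inj_on_subset[OF g] by auto
  have eq: "finite (g ` J \<inter> g ` X) \<and> card (g ` J \<inter> g ` X) \<le> card (g ` X - g ` U) \<longleftrightarrow>
      finite (J \<inter> X) \<and> card (J \<inter> X) \<le> card (X - U)" for U X
    unfolding d c by (rule refl)
  show ?thesis
  proof
    assume i: "E.ind (g ` J)"
    show "ind J"
      unfolding ind_def
    proof (intro conjI allI impI)
      fix U X assume "barrier U X"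
      then have b: "E.barrier (g ` U) (g ` X)" by (simp add: copy_barrier)
      have "finite (J \<inter> X) \<and> card (J \<inter> X) \<le> card (X - U)"
        using E.indD(2)[OF i b] E.indD(3)[OF i b] eq[of X U] by blast
      then show "finite (J \<inter> X)" "card (J \<inter> X) \<le> card (X - U)" by auto
    qed (rule J)
  next
    assume i: "ind J"
    show "E.ind (g ` J)"
      unfolding E.ind_def
    proof (intro conjI allI impI)
      show "g ` J \<subseteq> pverts (copy_dimaze g V W N)" using J by (auto simp: copy_verts)
      fix U' X' assume b: "E.barrier U' X'"
      have "X' \<subseteq> g ` V" "U' \<subseteq> g ` V" using E.barrierD(1,2)[OF b] by (auto simp: copy_verts)
      then obtain U X where UX: "U' = g ` U" "X' = g ` X" by (meson subset_imageE)
      then have "barrier U X" using b copy_barrier by simp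
      then have "finite (g ` J \<inter> g ` X) \<and> card (g ` J \<inter> g ` X) \<le> card (g ` X - g ` U)"
        unfolding eq using indD[OF i] by simp
      then show "finite (g ` J \<inter> X')" "card (g ` J \<inter> X') \<le> card (X' - U')" unfolding UX by auto
    qed
  qed
qed

lemma copy_M_L:
  assumes cl: "\<And>x. x \<in> V \<Longrightarrow> \<exists>X. x \<in> X \<and> barrier (X \<inter> W) X"
  shows "M_L (copy_dimaze g V W N) (g ` (V - W)) = (g ` V, {A. E.ind A})"
proof -
  have "\<exists>X. y \<in> X \<and> E.barrier (X \<inter> (pverts (copy_dimaze g V W N) - g ` (V - W))) X"
    if y: "y \<in> pverts (copy_dimaze g V W N)" for y
  proof -
    obtain x where x: "x \<in> V" "y = g x" using y by (auto simp: copy_verts)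
    obtain X where X: "x \<in> X" "barrier (X \<inter> W) X" using cl[OF x(1)] by blast
    have eq: "g ` X \<inter> (pverts (copy_dimaze g V W N) - g ` (V - W)) = g ` (X \<inter> W)"
      unfolding copy_verts copy_nonexits by (rule image_Int[OF g, symmetric])
    have "E.barrier (g ` X \<inter> (pverts (copy_dimaze g V W N) - g ` (V - W))) (g ` X)"
      unfolding eq copy_barrier by (rule X(2))
    then show ?thesis using X(1) x(2) by (intro exI[of _ "g ` X"]) simp
  qed
  from E.M_L_eq_if_closed[OF this] show ?thesis by (simp only: copy_verts)
qed

end

end

section \<open>Presentations of matroids by independence in a dimaze\<close>

lemma finitary_exchange_pullback:
  assumes S: "finitary_exchange S" and h: "inj_on h E" "h ` E \<subseteq> ground S"
  shows "finitary_exchange (E, {J. J \<subseteq> E \<and> h ` J \<in> indep S})"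
  unfolding finitary_exchange_def finitary_def fst_conv snd_conv mem_Collect_eq
proof (intro conjI ballI allI impI)
  show "{J. J \<subseteq> E \<and> h ` J \<in> indep S} \<subseteq> Pow E" by auto
  show "h ` {} \<in> indep S" using finitary_exchangeD(2)[OF S] by simp
  fix I assume "I \<in> {J. J \<subseteq> E \<and> h ` J \<in> indep S}"
  then have I: "I \<subseteq> E" "h ` I \<in> indep S" by simp_all
  show "J \<subseteq> E" if "J \<subseteq> I" for J using that I(1) by (rule subset_trans)
  show "h ` J \<in> indep S" if "J \<subseteq> I" for J using finitary_exchangeD(3)[OF S I(2) image_mono[OF that]] .
  fix J assume "J \<in> {J. J \<subseteq> E \<and> h ` J \<in> indep S}"
  then have J: "J \<subseteq> E" "h ` J \<in> indep S" by simp_all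
  assume f: "finite I \<and> finite J \<and> card J < card I"
  have "card (h ` I) = card I" "card (h ` J) = card J"
    using card_image[OF inj_on_subset[OF h(1) I(1)]] card_image[OF inj_on_subset[OF h(1) J(1)]] by simp_all
  then have "\<exists>y \<in> h ` I - h ` J. insert y (h ` J) \<in> indep S"
    using finitary_exchangeD(4)[OF S I(2) J(2)] f by simp
  then obtain x where x: "x \<in> I" "h x \<notin> h ` J" "insert (h x) (h ` J) \<in> indep S" by blast
  then have "x \<in> I - J" by auto
  then show "\<exists>x\<in>I - J. insert x J \<subseteq> E \<and> h ` insert x J \<in> indep S"
    by (rule bexI[rotated]) (use x I J in auto)
next
  fix A assume A: "A \<subseteq> E" "\<forall>F\<subseteq>A. finite F \<longrightarrow> F \<subseteq> E \<and> h ` F \<in> indep S"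
  show "h ` A \<in> indep S"
  proof (rule finitary_exchangeD(5)[OF S])
    show "h ` A \<subseteq> ground S" using image_mono[OF A(1), of h] h(2) by (rule subset_trans)
    fix G assume "G \<subseteq> h ` A" "finite G"
    then obtain F where "F \<subseteq> A" "finite F" "G = h ` F" by (meson finite_subset_image)
    then show "G \<in> indep S" using A(2) by simp
  qed
  show "A \<subseteq> E" by (rule A(1))
qed simp

lemma isomorphic_indep:
  assumes M: "indep M \<subseteq> Pow (ground M)" and f: "bij_betw f (ground M) (ground N)" "indep N = (`) f ` indep M"
    and J: "J \<subseteq> ground M"
  shows "J \<in> indep M \<longleftrightarrow> f ` J \<in> indep N"
proof
  assume "f ` J \<in> indep N"
  then obtain J' where J': "J' \<in> indep M" "f ` J = f ` J'" unfolding f(2) by blast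
  have "J' \<subseteq> ground M" using J'(1) M by auto
  then have "J = J'" using J'(2) J f(1) inj_on_image_eq_iff[of f "ground M" J J'] by (simp add: bij_betw_def)
  then show "J \<in> indep M" using J'(1) by simp
qed (simp add: f(2))

definition dimaze_ind :: "'v pair_pre_digraph \<Rightarrow> 'v set \<Rightarrow> 'v set \<Rightarrow> bool" where
  "dimaze_ind D B0 = nbhd_system.ind (pverts D) (pverts D - B0) (dnb D)"

text \<open>Common normal form of finitary gammoids and topological gammoids: both restrict the same
  kind of finitary matroid, so one argument about minors covers them.\<close>

definition presented :: "'a set_system \<Rightarrow> ('a \<Rightarrow> 'v) \<Rightarrow> 'v pair_pre_digraph \<Rightarrow> 'v set \<Rightarrow> bool" where
  "presented M h D B0 \<longleftrightarrow> dimaze D B0 \<and> inj_on h (ground M) \<and> h ` ground M \<subseteq> pverts D \<and>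
     indep M = {J. J \<subseteq> ground M \<and> dimaze_ind D B0 (h ` J)}"

lemma presented_finitary_exchange:
  assumes "presented M h D B0"
  shows "finitary_exchange M"
proof -
  interpret dimaze_system D B0 using assms by (simp add: dimaze_system_def presented_def)
  have "finitary_exchange (ground M, {J. J \<subseteq> ground M \<and> h ` J \<in> indep (pverts D, {A. ind A})})"
    by (rule finitary_exchange_pullback[OF finitary_exchange_ind]) (use assms in \<open>auto simp: presented_def\<close>)
  moreover have "M = (ground M, {J. J \<subseteq> ground M \<and> h ` J \<in> indep (pverts D, {A. ind A})})"
    by (rule prod_eqI) (use assms in \<open>auto simp: presented_def dimaze_ind_def\<close>)
  ultimately show ?thesis by simp
qed

text \<open>The dimaze is reversed and renamed by \<open>g\<close>. By \<open>closed_barrier\<close>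
  the linkable sets of the result are its independent sets, so it witnesses both kinds of
  gammoid.\<close>

lemma presented_minor:
  assumes M: "presented M h D B0" and N: "minor_of N M" and g: "inj (g :: 'v \<Rightarrow> 'w)"
  shows "\<exists>(D' :: 'w pair_pre_digraph) B'.
    presented N (g \<circ> h) D' B' \<and> M_L D' B' = (pverts D', {A. dimaze_ind D' B' A})"
proof -
  have D: "dimaze D B0" and h: "inj_on h (ground M)" "h ` ground M \<subseteq> pverts D"
    and Mi: "indep M = {J. J \<subseteq> ground M \<and> dimaze_ind D B0 (h ` J)}" using M by (simp_all add: presented_def)
  interpret D: dimaze_system D B0 by (simp add: dimaze_system_def D)
  obtain I where I: "I \<in> indep M" "ground N \<subseteq> ground M - I"
    and Ni: "\<And>J. J \<in> indep N \<longleftrightarrow> J \<subseteq> ground N \<and> I \<union> J \<in> indep M"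
    using indep_minor[OF presented_finitary_exchange[OF M] N] by metis
  have IM: "I \<subseteq> ground M" "D.ind (h ` I)" using I(1) by (simp_all add: Mi dimaze_ind_def)
  obtain A where A: "D.maxind A" "h ` I \<subseteq> A" using D.maxind_extension[OF IM(2)] .
  interpret K: contraction "pverts D" "pverts D - B0" "dnb D" A "h ` I"
    by unfold_locales (use A in auto)
  let ?V = "pverts D - h ` I" and ?W = "pverts D - A"
  define D' where "D' = copy_dimaze g ?V ?W K.N'"
  define B' where "B' = g ` (?V - ?W)"
  have ind': "dimaze_ind D' B' (g ` J) \<longleftrightarrow> K.C.ind J" if "J \<subseteq> ?V" for J
    using K.C.copy_ind[OF g that] by (simp only: dimaze_ind_def D'_def B'_def)
  have hN: "h ` J \<subseteq> ?V" if "J \<subseteq> ground N" for J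
  proof -
    have "h x \<notin> h ` I" if "x \<in> J" for x
      using inj_on_image_mem_iff[OF h(1), of x I] that \<open>J \<subseteq> ground N\<close> I(2) IM(1) by auto
    moreover have "h ` J \<subseteq> pverts D" using that I(2) h(2) by auto
    ultimately show ?thesis by auto
  qed
  have "presented N (g \<circ> h) D' B'"
    unfolding presented_def
  proof (intro conjI)
    show "dimaze D' B'" unfolding D'_def B'_def by (rule K.C.copy_dimaze[OF g])
    have "inj_on h (ground N)" by (rule inj_on_subset[OF h(1)]) (use I(2) in auto)
    then show "inj_on (g \<circ> h) (ground N)" by (rule comp_inj_on) (rule inj_on_subset[OF g subset_UNIV])
    show "(g \<circ> h) ` ground N \<subseteq> pverts D'" using hN[of "ground N"] by (auto simp: D'_def copy_dimaze_def)
    have "J \<in> indep N \<longleftrightarrow> J \<subseteq> ground N \<and> dimaze_ind D' B' ((g \<circ> h) ` J)" for J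
    proof (cases "J \<subseteq> ground N")
      case True
      have "I \<union> J \<subseteq> ground M" using True I(2) IM(1) by auto
      then have "J \<in> indep N \<longleftrightarrow> D.ind (h ` I \<union> h ` J)" using True by (simp add: Ni Mi image_Un dimaze_ind_def)
      also have "\<dots> \<longleftrightarrow> K.C.ind (h ` J)" using K.ind_contraction[OF hN[OF True]] by simp
      also have "\<dots> \<longleftrightarrow> dimaze_ind D' B' (g ` h ` J)" using ind'[OF hN[OF True]] by simp
      finally show ?thesis using True by (simp add: image_comp)
    qed (simp add: Ni)
    then show "indep N = {J. J \<subseteq> ground N \<and> dimaze_ind D' B' ((g \<circ> h) ` J)}" by blast
  qed
  moreover have "M_L D' B' = (pverts D', {A. dimaze_ind D' B' A})"
  proof -
    have "pverts D' = g ` ?V" by (simp add: D'_def copy_dimaze_def)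
    moreover have "M_L D' B' = (g ` ?V, {A. dimaze_ind D' B' A})"
      unfolding dimaze_ind_def D'_def B'_def by (rule K.C.copy_M_L[OF g K.closed_barrier])
    ultimately show ?thesis by simp
  qed
  ultimately show ?thesis by blast
qed

lemma presented_gammoid:
  fixes D :: "'v pair_pre_digraph"
  assumes M: "presented M h D B0" and linkable: "M_L D B0 = (pverts D, {A. dimaze_ind D B0 A})"
  shows "finitary_gammoid TYPE('v) M" "topological_gammoid TYPE('v) M"
proof -
  have D: "dimaze D B0" and h: "inj_on h (ground M)" "h ` ground M \<subseteq> pverts D"
    and Mi: "indep M = {J. J \<subseteq> ground M \<and> dimaze_ind D B0 (h ` J)}" using M by (simp_all add: presented_def)
  interpret D: dimaze_system D B0 by (simp add: dimaze_system_def D)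
  define S where "S = (pverts D, {A. dimaze_ind D B0 A})"
  have mS: "matroid S"
    using finitary_exchange_matroid[OF D.finitary_exchange_ind] by (simp add: S_def dimaze_ind_def)
  note fM = presented_finitary_exchange[OF M]
  have mM: "matroid M" by (rule finitary_exchange_matroid[OF fM])
  have "finitary M" using fM by (simp add: finitary_exchange_def)
  have iso: "isomorphic M (restrict_to S (h ` ground M))"
    unfolding isomorphic_def
  proof (intro exI[of _ h] conjI)
    show "bij_betw h (ground M) (ground (restrict_to S (h ` ground M)))"
      using h(1) by (simp add: restrict_to_def bij_betw_def)
    show "indep (restrict_to S (h ` ground M)) = (`) h ` indep M"
    proof
      show "indep (restrict_to S (h ` ground M)) \<subseteq> (`) h ` indep M"
      proof
        fix Y assume Y: "Y \<in> indep (restrict_to S (h ` ground M))"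
        then have "Y \<subseteq> h ` ground M" by (simp add: restrict_to_def)
        then obtain J where J: "J \<subseteq> ground M" "Y = h ` J" by (meson subset_imageE)
        then have "J \<in> indep M" using Y by (simp add: Mi restrict_to_def S_def)
        then show "Y \<in> (`) h ` indep M" using J(2) by blast
      qed
      show "(`) h ` indep M \<subseteq> indep (restrict_to S (h ` ground M))" by (auto simp: Mi restrict_to_def S_def)
    qed
  qed
  have "isomorphic S (M_L D B0)"
    unfolding linkable S_def isomorphic_def by (intro exI[of _ id]) simp
  then have "strict_gammoid TYPE('v) S" unfolding strict_gammoid_def using mS D by blast
  moreover have sub: "h ` ground M \<subseteq> ground S" using h(2) by (simp add: S_def)
  ultimately show "finitary_gammoid TYPE('v) M"
    unfolding finitary_gammoid_def gammoid_def using mM iso \<open>finitary M\<close> by blast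
  have "S = M_TL D B0" by (simp add: S_def D.M_TL_eq dimaze_ind_def)
  then have "strict_topological_gammoid S" unfolding strict_topological_gammoid_def using mS D by blast
  then show "topological_gammoid TYPE('v) M"
    unfolding topological_gammoid_def using mM iso sub by blast
qed

text \<open>Linkable sets are independent. The converse holds for finite sets by Menger's theorem
  and passes to all sets because \<open>M\<close> is finitary.\<close>

lemma finitary_gammoid_presented:
  assumes "finitary_gammoid TYPE('v) M"
  obtains h and D :: "'v pair_pre_digraph" and B0 where "presented M h D B0"
proof -
  have fM: "finitary M" and gM: "gammoid TYPE('v) M" using assms by (simp_all add: finitary_gammoid_def)
  obtain S :: "'v set_system" and X where mM: "matroid M" and S: "strict_gammoid TYPE('v) S" "X \<subseteq> ground S"
    and iso: "isomorphic M (restrict_to S X)" using gM unfolding gammoid_def by blast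
  obtain D :: "'v pair_pre_digraph" and B0 where mS: "matroid S" and D: "dimaze D B0" and iso': "isomorphic S (M_L D B0)"
    using S(1) unfolding strict_gammoid_def by blast
  obtain k where k: "bij_betw k (ground M) (ground (restrict_to S X))" "indep (restrict_to S X) = (`) k ` indep M"
    using iso unfolding isomorphic_def by blast
  obtain f where f: "bij_betw f (ground S) (ground (M_L D B0))" "indep (M_L D B0) = (`) f ` indep S"
    using iso' unfolding isomorphic_def by blast
  have Mg: "indep M \<subseteq> Pow (ground M)" "\<And>I J. I \<in> indep M \<Longrightarrow> J \<subseteq> I \<Longrightarrow> J \<in> indep M" and Sg: "indep S \<subseteq> Pow (ground S)"
    using mM mS by (simp_all add: matroid_def)
  interpret D: dimaze_system D B0 by (simp add: dimaze_system_def D)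
  let ?h = "f \<circ> k"
  have kX: "k ` ground M = X" "inj_on k (ground M)" using k(1) by (simp_all add: bij_betw_def restrict_to_def)
  have fV: "f ` ground S = pverts D" "inj_on f (ground S)" using f(1) by (simp_all add: bij_betw_def M_L_def)
  have lin: "J \<in> indep M \<longleftrightarrow> linkable D B0 (?h ` J)" if J: "J \<subseteq> ground M" for J
  proof -
    have kJ: "k ` J \<subseteq> X" using J kX by auto
    have "J \<in> indep M \<longleftrightarrow> k ` J \<in> indep (restrict_to S X)" by (rule isomorphic_indep[OF Mg(1) k J])
    also have "\<dots> \<longleftrightarrow> k ` J \<in> indep S" using kJ by (simp add: restrict_to_def)
    also have "\<dots> \<longleftrightarrow> f ` k ` J \<in> indep (M_L D B0)" by (rule isomorphic_indep[OF Sg f]) (use kJ S(2) in auto)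
    also have "\<dots> \<longleftrightarrow> linkable D B0 (?h ` J)" by (simp add: M_L_def image_comp)
    finally show ?thesis .
  qed
  have h: "inj_on ?h (ground M)" "?h ` ground M \<subseteq> pverts D"
    using comp_inj_on[OF kX(2), of f] inj_on_subset[OF fV(2), of X] kX(1) fV(1) S(2) by auto
  have eq: "J \<in> indep M \<longleftrightarrow> D.ind (?h ` J)" if J: "J \<subseteq> ground M" for J
  proof
    assume "J \<in> indep M"
    then show "D.ind (?h ` J)" using lin[OF J] D.linkable_ind by simp
  next
    assume i: "D.ind (?h ` J)"
    have "F \<in> indep M" if F: "F \<subseteq> J" "finite F" for F
    proof -
      have "D.ind (?h ` F)" by (rule D.ind_subset[OF i]) (use F in auto)
      then have "linkable D B0 (?h ` F)" by (rule D.finite_ind_linkable[rotated]) (use F in simp)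
      then show ?thesis using lin[of F] F J by auto
    qed
    then show "J \<in> indep M" using fM J by (simp add: finitary_def)
  qed
  have "indep M = {J. J \<subseteq> ground M \<and> dimaze_ind D B0 (?h ` J)}"
    using eq Mg(1) unfolding dimaze_ind_def by blast
  then have "presented M ?h D B0" using D h by (simp add: presented_def)
  then show thesis by (rule that)
qed

lemma topological_gammoid_presented:
  assumes "topological_gammoid TYPE('v) M"
  obtains h and D :: "'v pair_pre_digraph" and B0 where "presented M h D B0"
proof -
  obtain S :: "'v set_system" and X where mM: "matroid M" and S: "strict_topological_gammoid S" "X \<subseteq> ground S"
    and iso: "isomorphic M (restrict_to S X)" using assms unfolding topological_gammoid_def by blast
  obtain D :: "'v pair_pre_digraph" and B0 where D: "dimaze D B0" and SD: "S = M_TL D B0"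
    using S(1) unfolding strict_topological_gammoid_def by blast
  obtain k where k: "bij_betw k (ground M) (ground (restrict_to S X))" "indep (restrict_to S X) = (`) k ` indep M"
    using iso unfolding isomorphic_def by blast
  have Mg: "indep M \<subseteq> Pow (ground M)" using mM by (simp add: matroid_def)
  interpret D: dimaze_system D B0 by (simp add: dimaze_system_def D)
  have kX: "k ` ground M = X" "inj_on k (ground M)" using k(1) by (simp_all add: bij_betw_def restrict_to_def)
  have eq: "J \<in> indep M \<longleftrightarrow> D.ind (k ` J)" if J: "J \<subseteq> ground M" for J
  proof -
    have kJ: "k ` J \<subseteq> X" using J kX by auto
    have "J \<in> indep M \<longleftrightarrow> k ` J \<in> indep (restrict_to S X)" by (rule isomorphic_indep[OF Mg k J])
    also have "\<dots> \<longleftrightarrow> D.ind (k ` J)" using kJ by (simp add: restrict_to_def SD D.M_TL_eq)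
    finally show ?thesis .
  qed
  have "indep M = {J. J \<subseteq> ground M \<and> dimaze_ind D B0 (k ` J)}"
    using eq Mg unfolding dimaze_ind_def by blast
  then have "presented M k D B0" using D kX S(2) by (simp add: presented_def SD D.M_TL_eq)
  then show thesis by (rule that)
qed

theorem theorem2p17:
  shows "(\<forall>M N :: 'a set_system.
            finitary_gammoid TYPE('v) M \<and> minor_of N M \<longrightarrow>
            finitary_gammoid TYPE('v enlarged) N) \<and>
         (\<forall>M N :: 'a set_system.
            topological_gammoid TYPE('v) M \<and> minor_of N M \<longrightarrow>
            topological_gammoid TYPE('v enlarged) N)"
proof (intro conjI allI impI; elim conjE)
  \<comment> \<open>The reversed dimaze uses only vertices of the old one, so the enlarged type is
    reached by a mere renaming.\<close>
  have g: "inj (\<lambda>v :: 'v. {Inl v} :: 'v enlarged)" by (auto simp: inj_def)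
  fix M N :: "'a set_system" assume N: "minor_of N M"
  {
    assume "finitary_gammoid TYPE('v) M"
    then obtain h and D :: "'v pair_pre_digraph" and B0 where "presented M h D B0"
      by (rule finitary_gammoid_presented)
    from presented_minor[OF this N g] show "finitary_gammoid TYPE('v enlarged) N"
      by (elim exE conjE) (rule presented_gammoid(1))
  }
  {
    assume "topological_gammoid TYPE('v) M"
    then obtain h and D :: "'v pair_pre_digraph" and B0 where "presented M h D B0"
      by (rule topological_gammoid_presented)
    from presented_minor[OF this N g] show "topological_gammoid TYPE('v enlarged) N"
      by (elim exE conjE) (rule presented_gammoid(2))
  }
qed

end
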